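(* Consider the model problem, finite element spaces, residual error estimators $\eta_H,\zeta_{1,H},\dots,\zeta_{N,H}$ and the adaptive algorithm NGO-AFEM described in the context. Suppose stability (A1), reduction (A2), discrete reliability (A4), and quasi-monotonicity (QM) for these estimators. Let $\Delta_\ell:=\eta_\ell\sum_{i=1}^N\zeta_{i,\ell}$ for $\ell\in\mathbb N_0$, define $\theta_\star:=1/(1+C_{\rm stab}^2C_{\rm drel}^2)$ and, for $s,t>0$, $$C_0:=\max_{k=0,\dots,N-2}\#\mathcal M_k\,\Delta_k^{1/(s+t)} .$$ Let $0<\theta<\theta_\star$ and $0<\varrho_{\rm irr}<(1-q_{\rm est})/(N-1)$, where $0<q_{\rm est}:=[1-(1-q_{\rm red}^2)\,\theta]^{1/2}<1$. Then the algorithm NGO-AFEM guarantees, for all rates $s,t>0$, that $$\sup_{\ell\in\mathbb N_0}(\#\mathcal T_\ell-\#\mathcal T_0+1)^{s+t}\,\Delta_\ell\le C_{\rm opt}\,\max\Big\{C_0^{\,s+t},\ \max_{j=1,\dots,N}\|u^\star\|_{\mathbb A_s}\,\|z_j^\star\|_{\mathbb A_t}\Big\},$$ where $C_{\rm opt}>0$ depends only on the constants in (A1), (A2), (A4), (QM), and on $C_{\rm mark}$, $\theta$, $\varrho_{\rm irr}$, $s$, $t$, $N$, the initial mesh $\mathcal T_0$, and the mesh-closure constant $C_{\rm mesh}$.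
   Context: **Model problem.** $\Omega\subset\mathbb R^d$ is a bounded Lipschitz domain, $d\in\mathbb N$; $\boldsymbol A\in[L^\infty(\Omega)]^{d\times d}_{\rm sym}$ is uniformly positive definite; $f\in L^2(\Omega)$, $\boldsymbol f\in[L^2(\Omega)]^d$; $N\in\mathbb N$ with $N\ge2$; $g_j\in L^2(\Omega)$, $\boldsymbol g_j\in[L^2(\Omega)]^d$ for $j=1,\dots,N$. Put $a(u,v)=\int_\Omega(\boldsymbol A\nabla u)^\top\nabla v\,dx$, $F(v)=\int_\Omega(fv+\boldsymbol f^\top\nabla v)\,dx$, $G_j(v)=\int_\Omega(g_jv+\boldsymbol g_j^\top\nabla v)\,dx$, and $|||v|||^2=a(v,v)$ on $H^1_0(\Omega)$. The primal solution $u^\star$ and dual solutions $z_j^\star$ in $H^1_0(\Omega)$ solve $a(u^\star,v)=F(v)$ and $a(v,z_j^\star)=G_j(v)$ for all $v\in H^1_0(\Omega)$. **Meshes and spaces.** $\mathcal T_0$ is a conforming simplicial triangulation of $\Omega$. Meshes are refined by newest vertex bisection (NVB): for a mesh $\mathcal T_H$ and $\mathcal M_H\subseteq\mathcal T_H$, $\mathtt{refine}(\mathcal T_H,\mathcal M_H)$ is the coarsest conforming NVB refinement of $\mathcal T_H$ in which all elements of $\mathcal M_H$ have been refined. $\mathbb T(\mathcal T_H)$ is the set of all meshes obtained from $\mathcal T_H$ by finitely many such steps, and $\mathbb T:=\mathbb T(\mathcal T_0)$. The mesh-closure estimate is known for NVB: $\#\mathcal T_\ell-\#\mathcal T_0\le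 C_{\rm mesh}\sum_{k=0}^{\ell-1}\#\mathcal M_k$ for every sequence $\mathcal T_{k+1}=\mathtt{refine}(\mathcal T_k,\mathcal M_k)$, with the mesh-closure constant $C_{\rm mesh}$ depending only on $d$ and $\mathcal T_0$. For fixed $p\in\mathbb N$, $\mathcal X_H=\{v\in H_0^1(\Omega): v|_T\text{ is a polynomial of degree}\le p\text{ for all }T\in\mathcal T_H\}$. The discrete solutions $u_H^\star,z_{j,H}^\star\in\mathcal X_H$ solve $a(u_H^\star,v_H)=F(v_H)$, $a(v_H,z_{j,H}^\star)=G_j(v_H)$ for all $v_H\in\mathcal X_H$. Quantities on $\mathcal T_H,\mathcal T_h,\mathcal T_\ell$ carry the index $H,h,\ell$. **Estimators.** Assume $\boldsymbol A|_T\in[W^{1,\infty}(T)]^{d\times d}$ and $\boldsymbol f|_T,\boldsymbol g_j|_T\in[H^1(T)]^d$ for all elements $T$. With $h_T=|T|^{1/d}$, $[\![\cdot]\!]$ the jump across interior faces and $\boldsymbol n$ the normal, for $v_H\in\mathcal X_H$, $$\eta_H(T;v_H)^2=h_T^2\|f+\mathrm{div}(\boldsymbol A\nabla v_H-\boldsymbol f)\|_{L^2(T)}^2+h_T\|[\![(\boldsymbol A\nabla v_H-\boldsymbol f)^\top\boldsymbol n]\!]\|_{L^2(\partial T\cap\Omega)}^2,$$ and $\zeta_{j,H}(T;v_H)$ is defined identically with $(g_j,\boldsymbol g_j)$ in place of $(f,\boldsymbol f)$. For $\mu_H\in\{\eta_H,\zeta_{1,H},\dots,\zeta_{N,H}\}$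 and $\mathcal U_H\subseteq\mathcal T_H$: $\mu_H(\mathcal U_H;v_H)^2=\sum_{T\in\mathcal U_H}\mu_H(T;v_H)^2$ and $\mu_H(v_H)=\mu_H(\mathcal T_H;v_H)$; if the argument $v_H$ is omitted, the corresponding discrete solution is inserted ($u_H^\star$ for $\eta_H$, $z_{j,H}^\star$ for $\zeta_{j,H}$). **Properties of the estimators.** There are constants $C_{\rm stab},C_{\rm drel},C_{\rm mon}>0$ and $0<q_{\rm red}<1$ such that for each $\mu\in\{\eta,\zeta_1,\dots,\zeta_N\}$ (with $w_H^\star$ the corresponding discrete solution: $u_H^\star$ for $\eta$, $z_{j,H}^\star$ for $\zeta_j$), all $\mathcal T_H\in\mathbb T$, $\mathcal T_h\in\mathbb T(\mathcal T_H)$, $\mathcal U_H\subseteq\mathcal T_h\cap\mathcal T_H$, $v_H\in\mathcal X_H$, $v_h\in\mathcal X_h$: (A1) stability: $|\mu_h(\mathcal U_H;v_h)-\mu_H(\mathcal U_H;v_H)|\le C_{\rm stab}|||v_h-v_H|||$; (A2) reduction: $\mu_h(\mathcal T_h\setminus\mathcal T_H;v_H)\le q_{\rm red}\,\mu_H(\mathcal T_H\setminus\mathcal T_h;v_H)$; (A4) discrete reliability: $|||w_h^\star-w_H^\star|||\le C_{\rm drel}\,\mu_H(\mathcal T_H\setminus\mathcal T_h)$; (QM) quasi-monotonicity: $\mu_h\le C_{\rm mon}\,\mu_H$. (These are known to hold for the residual estimators $\eta_H,\zeta_{1,H},\dots,\zeta_{N,H}$ with the local contributions $\eta_H(T;v_H)$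 and $\zeta_{j,H}(T;v_H)$, with $q_{\rm red}=2^{-1/(2d)}$. Discrete reliability (A4) implies reliability: $|||w^\star-w_H^\star|||\le C_{\rm rel}\,\mu_H$ with $C_{\rm rel}\le C_{\rm drel}$.) **Approximation classes.** For $n\in\mathbb N_0$ let $\mathbb T_n=\{\mathcal T_H\in\mathbb T:\#\mathcal T_H-\#\mathcal T_0\le n\}$. For $r>0$ and $w^\star\in\{u^\star,z_1^\star,\dots,z_N^\star\}$, $\|w^\star\|_{\mathbb A_r}:=\sup_{n\in\mathbb N_0}\big((n+1)^r\min_{\mathcal T_{\rm opt}\in\mathbb T_n}\mu_{\rm opt}\big)\in[0,\infty]$, where $\mu_{\rm opt}$ is the estimator on $\mathcal T_{\rm opt}$ (evaluated at its discrete solution) corresponding to $w^\star$: $\eta_{\rm opt}$ for $u^\star$, $\zeta_{j,\rm opt}$ for $z_j^\star$. **Dörfler marking.** $\mathbb M[\theta,\infty;\mathcal T_H,\mu_H]$ is the set of all $\mathcal U_H\subseteq\mathcal T_H$ with $\theta\,\mu_H^2\le\mu_H(\mathcal U_H)^2$. For $C_{\rm mark}\ge1$, $\mathbb M[\theta,C_{\rm mark};\mathcal T_H,\mu_H]$ consists of those $\mathcal M_H$ in it with $\#\mathcal M_H\le C_{\rm mark}\min\{\#\mathcal U_H:\mathcal U_H\in\mathbb M[\theta,\infty;\mathcal T_H,\mu_H]\}$. **Algorithm NGO-AFEM.** Input: $\mathcal T_0$, goals $G_1,\dots,G_N$, parameters $0<\theta\le1$, $0<\varrho_{\rm irr}<1/(N-1)$,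 $C_{\rm mark}\ge1$. Set $\zeta^{\rm active}_{-k}:=0$ for $1\le k\le N$. For $\ell=0,1,2,\dots$: (i) Compute $u_\ell^\star$ and $\eta_\ell(T)$ for $T\in\mathcal T_\ell$; pick $\mathcal M_\ell^u\in\mathbb M[\theta,C_{\rm mark};\mathcal T_\ell,\eta_\ell]$. (ii) Let $j:=\mathrm{mod}(\ell,N)+1$. Compute $z_{j,\ell}^\star$ and $\zeta_\ell^{\rm active}(T):=\zeta_{j,\ell}(T)$ for $T\in\mathcal T_\ell$ (so $\zeta_\ell^{\rm active}=\zeta_{j,\ell}$); pick $\mathcal M_\ell^z\in\mathbb M[\theta,C_{\rm mark};\mathcal T_\ell,\zeta_{j,\ell}]$. (iii.a) Pick $\mathcal M_\ell^{\min}\in\{\mathcal M_\ell^u,\mathcal M_\ell^z\}$ of cardinality $\min\{\#\mathcal M_\ell^u,\#\mathcal M_\ell^z\}$ and choose $\mathcal M_\ell^{uz}$ with $\mathcal M_\ell^{\min}\subseteq\mathcal M_\ell^{uz}\subseteq\mathcal M_\ell^u\cup\mathcal M_\ell^z$ and $\#\mathcal M_\ell^{uz}\le C_{\rm mark}\#\mathcal M_\ell^{\min}$. (iii.b) If $\varrho_{\rm irr}\max_{i=1,\dots,N-1}\zeta^{\rm active}_{\ell-i}\le\zeta^{\rm active}_\ell$, set $\mathcal M_\ell:=\mathcal M_\ell^{uz}$; otherwise choose any $\mathcal M_\ell\subseteq\mathcal M_\ell^{uz}$ with $\#\mathcal M_\ell\le\#\mathcal M_{\ell-1}$ ($\mathcal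 M_\ell=\emptyset$ is allowed). (iv) $\mathcal T_{\ell+1}:=\mathtt{refine}(\mathcal T_\ell,\mathcal M_\ell)$. Here $\zeta_{i,\ell}$ in $\Delta_\ell$ denotes the dual estimator with the exact discrete dual solution $z_{i,\ell}^\star\in\mathcal X_\ell$, whether or not the algorithm computes it. *)

theory Defs
  imports "HOL-Analysis.Analysis"
begin

section \<open>Sobolev spaces\<close>

text \<open>
  Functions on an open set \<open>S\<close> are represented by total functions, of which only the class modulo
  equality almost everywhere on \<open>S\<close> matters.
\<close>

definition L2_on :: "'a::euclidean_space set \<Rightarrow> ('a \<Rightarrow> 'b::euclidean_space) \<Rightarrow> bool" where
  "L2_on S f \<longleftrightarrow> f \<in> borel_measurable (lebesgue_on S) \<and>
     integrable (lebesgue_on S) (\<lambda>x. (norm (f x))\<^sup>2)"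

definition Linf_on :: "'a::euclidean_space set \<Rightarrow> ('a \<Rightarrow> 'b::euclidean_space) \<Rightarrow> bool" where
  "Linf_on S f \<longleftrightarrow> f \<in> borel_measurable (lebesgue_on S) \<and>
     (\<exists>C. AE x in lebesgue_on S. norm (f x) \<le> C)"

definition partial_deriv :: "'n \<Rightarrow> (real^'n::finite \<Rightarrow> real) \<Rightarrow> real^'n \<Rightarrow> real" where
  "partial_deriv i \<phi> x = frechet_derivative \<phi> (at x) (axis i 1)"

definition gradient :: "(real^'n::finite \<Rightarrow> real) \<Rightarrow> real^'n \<Rightarrow> real^'n" where
  "gradient \<phi> x = (\<chi> i. partial_deriv i \<phi> x)"

primrec Ck :: "nat \<Rightarrow> (real^'n::finite \<Rightarrow> real) \<Rightarrow> bool" where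
  "Ck 0 \<phi> \<longleftrightarrow> continuous_on UNIV \<phi>"
| "Ck (Suc k) \<phi> \<longleftrightarrow> (\<forall>x. \<phi> differentiable (at x)) \<and> (\<forall>i. Ck k (partial_deriv i \<phi>))"

definition smooth :: "(real^'n::finite \<Rightarrow> real) \<Rightarrow> bool" where
  "smooth \<phi> \<longleftrightarrow> (\<forall>k. Ck k \<phi>)"

definition test_functions :: "(real^'n::finite) set \<Rightarrow> (real^'n \<Rightarrow> real) set" where
  "test_functions S = {\<phi>. smooth \<phi> \<and> compact (closure {x. \<phi> x \<noteq> 0}) \<and> closure {x. \<phi> x \<noteq> 0} \<subseteq> S}"

text \<open>
  The next two predicates are only meaningful for locally integrable arguments; below they are always
  combined with membership in \<open>L\<^sup>2\<close> or \<open>L\<^sup>\<infinity>\<close>.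
\<close>

definition is_weak_gradient ::
    "(real^'n::finite) set \<Rightarrow> (real^'n \<Rightarrow> real) \<Rightarrow> (real^'n \<Rightarrow> real^'n) \<Rightarrow> bool" where
  "is_weak_gradient S v g \<longleftrightarrow> (\<forall>\<phi>\<in>test_functions S. \<forall>i.
     (LINT x|lebesgue_on S. v x * partial_deriv i \<phi> x) = - (LINT x|lebesgue_on S. g x $ i * \<phi> x))"

definition is_weak_divergence ::
    "(real^'n::finite) set \<Rightarrow> (real^'n \<Rightarrow> real^'n) \<Rightarrow> (real^'n \<Rightarrow> real) \<Rightarrow> bool" where
  "is_weak_divergence S w h \<longleftrightarrow> (\<forall>\<phi>\<in>test_functions S.
     (LINT x|lebesgue_on S. w x \<bullet> gradient \<phi> x) = - (LINT x|lebesgue_on S. h x * \<phi> x))"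

definition H1 :: "(real^'n::finite) set \<Rightarrow> (real^'n \<Rightarrow> real) set" where
  "H1 S = {v. L2_on S v \<and> (\<exists>g. L2_on S g \<and> is_weak_gradient S v g)}"

definition W1inf :: "(real^'n::finite) set \<Rightarrow> (real^'n \<Rightarrow> real) set" where
  "W1inf S = {v. Linf_on S v \<and> (\<exists>g. Linf_on S g \<and> is_weak_gradient S v g)}"

text \<open>Weak gradient and weak divergence, unique up to a null set of \<open>S\<close>.\<close>

definition wgrad :: "(real^'n::finite) set \<Rightarrow> (real^'n \<Rightarrow> real) \<Rightarrow> real^'n \<Rightarrow> real^'n" where
  "wgrad S v = (SOME g. L2_on S g \<and> is_weak_gradient S v g)"

definition wdiv :: "(real^'n::finite) set \<Rightarrow> (real^'n \<Rightarrow> real^'n) \<Rightarrow> real^'n \<Rightarrow> real" where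
  "wdiv S w = (SOME h. L2_on S h \<and> is_weak_divergence S w h)"

definition H1_converges ::
    "(real^'n::finite) set \<Rightarrow> (nat \<Rightarrow> real^'n \<Rightarrow> real) \<Rightarrow> (real^'n \<Rightarrow> real) \<Rightarrow> bool" where
  "H1_converges S \<phi> v \<longleftrightarrow>
     (\<lambda>k. LINT x|lebesgue_on S. (\<phi> k x - v x)\<^sup>2) \<longlonglongrightarrow> 0 \<and>
     (\<lambda>k. LINT x|lebesgue_on S. (norm (gradient (\<phi> k) x - wgrad S v x))\<^sup>2) \<longlonglongrightarrow> 0"

definition H10 :: "(real^'n::finite) set \<Rightarrow> (real^'n \<Rightarrow> real) set" where
  "H10 S = {v \<in> H1 S. \<exists>\<phi>. (\<forall>k. \<phi> k \<in> test_functions S) \<and> H1_converges S \<phi> v}"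


section \<open>Model problem\<close>

text \<open>
  Around each boundary point the domain is the strict subgraph, in some direction \<open>e\<close>, of a Lipschitz
  function of the component orthogonal to \<open>e\<close>.
\<close>

definition lipschitz_domain :: "(real^'n::finite) set \<Rightarrow> bool" where
  "lipschitz_domain \<Omega> \<longleftrightarrow> open \<Omega> \<and> connected \<Omega> \<and> \<Omega> \<noteq> {} \<and>
     (\<forall>x\<in>frontier \<Omega>. \<exists>r>0. \<exists>e L \<gamma>. norm e = 1 \<and> L-lipschitz_on UNIV (\<gamma> :: real^'n \<Rightarrow> real) \<and>
        (\<forall>y\<in>ball x r. y \<in> \<Omega> \<longleftrightarrow> y \<bullet> e < \<gamma> (y - (y \<bullet> e) *\<^sub>R e)))"

definition uniformly_spd :: "(real^'n::finite) set \<Rightarrow> (real^'n \<Rightarrow> real^'n^'n) \<Rightarrow> bool" where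
  "uniformly_spd \<Omega> A \<longleftrightarrow> (AE x in lebesgue_on \<Omega>. transpose (A x) = A x) \<and>
     (\<exists>c>0. AE x in lebesgue_on \<Omega>. \<forall>\<xi>. c * (norm \<xi>)\<^sup>2 \<le> (A x *v \<xi>) \<bullet> \<xi>)"

definition bilin ::
    "(real^'n::finite) set \<Rightarrow> (real^'n \<Rightarrow> real^'n^'n) \<Rightarrow> (real^'n \<Rightarrow> real) \<Rightarrow> (real^'n \<Rightarrow> real) \<Rightarrow> real" where
  "bilin \<Omega> A u v = (LINT x|lebesgue_on \<Omega>. (A x *v wgrad \<Omega> u x) \<bullet> wgrad \<Omega> v x)"

definition energy_norm ::
    "(real^'n::finite) set \<Rightarrow> (real^'n \<Rightarrow> real^'n^'n) \<Rightarrow> (real^'n \<Rightarrow> real) \<Rightarrow> real" where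
  "energy_norm \<Omega> A v = sqrt (bilin \<Omega> A v v)"

definition functional ::
    "(real^'n::finite) set \<Rightarrow> (real^'n \<Rightarrow> real) \<Rightarrow> (real^'n \<Rightarrow> real^'n) \<Rightarrow> (real^'n \<Rightarrow> real) \<Rightarrow> real" where
  "functional \<Omega> f ff v = (LINT x|lebesgue_on \<Omega>. f x * v x + ff x \<bullet> wgrad \<Omega> v x)"

definition solves_primal ::
    "(real^'n::finite) set \<Rightarrow> (real^'n \<Rightarrow> real^'n^'n) \<Rightarrow> (real^'n \<Rightarrow> real) \<Rightarrow> (real^'n \<Rightarrow> real^'n) \<Rightarrow>
     (real^'n \<Rightarrow> real) set \<Rightarrow> (real^'n \<Rightarrow> real) \<Rightarrow> bool" where
  "solves_primal \<Omega> A f ff V u \<longleftrightarrow> u \<in> V \<and> (\<forall>v\<in>V. bilin \<Omega> A u v = functional \<Omega> f ff v)"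

definition solves_dual ::
    "(real^'n::finite) set \<Rightarrow> (real^'n \<Rightarrow> real^'n^'n) \<Rightarrow> (real^'n \<Rightarrow> real) \<Rightarrow> (real^'n \<Rightarrow> real^'n) \<Rightarrow>
     (real^'n \<Rightarrow> real) set \<Rightarrow> (real^'n \<Rightarrow> real) \<Rightarrow> bool" where
  "solves_dual \<Omega> A g gg V z \<longleftrightarrow> z \<in> V \<and> (\<forall>v\<in>V. bilin \<Omega> A v z = functional \<Omega> g gg v)"


section \<open>Simplicial meshes and newest vertex bisection\<close>

text \<open>
  An element is a simplex together with an ordering \<open>z\<^sub>0, \<dots>, z\<^sub>d\<close> of its vertices and a type in
  \<open>{0..<d}\<close>, where \<open>d = CARD('n)\<close>. The refinement edge joins \<open>z\<^sub>0\<close> and \<open>z\<^sub>d\<close>.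
\<close>

type_synonym 'n element = "(real^'n) list \<times> nat"
type_synonym 'n mesh = "'n element set"

definition vertices :: "'n::finite element \<Rightarrow> (real^'n) set" where
  "vertices K = set (fst K)"

definition simplex_of :: "'n::finite element \<Rightarrow> (real^'n) set" where
  "simplex_of K = convex hull (vertices K)"

definition is_element :: "'n::finite element \<Rightarrow> bool" where
  "is_element K \<longleftrightarrow> length (fst K) = CARD('n) + 1 \<and> distinct (fst K) \<and>
     \<not> affine_dependent (vertices K) \<and> snd K < CARD('n)"

definition conforming :: "'n::finite mesh \<Rightarrow> bool" where
  "conforming T \<longleftrightarrow> (\<forall>K\<in>T. \<forall>K'\<in>T.
     simplex_of K \<inter> simplex_of K' = convex hull (vertices K \<inter> vertices K'))"

text \<open>Injectivity of \<open>vertices\<close> excludes several copies of one simplex with different orderings or types.\<close>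

definition conforming_triangulation :: "(real^'n::finite) set \<Rightarrow> 'n mesh \<Rightarrow> bool" where
  "conforming_triangulation \<Omega> T \<longleftrightarrow> finite T \<and> (\<forall>K\<in>T. is_element K) \<and> inj_on vertices T \<and>
     conforming T \<and> (\<Union>K\<in>T. simplex_of K) = closure \<Omega>"

text \<open>
  Bisection rule of Maubach and Traxler, in the form used by Stevenson: with \<open>m = (z\<^sub>0 + z\<^sub>d) / 2\<close>, the
  children of \<open>(z\<^sub>0, \<dots>, z\<^sub>d)\<close> of type \<open>\<gamma>\<close> are
  \<open>(z\<^sub>0, m, z\<^sub>1, \<dots>, z\<^sub>d\<^sub>-\<^sub>1)\<close> and \<open>(z\<^sub>d, m, z\<^sub>1, \<dots>, z\<^sub>\<gamma>, z\<^sub>d\<^sub>-\<^sub>1, \<dots>, z\<^sub>\<gamma>\<^sub>+\<^sub>1)\<close>, both of type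
  \<open>\<gamma> + 1\<close> modulo \<open>d\<close>. For \<open>d = 2\<close> the type is immaterial and \<open>z\<^sub>1\<close> is the newest vertex.
\<close>

definition children :: "'n::finite element \<Rightarrow> 'n element set" where
  "children K = (let d = CARD('n); z = (\<lambda>i. fst K ! i); \<gamma> = snd K; m = midpoint (z 0) (z d) in
     {(z 0 # m # map z [1..<d], Suc \<gamma> mod d),
      (z d # m # map z ([1..<Suc \<gamma>] @ rev [Suc \<gamma>..<d]), Suc \<gamma> mod d)})"

definition bisection_step :: "'n::finite mesh \<Rightarrow> 'n mesh \<Rightarrow> bool" where
  "bisection_step T T' \<longleftrightarrow> (\<exists>K\<in>T. T' = (T - {K}) \<union> children K)"

text \<open>Refinements by bisection of single elements; hanging nodes are allowed.\<close>

abbreviation nvb_refinement :: "'n::finite mesh \<Rightarrow> 'n mesh \<Rightarrow> bool" where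
  "nvb_refinement \<equiv> bisection_step\<^sup>*\<^sup>*"

text \<open>
  The relation \<open>T' = refine(T, M)\<close>. It is a relation because, for \<open>d \<ge> 3\<close> and arbitrary vertex orderings
  and types, a conforming refinement need not exist; if one exists, the coarsest one is unique.
\<close>

definition is_refine :: "'n::finite mesh \<Rightarrow> 'n mesh \<Rightarrow> 'n mesh \<Rightarrow> bool" where
  "is_refine T M T' \<longleftrightarrow> M \<subseteq> T \<and> nvb_refinement T T' \<and> conforming T' \<and> M \<inter> T' = {} \<and>
     (\<forall>T''. nvb_refinement T T'' \<and> conforming T'' \<and> M \<inter> T'' = {} \<longrightarrow> nvb_refinement T' T'')"

inductive_set meshes :: "'n::finite mesh \<Rightarrow> 'n mesh set" for T where
  base: "T \<in> meshes T"
| step: "T' \<in> meshes T \<Longrightarrow> is_refine T' M T'' \<Longrightarrow> T'' \<in> meshes T"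

definition mesh_closure :: "'n::finite mesh \<Rightarrow> real \<Rightarrow> bool" where
  "mesh_closure T0 Cmesh \<longleftrightarrow> (\<forall>T M l. T 0 = T0 \<and> (\<forall>k<l. is_refine (T k) (M k) (T (Suc k))) \<longrightarrow>
     real (card (T l)) - real (card T0) \<le> Cmesh * (\<Sum>k<l. real (card (M k))))"

definition meshes_upto :: "'n::finite mesh \<Rightarrow> nat \<Rightarrow> 'n mesh set" where
  "meshes_upto T0 n = {T \<in> meshes T0. card T - card T0 \<le> n}"


section \<open>Finite element spaces\<close>

definition poly_fun :: "nat \<Rightarrow> (real^'n::finite \<Rightarrow> real) \<Rightarrow> bool" where
  "poly_fun p q \<longleftrightarrow> (\<exists>c. \<forall>x. q x = (\<Sum>\<alpha> | (\<Sum>i\<in>UNIV. \<alpha> i) \<le> p. c \<alpha> * (\<Prod>i\<in>UNIV. (x $ i) ^ \<alpha> i)))"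

definition fe_space :: "(real^'n::finite) set \<Rightarrow> nat \<Rightarrow> 'n mesh \<Rightarrow> (real^'n \<Rightarrow> real) set" where
  "fe_space \<Omega> p T = {v \<in> H10 \<Omega>. \<forall>K\<in>T. \<exists>q. poly_fun p q \<and> (AE x in lebesgue_on (simplex_of K). v x = q x)}"


section \<open>Residual error estimators\<close>

text \<open>Outer unit normal of the full-dimensional simplex \<open>S\<close> on its \<open>(d-1)\<close>-dimensional face \<open>F\<close>.\<close>

definition outer_normal :: "(real^'n::finite) set \<Rightarrow> (real^'n) set \<Rightarrow> real^'n" where
  "outer_normal S F = (THE n. norm n = 1 \<and> (\<forall>x\<in>F. \<forall>y\<in>S. n \<bullet> y \<le> n \<bullet> x))"

text \<open>
  Surface measure on a flat \<open>(d-1)\<close>-dimensional set \<open>F\<close> with unit normal \<open>n\<close>: by Fubini it is the image,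
  under orthogonal projection onto the hyperplane of \<open>F\<close>, of Lebesgue measure on the prism of height one
  over \<open>F\<close>. For \<open>d = 1\<close> it is the unit point mass.
\<close>

definition surface_measure :: "real^'n::finite \<Rightarrow> (real^'n) set \<Rightarrow> (real^'n) measure" where
  "surface_measure n F =
     distr (restrict_space lborel {x + t *\<^sub>R n | x t. x \<in> F \<and> t \<in> {0..1}}) borel
       (\<lambda>y. y - ((y - (SOME x. x \<in> F)) \<bullet> n) *\<^sub>R n)"

text \<open>
  Trace on the face \<open>F\<close> of a function in \<open>H\<^sup>1\<close> of the interior of the simplex \<open>S\<close>: continuous extension of
  the restriction of smooth functions. It is unique up to a null set of the surface measure.
\<close>

definition is_face_trace ::
    "(real^'n::finite) set \<Rightarrow> (real^'n) set \<Rightarrow> (real^'n \<Rightarrow> real) \<Rightarrow> (real^'n \<Rightarrow> real) \<Rightarrow> bool" where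
  "is_face_trace S F w \<tau> \<longleftrightarrow> (let \<sigma> = surface_measure (outer_normal S F) F in
     w \<in> H1 (interior S) \<and> \<tau> \<in> borel_measurable \<sigma> \<and> integrable \<sigma> (\<lambda>x. (\<tau> x)\<^sup>2) \<and>
     (\<exists>\<phi>. (\<forall>k. smooth (\<phi> k)) \<and> H1_converges (interior S) \<phi> w \<and>
        (\<lambda>k. LINT x|\<sigma>. (\<phi> k x - \<tau> x)\<^sup>2) \<longlonglongrightarrow> 0))"

definition face_trace ::
    "(real^'n::finite) set \<Rightarrow> (real^'n) set \<Rightarrow> (real^'n \<Rightarrow> real) \<Rightarrow> real^'n \<Rightarrow> real" where
  "face_trace S F w = (SOME \<tau>. is_face_trace S F w \<tau>)"

definition normal_trace ::
    "(real^'n::finite) set \<Rightarrow> (real^'n) set \<Rightarrow> (real^'n \<Rightarrow> real^'n) \<Rightarrow> real^'n \<Rightarrow> real" where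
  "normal_trace S F w x = (\<Sum>i\<in>UNIV. face_trace S F (\<lambda>y. w y $ i) x * outer_normal S F $ i)"

definition face_neighbours :: "'n::finite mesh \<Rightarrow> 'n element \<Rightarrow> 'n element set" where
  "face_neighbours T K = {K' \<in> T. K' \<noteq> K \<and> card (vertices K \<inter> vertices K') = CARD('n)}"

text \<open>
  The square of the norm of the normal jump of \<open>w\<close> over \<open>\<partial>K \<inter> \<Omega>\<close>, which up to a null set consists of the
  faces that \<open>K\<close> shares with another element. The jump is the sum of the two outer normal traces.
\<close>

definition jump_norm_sq ::
    "'n::finite mesh \<Rightarrow> 'n element \<Rightarrow> (real^'n \<Rightarrow> real^'n) \<Rightarrow> real" where
  "jump_norm_sq T K w = (\<Sum>K'\<in>face_neighbours T K.
     let S = simplex_of K; S' = simplex_of K'; F = S \<inter> S' in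
     LINT x|surface_measure (outer_normal S F) F. (normal_trace S F w x + normal_trace S' F w x)\<^sup>2)"

definition mesh_size :: "'n::finite element \<Rightarrow> real" where
  "mesh_size K = measure lebesgue (simplex_of K) powr (1 / real CARD('n))"

definition residual_indicator ::
    "(real^'n::finite) set \<Rightarrow> (real^'n \<Rightarrow> real^'n^'n) \<Rightarrow> (real^'n \<Rightarrow> real) \<Rightarrow> (real^'n \<Rightarrow> real^'n) \<Rightarrow>
     'n mesh \<Rightarrow> (real^'n \<Rightarrow> real) \<Rightarrow> 'n element \<Rightarrow> real" where
  "residual_indicator \<Omega> A f ff T v K =
     (let w = (\<lambda>x. A x *v wgrad \<Omega> v x - ff x); S = interior (simplex_of K); h = mesh_size K in
      sqrt (h\<^sup>2 * (LINT x|lebesgue_on S. (f x + wdiv S w x)\<^sup>2) + h * jump_norm_sq T K w))"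

definition est :: "('n::finite element \<Rightarrow> real) \<Rightarrow> 'n element set \<Rightarrow> real" where
  "est \<mu> U = sqrt (\<Sum>K\<in>U. (\<mu> K)\<^sup>2)"

text \<open>Regularity of the data; elementwise regularity on \<open>T0\<close> carries over to all refinements.\<close>

definition admissible_coefficient ::
    "(real^'n::finite) set \<Rightarrow> 'n mesh \<Rightarrow> (real^'n \<Rightarrow> real^'n^'n) \<Rightarrow> bool" where
  "admissible_coefficient \<Omega> T0 A \<longleftrightarrow> Linf_on \<Omega> A \<and> uniformly_spd \<Omega> A \<and>
     (\<forall>K\<in>T0. \<forall>i j. (\<lambda>x. A x $ i $ j) \<in> W1inf (interior (simplex_of K)))"

definition admissible_rhs ::
    "(real^'n::finite) set \<Rightarrow> 'n mesh \<Rightarrow> (real^'n \<Rightarrow> real) \<Rightarrow> (real^'n \<Rightarrow> real^'n) \<Rightarrow> bool" where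
  "admissible_rhs \<Omega> T0 f ff \<longleftrightarrow> L2_on \<Omega> f \<and> L2_on \<Omega> ff \<and>
     (\<forall>K\<in>T0. \<forall>i. (\<lambda>x. ff x $ i) \<in> H1 (interior (simplex_of K)))"


section \<open>Properties of the estimators\<close>

text \<open>
  Here \<open>\<mu> T v K\<close> is the local contribution of \<open>K \<in> T\<close> for the discrete function \<open>v\<close>, \<open>X T\<close> the discrete
  space, \<open>nrm\<close> the energy norm, and \<open>w T\<close> the discrete solution on \<open>T\<close>.
\<close>

definition stability ::
    "'n::finite mesh \<Rightarrow> ('n mesh \<Rightarrow> (real^'n \<Rightarrow> real) set) \<Rightarrow> ((real^'n \<Rightarrow> real) \<Rightarrow> real) \<Rightarrow> real \<Rightarrow>
     ('n mesh \<Rightarrow> (real^'n \<Rightarrow> real) \<Rightarrow> 'n element \<Rightarrow> real) \<Rightarrow> bool" where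
  "stability T0 X nrm Cstab \<mu> \<longleftrightarrow> (\<forall>TH\<in>meshes T0. \<forall>Th\<in>meshes TH. \<forall>U \<subseteq> Th \<inter> TH. \<forall>vH\<in>X TH. \<forall>vh\<in>X Th.
     \<bar>est (\<mu> Th vh) U - est (\<mu> TH vH) U\<bar> \<le> Cstab * nrm (\<lambda>x. vh x - vH x))"

definition reduction ::
    "'n::finite mesh \<Rightarrow> ('n mesh \<Rightarrow> (real^'n \<Rightarrow> real) set) \<Rightarrow> real \<Rightarrow> ('n mesh \<Rightarrow> (real^'n \<Rightarrow> real) \<Rightarrow> 'n element \<Rightarrow> real) \<Rightarrow> bool" where
  "reduction T0 X qred \<mu> \<longleftrightarrow> (\<forall>TH\<in>meshes T0. \<forall>Th\<in>meshes TH. \<forall>vH\<in>X TH.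
     est (\<mu> Th vH) (Th - TH) \<le> qred * est (\<mu> TH vH) (TH - Th))"

definition discrete_reliability ::
    "'n::finite mesh \<Rightarrow> ((real^'n \<Rightarrow> real) \<Rightarrow> real) \<Rightarrow> real \<Rightarrow> ('n mesh \<Rightarrow> (real^'n \<Rightarrow> real) \<Rightarrow> 'n element \<Rightarrow> real) \<Rightarrow>
     ('n mesh \<Rightarrow> real^'n \<Rightarrow> real) \<Rightarrow> bool" where
  "discrete_reliability T0 nrm Cdrel \<mu> w \<longleftrightarrow> (\<forall>TH\<in>meshes T0. \<forall>Th\<in>meshes TH.
     nrm (\<lambda>x. w Th x - w TH x) \<le> Cdrel * est (\<mu> TH (w TH)) (TH - Th))"

definition quasi_monotonicity ::
    "'n::finite mesh \<Rightarrow> real \<Rightarrow> ('n mesh \<Rightarrow> (real^'n \<Rightarrow> real) \<Rightarrow> 'n element \<Rightarrow> real) \<Rightarrow> ('n mesh \<Rightarrow> real^'n \<Rightarrow> real) \<Rightarrow> bool" where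
  "quasi_monotonicity T0 Cmon \<mu> w \<longleftrightarrow> (\<forall>TH\<in>meshes T0. \<forall>Th\<in>meshes TH.
     est (\<mu> Th (w Th)) Th \<le> Cmon * est (\<mu> TH (w TH)) TH)"

definition estimator_properties ::
    "'n::finite mesh \<Rightarrow> ('n mesh \<Rightarrow> (real^'n \<Rightarrow> real) set) \<Rightarrow> ((real^'n \<Rightarrow> real) \<Rightarrow> real) \<Rightarrow>
     real \<Rightarrow> real \<Rightarrow> real \<Rightarrow> real \<Rightarrow> ('n mesh \<Rightarrow> (real^'n \<Rightarrow> real) \<Rightarrow> 'n element \<Rightarrow> real) \<Rightarrow>
     ('n mesh \<Rightarrow> real^'n \<Rightarrow> real) \<Rightarrow> bool" where
  "estimator_properties T0 X nrm Cstab qred Cdrel Cmon \<mu> w \<longleftrightarrow>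
     stability T0 X nrm Cstab \<mu> \<and> reduction T0 X qred \<mu> \<and>
     discrete_reliability T0 nrm Cdrel \<mu> w \<and> quasi_monotonicity T0 Cmon \<mu> w"

text \<open>
  Approximation norm of the solution to which the estimator \<open>\<mu>\<close> belongs; \<open>\<mu> T\<close> is the total estimator on \<open>T\<close> at
  the discrete solution. The infimum is a minimum since \<open>meshes_upto T0 n\<close> is finite and nonempty.
\<close>

definition approx_norm :: "'n::finite mesh \<Rightarrow> real \<Rightarrow> ('n mesh \<Rightarrow> real) \<Rightarrow> ennreal" where
  "approx_norm T0 r \<mu> =
     (SUP n. ennreal ((real n + 1) powr r) * (INF T\<in>meshes_upto T0 n. ennreal (\<mu> T)))"

definition theta_star :: "real \<Rightarrow> real \<Rightarrow> real" where
  "theta_star Cstab Cdrel = 1 / (1 + Cstab\<^sup>2 * Cdrel\<^sup>2)"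

definition q_est :: "real \<Rightarrow> real \<Rightarrow> real" where
  "q_est qred \<theta> = sqrt (1 - (1 - qred\<^sup>2) * \<theta>)"


section \<open>Adaptive algorithm\<close>

definition doerfler :: "real \<Rightarrow> 'n::finite mesh \<Rightarrow> ('n element \<Rightarrow> real) \<Rightarrow> 'n element set set" where
  "doerfler \<theta> T \<mu> = {U. U \<subseteq> T \<and> \<theta> * (est \<mu> T)\<^sup>2 \<le> (est \<mu> U)\<^sup>2}"

definition doerfler_quasi_min ::
    "real \<Rightarrow> real \<Rightarrow> 'n::finite mesh \<Rightarrow> ('n element \<Rightarrow> real) \<Rightarrow> 'n element set set" where
  "doerfler_quasi_min \<theta> Cmark T \<mu> =
     {M \<in> doerfler \<theta> T \<mu>. real (card M) \<le> Cmark * real (Min (card ` doerfler \<theta> T \<mu>))}"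

text \<open>
  \<open>\<eta> T K\<close> and \<open>\<zeta> j T K\<close> are the local contributions at the respective discrete solutions on \<open>T\<close>.
\<close>

definition zeta_active ::
    "nat \<Rightarrow> (nat \<Rightarrow> 'n::finite mesh \<Rightarrow> 'n element \<Rightarrow> real) \<Rightarrow> (nat \<Rightarrow> 'n mesh) \<Rightarrow> int \<Rightarrow> real" where
  "zeta_active N \<zeta> T l =
     (if l < 0 then 0 else est (\<zeta> (nat l mod N + 1) (T (nat l))) (T (nat l)))"

text \<open>
  At \<open>l = 0\<close> the condition of the case distinction always holds, so that \<open>M (l - 1)\<close> is only used for \<open>l > 0\<close>.
\<close>

definition NGO_AFEM ::
    "nat \<Rightarrow> real \<Rightarrow> real \<Rightarrow> real \<Rightarrow> 'n::finite mesh \<Rightarrow>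
     ('n mesh \<Rightarrow> 'n element \<Rightarrow> real) \<Rightarrow> (nat \<Rightarrow> 'n mesh \<Rightarrow> 'n element \<Rightarrow> real) \<Rightarrow>
     (nat \<Rightarrow> 'n mesh) \<Rightarrow> (nat \<Rightarrow> 'n mesh) \<Rightarrow> (nat \<Rightarrow> 'n mesh) \<Rightarrow> (nat \<Rightarrow> 'n mesh) \<Rightarrow>
     (nat \<Rightarrow> 'n mesh) \<Rightarrow> (nat \<Rightarrow> 'n mesh) \<Rightarrow> bool" where
  "NGO_AFEM N \<theta> \<rho> Cmark T0 \<eta> \<zeta> T Mu Mz Mmin Muz M \<longleftrightarrow> T 0 = T0 \<and> (\<forall>l.
     Mu l \<in> doerfler_quasi_min \<theta> Cmark (T l) (\<eta> (T l)) \<and>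
     Mz l \<in> doerfler_quasi_min \<theta> Cmark (T l) (\<zeta> (l mod N + 1) (T l)) \<and>
     Mmin l \<in> {Mu l, Mz l} \<and> card (Mmin l) = min (card (Mu l)) (card (Mz l)) \<and>
     Mmin l \<subseteq> Muz l \<and> Muz l \<subseteq> Mu l \<union> Mz l \<and> real (card (Muz l)) \<le> Cmark * real (card (Mmin l)) \<and>
     (if \<rho> * Max ((\<lambda>i. zeta_active N \<zeta> T (int l - int i)) ` {1..N - 1}) \<le> zeta_active N \<zeta> T (int l)
      then M l = Muz l
      else M l \<subseteq> Muz l \<and> card (M l) \<le> card (M (l - 1))) \<and>
     is_refine (T l) (M l) (T (Suc l)))"

definition error_product ::
    "nat \<Rightarrow> ('n::finite mesh \<Rightarrow> 'n element \<Rightarrow> real) \<Rightarrow> (nat \<Rightarrow> 'n mesh \<Rightarrow> 'n element \<Rightarrow> real) \<Rightarrow>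
     'n mesh \<Rightarrow> real" where
  "error_product N \<eta> \<zeta> T = est (\<eta> T) T * (\<Sum>i=1..N. est (\<zeta> i T) T)"

end

theory Submission
  imports Defs "HOL-Computational_Algebra.Polynomial"
begin

text \<open>
  Galerkin orthogonality makes \<open>|||w\<^sub>h - w\<^sub>H|||\<^sup>2\<close> a difference of energies, so that
  perturbations along any subsequence of nested meshes are square summable; an estimator therefore
  decays geometrically in the number of steps in which it is Doerfler marked. Over sufficiently many
  consecutive steps at least one of the following happens: \<open>\<eta>\<close> is marked; some active \<open>\<zeta>\<^sub>j\<close> is marked in a
  regular step, where it dominates a fixed fraction of \<open>\<Sum>\<^sub>i \<zeta>\<^sub>i\<close>; or all steps are irregular, and then the
  active estimators, hence \<open>\<Sum>\<^sub>i \<zeta>\<^sub>i\<close>, shrink by powers of \<open>\<rho>\<close>. In each case one factor of \<open>\<Delta>\<close> contracts,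
  so \<open>\<Delta>\<close> converges linearly.
  For the rate, the overlay of two meshes and discrete reliability yield Doerfler sets of optimal size, so
  \<open>#M\<^sub>k\<close> is at most a multiple of \<open>(G / \<Delta>\<^sub>k)\<close> to the power \<open>1 / (s + t)\<close>, where \<open>G\<close> is the maximum on the
  right-hand side; summation over \<open>k\<close> with mesh closure and linear convergence concludes.
\<close>

section \<open>Geometry of bisection\<close>

text \<open>Two features of the setting shape the preparatory work. Meshes are generated by
  \<open>is_refine\<close>, a relation whose coarsest target must be shown to exist, whereas
  overlays arise from single bisections; conforming meets and joins of bisection refinements
  reconcile the two. Moreover, \<open>wgrad\<close> is a chosen representative, so its linearity,
  and with it the Galerkin identity for the energy norm, rests on uniqueness of weak gradients and
  hence on test functions that approximate boxes. In the convergence argument the obstacle is that a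
  step does not reveal which factor of \<Delta> profits from it, and neither factor is monotone. The
  steps are therefore cut into long blocks, each credited to exactly one factor; decay is measured
  only between starts of credited blocks, and the energy increments in between telescope. The marked
  sets of irregular steps carry no optimality. They are no larger than those of the preceding step,
  so their cost is traced back to a regular step or to one of the first \<open>N - 1\<close> steps;
  the latter are what \<open>C0\<close> pays for.\<close>

definition child_verts :: "'n::finite element \<Rightarrow> (real^'n) \<Rightarrow> (real^'n) set" where
  "child_verts K b = insert (midpoint (fst K ! 0) (fst K ! CARD('n))) (vertices K - {b})"

text \<open>Geometric arguments see only the vertex sets of the children; order and type merely
  decide which edge is bisected next.\<close>

lemma children_cases:
  fixes K :: "'n::finite element"
  assumes "is_element K"
  obtains c1 c2 where "children K = {c1, c2}"
    "length (fst c1) = CARD('n) + 1" "length (fst c2) = CARD('n) + 1"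
    "snd c1 < CARD('n)" "snd c2 < CARD('n)"
    "vertices c1 = child_verts K (fst K ! CARD('n))" "vertices c2 = child_verts K (fst K ! 0)"
proof -
  let ?d = "CARD('n)"
  obtain zs \<gamma> where K: "K = (zs, \<gamma>)" by fastforce
  have len: "length zs = ?d + 1" and dis: "distinct zs" and \<gamma>: "\<gamma> < ?d"
    using assms by (auto simp: is_element_def K)
  define m where "m = midpoint (zs ! 0) (zs ! ?d)"
  define c1 where "c1 = (zs ! 0 # m # map ((!) zs) [1..<?d], Suc \<gamma> mod ?d)"
  define c2 where "c2 = (zs ! ?d # m # map ((!) zs) ([1..<Suc \<gamma>] @ rev [Suc \<gamma>..<?d]), Suc \<gamma> mod ?d)"
  have d: "?d > 0" by simp
  have ch: "children K = {c1, c2}"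
    by (simp add: children_def K c1_def c2_def m_def Let_def)
  have set_zs: "set zs = (!) zs ` {0..?d}"
    using len by (auto simp: set_conv_nth image_iff less_Suc_eq_le)
  have inj: "inj_on ((!) zs) {0..?d}"
    using dis len by (auto simp: inj_on_def nth_eq_iff_index_eq)
  have i1: "insert (zs ! 0) ((!) zs ` {1..<?d}) = set zs - {zs ! ?d}"
  proof -
    have "insert (zs ! 0) ((!) zs ` {1..<?d}) = (!) zs ` ({0..?d} - {?d})"
      by (subst image_insert[symmetric]) (rule arg_cong[where f = "image _"], auto)
    also have "\<dots> = set zs - {zs ! ?d}"
      using inj by (subst inj_on_image_set_diff[of _ "{0..?d}"]) (auto simp: set_zs)
    finally show ?thesis .
  qed
  have i2: "insert (zs ! ?d) ((!) zs ` {1..<?d}) = set zs - {zs ! 0}"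
  proof -
    have "insert (zs ! ?d) ((!) zs ` {1..<?d}) = (!) zs ` ({0..?d} - {0})"
      by (subst image_insert[symmetric]) (rule arg_cong[where f = "image _"], use d in auto)
    also have "\<dots> = set zs - {zs ! 0}"
      using inj by (subst inj_on_image_set_diff[of _ "{0..?d}"]) (auto simp: set_zs)
    finally show ?thesis .
  qed
  \<comment> \<open>Reversing the tail for the second child permutes the inner indices, which is
    invisible in the vertex set.\<close>
  have u: "{1..<Suc \<gamma>} \<union> {Suc \<gamma>..<?d} = {1..<?d}" using \<gamma> by auto
  show ?thesis
  proof (rule that[OF ch])
    show "length (fst c1) = ?d + 1" "length (fst c2) = ?d + 1"
      using d \<gamma> by (auto simp: c1_def c2_def)
    show "snd c1 < ?d" "snd c2 < ?d" by (auto simp: c1_def c2_def)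
    have "vertices c1 = insert m (insert (zs ! 0) ((!) zs ` {1..<?d}))"
      by (auto simp: vertices_def c1_def)
    then show "vertices c1 = child_verts K (fst K ! CARD('n))"
      by (simp only: i1) (simp add: child_verts_def vertices_def K m_def)
    have "vertices c2 = insert m (insert (zs ! ?d) ((!) zs ` ({1..<Suc \<gamma>} \<union> {Suc \<gamma>..<?d})))"
      by (auto simp: vertices_def c2_def)
    then show "vertices c2 = child_verts K (fst K ! 0)"
      by (simp only: i2 u) (simp add: child_verts_def vertices_def K m_def)
  qed
qed

lemma is_element_card: "is_element (K :: 'n::finite element) \<Longrightarrow> card (vertices K) = CARD('n) + 1"
  by (auto simp: is_element_def vertices_def distinct_card)

lemma is_element_interior: "is_element (K :: 'n::finite element) \<Longrightarrow> interior (simplex_of K) \<noteq> {}"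
  using interior_convex_hull_eq_empty[of "vertices K"] is_element_card[of K]
  by (auto simp: simplex_of_def is_element_def)

text \<open>If the midpoint \<open>m\<close> lay in the affine hull of \<open>V - {b}\<close>, then
  so would \<open>b = 2 m - a\<close>.\<close>

lemma affine_independent_exchange_midpoint:
  fixes V :: "'a::euclidean_space set"
  assumes V: "\<not> affine_dependent V" and a: "a \<in> V" "b \<in> V" "a \<noteq> b"
  shows "\<not> affine_dependent (insert (midpoint a b) (V - {b}))" "midpoint a b \<notin> V - {b}"
proof -
  have *: "midpoint a b \<notin> affine hull (V - {b})"
  proof
    assume m: "midpoint a b \<in> affine hull (V - {b})"
    have "a \<in> affine hull (V - {b})" using a by (auto intro: hull_inc)
    then have "2 *\<^sub>R midpoint a b + (-1) *\<^sub>R a \<in> affine hull (V - {b})"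
      using m by (intro mem_affine affine_affine_hull) auto
    also have "2 *\<^sub>R midpoint a b + (-1) *\<^sub>R a = b" by (simp add: midpoint_def)
    finally show False using V a by (auto simp: affine_dependent_def)
  qed
  then show "midpoint a b \<notin> V - {b}" by (meson hull_inc)
  show "\<not> affine_dependent (insert (midpoint a b) (V - {b}))"
    using * V by (intro affine_independent_insert) (simp_all add: affine_independent_Diff)
qed

lemma refinement_edge:
  assumes "is_element (K :: 'n::finite element)"
  shows "fst K ! 0 \<in> vertices K" "fst K ! CARD('n) \<in> vertices K" "fst K ! 0 \<noteq> fst K ! CARD('n)"
  using assms by (auto simp: is_element_def vertices_def nth_eq_iff_index_eq)

lemma child_is_element:
  fixes K :: "'n::finite element"
  assumes K: "is_element K" and c: "c \<in> children K"
  shows "is_element c"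
proof -
  note e = refinement_edge[OF K]
  have V: "\<not> affine_dependent (vertices K)" using K by (simp add: is_element_def)
  have m: "midpoint (fst K ! CARD('n)) (fst K ! 0) = midpoint (fst K ! 0) (fst K ! CARD('n))"
    by (rule midpoint_sym)
  have fin: "finite (vertices K)" by (simp add: vertices_def)
  have 1: "\<not> affine_dependent (child_verts K b) \<and> card (child_verts K b) = CARD('n) + 1"
    if b: "b = fst K ! 0 \<or> b = fst K ! CARD('n)" for b
  proof -
    have "\<not> affine_dependent (child_verts K b)"
      "midpoint (fst K ! 0) (fst K ! CARD('n)) \<notin> vertices K - {b}"
      using affine_independent_exchange_midpoint[OF V e]
        affine_independent_exchange_midpoint[OF V e(2) e(1) e(3)[symmetric]] b
      by (auto simp: child_verts_def m)
    moreover have "b \<in> vertices K" using b e by auto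
    ultimately show ?thesis
      using fin is_element_card[OF K] by (simp add: child_verts_def card_insert_disjoint)
  qed
  obtain c1 c2 where cc: "children K = {c1, c2}"
    "length (fst c1) = CARD('n) + 1" "length (fst c2) = CARD('n) + 1"
    "snd c1 < CARD('n)" "snd c2 < CARD('n)"
    "vertices c1 = child_verts K (fst K ! CARD('n))" "vertices c2 = child_verts K (fst K ! 0)"
    using children_cases[OF K] by blast
  obtain b where b: "b = fst K ! 0 \<or> b = fst K ! CARD('n)" "vertices c = child_verts K b"
    "length (fst c) = CARD('n) + 1" "snd c < CARD('n)"
    using c cc by auto
  \<comment> \<open>A list of length \<open>d + 1\<close> whose set has \<open>d + 1\<close>
    elements is distinct.\<close>
  then show ?thesis using 1[OF b(1)]
    by (auto simp: is_element_def vertices_def intro: card_distinct)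
qed

text \<open>In barycentric coordinates, a point of the parent belongs to the child that keeps the
  endpoint of the refinement edge with the larger coordinate.\<close>

lemma child_simplex:
  fixes K :: "'n::finite element"
  assumes K: "is_element K"
  shows "\<And>c. c \<in> children K \<Longrightarrow> simplex_of c \<subseteq> simplex_of K"
    and "(\<Union>c\<in>children K. simplex_of c) = simplex_of K"
    and "\<And>c c'. c \<in> children K \<Longrightarrow> c' \<in> children K \<Longrightarrow> c \<noteq> c' \<Longrightarrow>
      interior (simplex_of c) \<inter> interior (simplex_of c') = {}"
    and "card (children K) = 2"
proof -
  note e = refinement_edge[OF K]
  let ?a = "fst K ! 0" and ?b = "fst K ! CARD('n)"
  let ?m = "midpoint ?a ?b" and ?V = "vertices K"
  have V: "\<not> affine_dependent ?V" using K by (simp add: is_element_def)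
  have fin: "finite ?V" by (simp add: vertices_def)
  obtain c1 c2 where cc: "children K = {c1, c2}"
    "vertices c1 = child_verts K ?b" "vertices c2 = child_verts K ?a"
    using children_cases[OF K] by metis
  have mab: "?m \<in> closed_segment ?a ?b" by simp
  then have m2: "?m \<in> convex hull {?a, ?b}" by (simp add: segment_convex_hull)
  then have m: "?m \<in> convex hull ?V" using e hull_mono[of "{?a, ?b}" ?V convex] by auto
  have sub: "convex hull (child_verts K b) \<subseteq> convex hull ?V" for b
    unfolding child_verts_def using m by (intro hull_minimal) (auto intro: hull_inc)
  show 1: "simplex_of c \<subseteq> simplex_of K" if "c \<in> children K" for c
    using that cc(2,3) sub unfolding cc(1) simplex_of_def by (metis insertE singletonD)
  have "simplex_of K \<subseteq> simplex_of c1 \<union> simplex_of c2"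
  proof
    fix x assume "x \<in> simplex_of K"
    then obtain u where u: "\<And>v. v \<in> ?V \<Longrightarrow> 0 \<le> u v" "sum u ?V = 1" "(\<Sum>v\<in>?V. u v *\<^sub>R v) = x"
      using fin by (auto simp: simplex_of_def convex_hull_finite)
    have key: "x \<in> convex hull (insert ?m (?V - {q}))"
      if pq: "p \<in> ?V" "q \<in> ?V" "p \<noteq> q" "midpoint p q = ?m" "u q \<le> u p" for p q
    proof -
      let ?W = "?V - {p} - {q}"
      have s: "sum f ?V = f p + (f q + sum f ?W)" for f :: "_ \<Rightarrow> 'b::ab_group_add"
        using pq fin by (simp add: sum.remove[of ?V p] sum.remove[of "?V - {p}" q])
      \<comment> \<open>The smaller weight \<open>u q\<close> is moved from both endpoints to their
        midpoint: \<open>u p p + u q q = 2 u q m + (u p - u q) p\<close>. All new weights are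
        nonnegative.\<close>
      have "x = u p *\<^sub>R p + (u q *\<^sub>R q + (\<Sum>v\<in>?W. u v *\<^sub>R v))" using u(3) s by metis
      also have "\<dots> = (2 * u q) *\<^sub>R midpoint p q + ((u p - u q) *\<^sub>R p + (\<Sum>v\<in>?W. u v *\<^sub>R v))"
        by (simp add: midpoint_def algebra_simps)
      finally have x: "x = (2 * u q) *\<^sub>R ?m + ((u p - u q) *\<^sub>R p + (\<Sum>v\<in>?W. u v *\<^sub>R v))" by (simp add: pq)
      define y where "y v = (if v = p then u p - u q else u v)" for v
      have s': "sum f (?V - {q}) = f p + sum f ?W" for f :: "_ \<Rightarrow> 'b::ab_group_add"
      proof -
        have "sum f (?V - {q}) = f p + sum f (?V - {q} - {p})"
          using pq fin by (simp add: sum.remove[of "?V - {q}" p])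
        also have "?V - {q} - {p} = ?W" by auto
        finally show ?thesis .
      qed
      have y1: "2 * u q + sum y (?V - {q}) = 1"
      proof -
        have "sum y (?V - {q}) = (u p - u q) + sum u ?W"
          unfolding s' by (simp add: y_def)
        then show ?thesis using u(2) s[of u] by simp
      qed
      have y2: "x = (2 * u q) *\<^sub>R ?m + (\<Sum>v\<in>?V - {q}. y v *\<^sub>R v)"
        unfolding x s' by (simp add: y_def)
      have q0: "0 \<le> u q" using u pq by auto
      have y0: "0 \<le> y v" if "v \<in> ?V - {q}" for v
        using that u pq by (auto simp: y_def)
      have mn: "?m \<notin> ?V - {q}"
        using affine_independent_exchange_midpoint(2)[OF V pq(1-3)] pq(4) by simp
      define z where "z v = (if v = ?m then 2 * u q else y v)" for v
      have sz: "sum z (?V - {q}) = sum y (?V - {q})"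
        "(\<Sum>v\<in>?V - {q}. z v *\<^sub>R v) = (\<Sum>v\<in>?V - {q}. y v *\<^sub>R v)"
      proof -
        have "z v = y v" if "v \<in> ?V - {q}" for v using that mn unfolding z_def by metis
        then show "sum z (?V - {q}) = sum y (?V - {q})"
          "(\<Sum>v\<in>?V - {q}. z v *\<^sub>R v) = (\<Sum>v\<in>?V - {q}. y v *\<^sub>R v)"
          by (auto intro!: sum.cong)
      qed
      have zm: "z ?m = 2 * u q" by (simp add: z_def)
      have "(\<Sum>v\<in>insert ?m (?V - {q}). z v *\<^sub>R v) \<in> convex hull (insert ?m (?V - {q}))"
      proof (rule convex_sum)
        show "sum z (insert ?m (?V - {q})) = 1"
          using fin mn y1 by (subst sum.insert) (simp_all only: sz zm, auto)
        show "0 \<le> z v" if "v \<in> insert ?m (?V - {q})" for v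
          using that y0 q0 by (auto simp: z_def)
        show "v \<in> convex hull (insert ?m (?V - {q}))" if "v \<in> insert ?m (?V - {q})" for v
          using that by (rule hull_inc)
      qed (use fin in auto)
      also have "(\<Sum>v\<in>insert ?m (?V - {q}). z v *\<^sub>R v) = x"
        using fin mn by (subst sum.insert) (simp_all only: sz zm y2, auto)
      finally show ?thesis .
    qed
    show "x \<in> simplex_of c1 \<union> simplex_of c2"
    proof (cases "u ?b \<le> u ?a")
      case True
      then show ?thesis using key[OF e] by (simp add: simplex_of_def cc child_verts_def)
    next
      case False
      then show ?thesis using key[OF e(2,1) e(3)[symmetric]]
        by (simp add: simplex_of_def cc child_verts_def midpoint_sym)
    qed
  qed
  moreover have "simplex_of c1 \<subseteq> simplex_of K" "simplex_of c2 \<subseteq> simplex_of K"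
    using 1 cc(1) by blast+
  ultimately show "(\<Union>c\<in>children K. simplex_of c) = simplex_of K"
    unfolding cc(1) by blast
  have int: "interior (simplex_of c1) \<inter> interior (simplex_of c2) = {}"
  proof -
    \<comment> \<open>The common face is spanned by the midpoint and the \<open>d - 1\<close>
      vertices off the refinement edge, which are too few points for an interior.\<close>
    have "simplex_of c1 \<inter> simplex_of c2 = convex hull (insert ?m ((?V - {?b}) \<inter> (?V - {?a})))"
      unfolding simplex_of_def cc(2,3) child_verts_def
      by (rule convex_hull_exchange_Int[OF V m]) auto
    moreover have "interior (convex hull (insert ?m ((?V - {?b}) \<inter> (?V - {?a})))) = {}"
    proof (rule empty_interior_convex_hull)
      have "(?V - {?b}) \<inter> (?V - {?a}) = ?V - {?a} - {?b}" by auto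
      moreover have "card (?V - {?a} - {?b}) = CARD('n) - 1"
        using e fin is_element_card[OF K] by (simp add: card_Diff_singleton)
      moreover have "CARD('n) > 0" by simp
      ultimately show "card (insert ?m ((?V - {?b}) \<inter> (?V - {?a}))) \<le> DIM(real^'n)"
        using card_insert_le_m1[of "CARD('n)" "?V - {?a} - {?b}" ?m] by simp
    qed (use fin in auto)
    ultimately show ?thesis by (metis interior_Int)
  qed
  then show "interior (simplex_of c) \<inter> interior (simplex_of c') = {}"
    if "c \<in> children K" "c' \<in> children K" "c \<noteq> c'" for c c'
    using that cc by auto
  have "c1 \<noteq> c2"
    using int is_element_interior[OF child_is_element[OF K, of c1]] cc by auto
  then show "card (children K) = 2" by (simp add: cc)
qed

text \<open>Otherwise the nonempty interior of the sibling would lie in the interior of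
  \<open>c\<close>, from which it is disjoint.\<close>

lemma child_simplex_strict:
  fixes K :: "'n::finite element"
  assumes K: "is_element K" and c: "c \<in> children K"
  shows "simplex_of c \<noteq> simplex_of K"
proof
  assume eq: "simplex_of c = simplex_of K"
  obtain c' where c': "c' \<in> children K" "c' \<noteq> c"
    using child_simplex(4)[OF K] c
    by (metis card_2_iff')
  have "interior (simplex_of c') \<subseteq> interior (simplex_of c)"
    unfolding eq by (intro interior_mono child_simplex(1)[OF K c'(1)])
  then show False
    using child_simplex(3)[OF K c c'(1)] c' is_element_interior[OF child_is_element[OF K c'(1)]] by blast
qed

section \<open>The lattice of bisection refinements\<close>

text \<open>What remains of a triangulation once hanging nodes are allowed. Unlike conformity, it
  survives every single bisection and thus serves as the invariant.\<close>

definition packing :: "'n::finite mesh \<Rightarrow> bool" where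
  "packing T \<longleftrightarrow> finite T \<and> (\<forall>K\<in>T. is_element K) \<and>
     (\<forall>K\<in>T. \<forall>K'\<in>T. K \<noteq> K' \<longrightarrow> interior (simplex_of K) \<inter> interior (simplex_of K') = {})"

definition bisect :: "'n::finite mesh \<Rightarrow> 'n element \<Rightarrow> 'n mesh" where
  "bisect T K = (T - {K}) \<union> children K"

lemma bisection_step_iff: "bisection_step T T' \<longleftrightarrow> (\<exists>K\<in>T. T' = bisect T K)"
  by (simp add: bisection_step_def bisect_def)

lemma finite_children: "finite (children (K :: 'n::finite element))"
  by (simp add: children_def Let_def)

lemma packing_overlap:
  "packing T \<Longrightarrow> K \<in> T \<Longrightarrow> K' \<in> T \<Longrightarrow> interior (simplex_of K) \<inter> interior (simplex_of K') \<noteq> {} \<Longrightarrow> K = K'"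
  by (auto simp: packing_def)

lemma packing_subset_eq:
  assumes "packing T" "K \<in> T" "L \<in> T" "is_element M" "simplex_of M \<subseteq> simplex_of K" "simplex_of M \<subseteq> simplex_of L"
  shows "K = L"
  using packing_overlap[OF assms(1-3)] is_element_interior[OF assms(4)]
    interior_mono[OF assms(5)] interior_mono[OF assms(6)] by blast

lemma child_notin_packing:
  assumes T: "packing T" and "K \<in> T" "L \<in> T" "c \<in> children K"
  shows "c \<noteq> L"
proof
  assume eq: "c = L"
  have K: "is_element K" using T assms by (auto simp: packing_def)
  have "simplex_of c \<subseteq> simplex_of K" by (rule child_simplex(1)[OF K assms(4)])
  then have "K = L"
    using packing_subset_eq[OF T assms(2,3), of c] child_is_element[OF K assms(4)] eq by auto
  then show False using child_simplex_strict[OF K assms(4)] eq by simp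
qed

lemma packing_bisect:
  assumes T: "packing T" and K: "K \<in> T"
  shows "packing (bisect T K)" and "card (bisect T K) = Suc (card T)"
proof -
  have eK: "is_element K" using T K by (auto simp: packing_def)
  have mixed: "interior (simplex_of c) \<inter> interior (simplex_of L) = {}"
    if "c \<in> children K" "L \<in> T - {K}" for c L
    using interior_mono[OF child_simplex(1)[OF eK that(1)]] T K that unfolding packing_def by blast
  show "packing (bisect T K)"
    unfolding packing_def
  proof (intro conjI ballI impI)
    show "finite (bisect T K)" using T finite_children[of K] by (auto simp: bisect_def packing_def)
    show "is_element L" if "L \<in> bisect T K" for L
      using that T child_is_element[OF eK, of L] by (auto simp: bisect_def packing_def)
    show "interior (simplex_of L) \<inter> interior (simplex_of L') = {}"
      if LL: "L \<in> bisect T K" "L' \<in> bisect T K" "L \<noteq> L'" for L L'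
    proof -
      consider "L \<in> children K" "L' \<in> children K" | "L \<in> children K" "L' \<in> T - {K}"
        | "L \<in> T - {K}" "L' \<in> children K" | "L \<in> T" "L' \<in> T"
        using LL unfolding bisect_def by blast
      then show ?thesis
      proof cases
        case 1 then show ?thesis using child_simplex(3)[OF eK] LL(3) by blast
      next
        case 2 then show ?thesis by (rule mixed)
      next
        case 3 then show ?thesis using mixed by blast
      next
        case 4 then show ?thesis using T LL(3) by (auto simp: packing_def)
      qed
    qed
  qed
  have "(T - {K}) \<inter> children K = {}" using child_notin_packing[OF T K] by blast
  moreover have "finite T" using T by (simp add: packing_def)
  moreover have "card T > 0" using K \<open>finite T\<close> card_gt_0_iff by blast
  ultimately show "card (bisect T K) = Suc (card T)"
    using K child_simplex(4)[OF eK] finite_children[of K]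
    by (simp add: bisect_def card_Un_disjoint card_Diff_singleton)
qed

lemma nvb_packing:
  assumes "nvb_refinement T T'" "packing T"
  shows "packing T'" "card T \<le> card T'" "T' \<noteq> T \<Longrightarrow> card T < card T'"
proof -
  have "packing T' \<and> card T \<le> card T' \<and> (T' \<noteq> T \<longrightarrow> card T < card T')"
    using assms by (induction rule: rtranclp_induct) (auto simp: bisection_step_iff packing_bisect)
  then show "packing T'" "card T \<le> card T'" "T' \<noteq> T \<Longrightarrow> card T < card T'" by auto
qed

lemma nvb_bisect: "K \<in> T \<Longrightarrow> nvb_refinement T (bisect T K)"
  by (rule r_into_rtranclp) (auto simp: bisection_step_iff)

lemma nvb_ancestor:
  assumes "nvb_refinement T T'" "packing T" "K \<in> T'"
  shows "\<exists>L\<in>T. simplex_of K \<subseteq> simplex_of L"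
  using assms
proof (induction arbitrary: K rule: rtranclp_induct)
  case base then show ?case by blast
next
  case (step T' T'')
  obtain L where L: "L \<in> T'" "T'' = bisect T' L" using step.hyps by (auto simp: bisection_step_iff)
  have "is_element L" using nvb_packing(1)[OF step.hyps(1) step.prems(1)] L by (auto simp: packing_def)
  then have sub: "simplex_of K \<subseteq> simplex_of L" if "K \<in> children L"
    using child_simplex(1)[of L K] that by simp
  have "K \<in> T' \<or> K \<in> children L" using step.prems(2) L(2) by (simp add: bisect_def) blast
  then show ?case
    using step.IH[OF step.prems(1), of K] step.IH[OF step.prems(1) L(1)] sub by (meson subset_trans)
qed

lemma nvb_covers:
  assumes "nvb_refinement T T'" "packing T" "K \<in> T" "x \<in> simplex_of K"
  shows "\<exists>L\<in>T'. x \<in> simplex_of L \<and> simplex_of L \<subseteq> simplex_of K"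
  using assms
proof (induction rule: rtranclp_induct)
  case base then show ?case by blast
next
  case (step T' T'')
  obtain L where L: "L \<in> T'" "x \<in> simplex_of L" "simplex_of L \<subseteq> simplex_of K"
    using step by blast
  obtain M where M: "M \<in> T'" "T'' = bisect T' M" using step.hyps by (auto simp: bisection_step_iff)
  have eM: "is_element M" using nvb_packing(1)[OF step.hyps(1) step.prems(1)] M by (auto simp: packing_def)
  show ?case
  proof (cases "L = M")
    case False then show ?thesis using L M by (auto simp: bisect_def)
  next
    case True
    then obtain c where "c \<in> children M" "x \<in> simplex_of c" using child_simplex(2)[OF eM] L by blast
    then show ?thesis using child_simplex(1)[OF eM, of c] L M True by (auto simp: bisect_def)
  qed
qed

text \<open>A returning \<open>K\<close> would be a child of some \<open>M\<close> contained in an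
  element \<open>L\<close> of \<open>T\<close>. Disjoint interiors force \<open>L = K\<close>, so
  child and parent would be the same simplex.\<close>

lemma nvb_no_return:
  assumes T': "nvb_refinement T T'" and T'': "nvb_refinement T' T''" and T: "packing T"
    and K: "K \<in> T" "K \<notin> T'"
  shows "K \<notin> T''"
  using T''
proof (induction rule: rtranclp_induct)
  case base then show ?case using K by simp
next
  case (step U U')
  have TU: "nvb_refinement T U" using T' step by (meson rtranclp_trans)
  have U: "packing U" by (rule nvb_packing(1)[OF TU T])
  obtain M where M: "M \<in> U" "U' = bisect U M" using step by (auto simp: bisection_step_iff)
  have eM: "is_element M" using U M by (auto simp: packing_def)
  show ?case
  proof
    assume "K \<in> U'"
    then have c: "K \<in> children M" using step M by (auto simp: bisect_def)
    have KM: "simplex_of K \<subseteq> simplex_of M" by (rule child_simplex(1)[OF eM c])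
    obtain L where L: "L \<in> T" "simplex_of M \<subseteq> simplex_of L" using nvb_ancestor[OF TU T M(1)] by blast
    have "is_element K" using T K by (auto simp: packing_def)
    then have "K = L"
      using packing_subset_eq[OF T K(1) L(1)] KM L by blast
    then show False using child_simplex_strict[OF eM c] KM L by blast
  qed
qed

section \<open>Exchange of bisections, meets and joins\<close>

lemma bisect_commute:
  assumes T: "packing T" and "K \<in> T" "L \<in> T" "K \<noteq> L"
  shows "bisect (bisect T K) L = bisect (bisect T L) K"
  using child_notin_packing[OF T assms(2,3), of L] child_notin_packing[OF T assms(3,2), of K] assms(4)
  unfolding bisect_def by blast

text \<open>Bisections of different elements commute, so an early bisection of \<open>K\<close> can
  be carried along any refinement of \<open>T\<close>; once that refinement bisects \<open>K\<close>
  itself, the two histories merge. Meet and join both rest on this exchange.\<close>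

lemma nvb_bisect_mono:
  assumes "nvb_refinement T U" and T: "packing T" and K: "K \<in> T"
  shows "if K \<in> U then nvb_refinement (bisect T K) (bisect U K) else nvb_refinement (bisect T K) U"
  using assms(1)
proof (induction rule: rtranclp_induct)
  case base then show ?case using K by simp
next
  case (step U U')
  have U: "packing U" by (rule nvb_packing(1)[OF step.hyps(1) T])
  obtain M where M: "M \<in> U" "U' = bisect U M" using step by (auto simp: bisection_step_iff)
  show ?case
  proof (cases "K \<in> U")
    case False
    then have "K \<notin> U'" using nvb_no_return[OF step.hyps(1) _ T K] step.hyps(2) by blast
    then show ?thesis using step.IH step.hyps(2) False by auto
  next
    case KU: True
    show ?thesis
    proof (cases "M = K")
      case True
      have "K \<notin> U'" using child_notin_packing[OF U KU KU, of K] M True by (auto simp: bisect_def)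
      then show ?thesis using step.IH KU M True by simp
    next
      case False
      have "K \<in> U'" using KU M False by (auto simp: bisect_def)
      moreover have "nvb_refinement (bisect U K) (bisect U' K)"
        unfolding M(2) bisect_commute[OF U M(1) KU False]
        by (rule nvb_bisect) (use M False in \<open>auto simp: bisect_def\<close>)
      ultimately show ?thesis using step.IH KU by (meson rtranclp_trans)
    qed
  qed
qed

text \<open>Take a common coarsening with as many elements as possible: an element missing in both
  \<open>T1\<close> and \<open>T2\<close> has been bisected on the way to each, so it could be
  bisected in \<open>C\<close> already.\<close>

lemma nvb_meet:
  assumes "nvb_refinement T T1" "nvb_refinement T T2" and T: "packing T"
  obtains C where "nvb_refinement T C" "nvb_refinement C T1" "nvb_refinement C T2" "C \<subseteq> T1 \<union> T2"
proof -
  let ?P = "\<lambda>C. nvb_refinement T C \<and> nvb_refinement C T1 \<and> nvb_refinement C T2"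
  have bd: "card C < Suc (card T1)" if "?P C" for C
    using that nvb_packing(1)[of T C] nvb_packing(2)[of C T1] T by (simp add: less_Suc_eq_le)
  have "?P T" using assms by simp
  then obtain C where C: "?P C" and max: "\<And>C'. ?P C' \<Longrightarrow> card C' \<le> card C"
    using ex_has_greatest_nat[of ?P T card "Suc (card T1)"] bd by meson
  have pC: "packing C" using C T nvb_packing by blast
  have "C \<subseteq> T1 \<union> T2"
  proof (rule ccontr)
    assume "\<not> C \<subseteq> T1 \<union> T2"
    then obtain K where K: "K \<in> C" "K \<notin> T1" "K \<notin> T2" by blast
    have "?P (bisect C K)"
      using C K nvb_bisect[OF K(1)] nvb_bisect_mono[of C T1 K] nvb_bisect_mono[of C T2 K] pC
      by (auto intro: rtranclp_trans)
    then show False using max[of "bisect C K"] packing_bisect(2)[OF pC K(1)] by simp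
  qed
  then show ?thesis using that C by blast
qed

text \<open>The bisections leading to \<open>T2\<close> are replayed on top of \<open>T1\<close>,
  except those already present. A replayed one destroys at most one element of \<open>T1\<close> and
  each raises \<open>card T2\<close> by one, which gives the overlay estimate directly for the
  refined elements.\<close>

lemma nvb_join:
  assumes "nvb_refinement T T2" "nvb_refinement T T1" and T: "packing T"
  shows "\<exists>J. nvb_refinement T1 J \<and> nvb_refinement T2 J \<and> J \<subseteq> T1 \<union> T2 \<and>
    card (T1 - J) + card T \<le> card T2"
  using assms(1)
proof (induction rule: rtranclp_induct)
  case base
  then show ?case using assms(2) by (intro exI[of _ T1]) simp
next
  case (step T2 T3)
  then obtain J where J: "nvb_refinement T1 J" "nvb_refinement T2 J" "J \<subseteq> T1 \<union> T2"
    "card (T1 - J) + card T \<le> card T2" by blast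
  have p2: "packing T2" by (rule nvb_packing(1)[OF step.hyps(1) T])
  have f1: "finite T1" using nvb_packing(1)[OF assms(2) T] by (simp add: packing_def)
  obtain K where K: "K \<in> T2" "T3 = bisect T2 K" using step by (auto simp: bisection_step_iff)
  have c3: "card T3 = Suc (card T2)" using packing_bisect(2)[OF p2 K(1)] K by simp
  note mono = nvb_bisect_mono[OF J(2) p2 K(1)]
  show ?case
  proof (cases "K \<in> J")
    case True
    have "T1 - bisect J K \<subseteq> insert K (T1 - J)" by (auto simp: bisect_def)
    then have "card (T1 - bisect J K) \<le> Suc (card (T1 - J))"
      using f1 card_mono[of "insert K (T1 - J)" "T1 - bisect J K"]
      by (simp add: card_insert_if split: if_splits)
    moreover have "bisect J K \<subseteq> T1 \<union> T3" using J(3) K(2) by (auto simp: bisect_def)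
    moreover have "nvb_refinement T1 (bisect J K)" using J(1) nvb_bisect[OF True] by (rule rtranclp_trans)
    ultimately show ?thesis using J(4) c3 mono True K(2) by (intro exI[of _ "bisect J K"]) auto
  next
    case False
    then have "J \<subseteq> T1 \<union> T3" using J(3) K(2) by (auto simp: bisect_def)
    then show ?thesis using J(1,4) c3 mono False K(2) by (intro exI[of _ J]) auto
  qed
qed

section \<open>Conformity\<close>

text \<open>Faces, unlike vertex sets, can be sliced and composed. For the converse, the
  intersection is spanned by vertices of either simplex, and the two spanning sets agree because
  both consist of its extreme points.\<close>

lemma conforming_iff_face_of:
  assumes T: "\<forall>K\<in>T. is_element K"
  shows "conforming T \<longleftrightarrow> (\<forall>K\<in>T. \<forall>K'\<in>T. (simplex_of K \<inter> simplex_of K') face_of simplex_of K)"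
proof (intro iffI)
  assume c: "conforming T"
  show "\<forall>K\<in>T. \<forall>K'\<in>T. (simplex_of K \<inter> simplex_of K') face_of simplex_of K"
  proof (intro ballI)
    fix K K' assume K: "K \<in> T" "K' \<in> T"
    then have "\<not> affine_dependent (vertices K)" using T by (auto simp: is_element_def)
    from face_of_convex_hull_affine_independent[OF this] 
    show "(simplex_of K \<inter> simplex_of K') face_of simplex_of K"
      using c K by (auto simp: conforming_def simplex_of_def)
  qed
next
  assume f: "\<forall>K\<in>T. \<forall>K'\<in>T. (simplex_of K \<inter> simplex_of K') face_of simplex_of K"
  show "conforming T"
    unfolding conforming_def
  proof (intro ballI)
    fix K K' assume K: "K \<in> T" "K' \<in> T"
    have i: "\<not> affine_dependent (vertices K)" "\<not> affine_dependent (vertices K')"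
      using T K by (auto simp: is_element_def)
    have "(simplex_of K \<inter> simplex_of K') face_of simplex_of K"
      "(simplex_of K \<inter> simplex_of K') face_of simplex_of K'"
      using f K by (auto simp: Int_commute)
    then obtain c c' where c: "c \<subseteq> vertices K" "simplex_of K \<inter> simplex_of K' = convex hull c"
      "c' \<subseteq> vertices K'" "simplex_of K \<inter> simplex_of K' = convex hull c'"
      using face_of_convex_hull_affine_independent[OF i(1)] face_of_convex_hull_affine_independent[OF i(2)]
      unfolding simplex_of_def by metis
    have "\<not> affine_dependent c" "\<not> affine_dependent c'" using i c by (meson affine_independent_subset)+
    then have "c = c'"
      using extreme_point_of_convex_hull_affine_independent[of c]
        extreme_point_of_convex_hull_affine_independent[of c'] c(2,4) by auto
    then have "convex hull c \<subseteq> convex hull (vertices K \<inter> vertices K')"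
      using c by (intro hull_mono) auto
    moreover have "convex hull (vertices K \<inter> vertices K') \<subseteq> simplex_of K \<inter> simplex_of K'"
      by (auto simp: simplex_of_def intro: subsetD[OF hull_mono, rotated])
    ultimately show "simplex_of K \<inter> simplex_of K' = convex hull (vertices K \<inter> vertices K')"
      using c(2) by blast
  qed
qed

lemma convex_simplex_of [simp]: "convex (simplex_of K)"
  by (simp add: simplex_of_def)

text \<open>
  If \<open>K \<in> T1\<close> and \<open>K'\<close> is covered by elements \<open>L\<close> of \<open>T1\<close>, then \<open>K \<inter> K'\<close> is a convex union of faces
  \<open>K \<inter> L\<close> of \<open>K\<close>, hence equal to the one that meets its relative interior.
\<close>

lemma conforming_meet:
  assumes C: "packing C" and r: "nvb_refinement C T1" "nvb_refinement C T2" and sub: "C \<subseteq> T1 \<union> T2"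
    and cf: "conforming T1" "conforming T2"
  shows "conforming C"
proof -
  have mixed: "(simplex_of K \<inter> simplex_of K') face_of simplex_of K"
    if K: "K \<in> U" "K' \<in> C" and U: "nvb_refinement C U" "conforming U" for K K' U
  proof -
    let ?F = "simplex_of K \<inter> simplex_of K'"
    have f: "(simplex_of K \<inter> simplex_of L) face_of simplex_of K" if "L \<in> U" for L
      using conforming_iff_face_of[of U] nvb_packing(1)[OF U(1) C] U(2) K(1) that
      by (auto simp: packing_def)
    show ?thesis
    proof (cases "?F = {}")
      case False
      have cv: "convex ?F" by (intro convex_Int) auto
      then obtain x where x: "x \<in> rel_interior ?F" using False rel_interior_eq_empty by blast
      then have "x \<in> simplex_of K" "x \<in> simplex_of K'" using rel_interior_subset by blast+
      then obtain L where L: "L \<in> U" "x \<in> simplex_of L" "simplex_of L \<subseteq> simplex_of K'"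
        using nvb_covers[OF U(1) C K(2)] by blast
      have "?F \<subseteq> simplex_of K \<inter> simplex_of L"
        using subset_of_face_of[OF f[OF L(1)], of ?F] x L \<open>x \<in> simplex_of K\<close> by blast
      then have "?F = simplex_of K \<inter> simplex_of L" using L by blast
      then show ?thesis using f[OF L(1)] by simp
    qed simp
  qed
  have "\<forall>K\<in>C. \<forall>K'\<in>C. (simplex_of K \<inter> simplex_of K') face_of simplex_of K"
    using mixed[OF _ _ r(1) cf(1)] mixed[OF _ _ r(2) cf(2)] sub by blast
  then show ?thesis using conforming_iff_face_of C by (auto simp: packing_def)
qed

text \<open>
  For \<open>K \<in> T1\<close>, \<open>K' \<in> T2\<close> in \<open>J\<close> with ancestors \<open>L \<in> T1\<close> of \<open>K'\<close> and \<open>L' \<in> T2\<close> of \<open>K\<close>, the set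
  \<open>K \<inter> K'\<close> is the intersection of the face \<open>K \<inter> L\<close> of \<open>L\<close> with \<open>K' \<inter> L' \<subseteq> L\<close>, hence a face of the
  latter; the same holds with the roles exchanged.
\<close>

lemma conforming_join:
  assumes p: "packing T1" "packing T2" and r: "nvb_refinement T1 J" "nvb_refinement T2 J"
    and sub: "J \<subseteq> T1 \<union> T2" and cf: "conforming T1" "conforming T2"
  shows "conforming J"
proof -
  have face: "\<And>K L. K \<in> T1 \<Longrightarrow> L \<in> T1 \<Longrightarrow> (simplex_of K \<inter> simplex_of L) face_of simplex_of K"
    "\<And>K L. K \<in> T2 \<Longrightarrow> L \<in> T2 \<Longrightarrow> (simplex_of K \<inter> simplex_of L) face_of simplex_of K"
    using conforming_iff_face_of[of T1] conforming_iff_face_of[of T2] p cf by (auto simp: packing_def)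
  have mixed: "(simplex_of K \<inter> simplex_of K') face_of simplex_of K \<and>
      (simplex_of K \<inter> simplex_of K') face_of simplex_of K'"
    if K: "K \<in> J" "K' \<in> J" "K \<in> T1" "K' \<in> T2" for K K'
  proof -
    obtain L L' where L: "L \<in> T1" "simplex_of K' \<subseteq> simplex_of L"
      and L': "L' \<in> T2" "simplex_of K \<subseteq> simplex_of L'"
      using nvb_ancestor[OF r(1) p(1) K(2)] nvb_ancestor[OF r(2) p(2) K(1)] by blast
    let ?E = "simplex_of K \<inter> simplex_of L" and ?E' = "simplex_of K' \<inter> simplex_of L'"
    have eq: "simplex_of K \<inter> simplex_of K' = ?E \<inter> ?E'" using L L' by blast
    have E: "?E face_of simplex_of K" "?E face_of simplex_of L"
      using face(1)[OF K(3) L(1)] face(1)[OF L(1) K(3)] by (auto simp: Int_commute)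
    have E': "?E' face_of simplex_of K'" "?E' face_of simplex_of L'"
      using face(2)[OF K(4) L'(1)] face(2)[OF L'(1) K(4)] by (auto simp: Int_commute)
    have cE: "convex ?E" "convex ?E'" by (intro convex_Int; simp)+
    have "(?E \<inter> ?E') face_of (simplex_of L \<inter> ?E')" by (rule face_of_slice[OF E(2) cE(2)])
    also have "simplex_of L \<inter> ?E' = ?E'" using L by blast
    finally have 1: "(?E \<inter> ?E') face_of simplex_of K'" using E'(1) by (rule face_of_trans)
    have "(?E' \<inter> ?E) face_of (simplex_of L' \<inter> ?E)" by (rule face_of_slice[OF E'(2) cE(1)])
    also have "simplex_of L' \<inter> ?E = ?E" using L' by blast
    finally have 2: "(?E \<inter> ?E') face_of simplex_of K" using E(1) by (metis face_of_trans Int_commute)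
    show ?thesis unfolding eq using 1 2 by simp
  qed
  have "\<forall>K\<in>J. \<forall>K'\<in>J. (simplex_of K \<inter> simplex_of K') face_of simplex_of K"
  proof (intro ballI)
    fix K K' assume "K \<in> J" "K' \<in> J"
    moreover have "K \<in> T1 \<or> K \<in> T2" "K' \<in> T1 \<or> K' \<in> T2" using calculation sub by blast+
    ultimately show "(simplex_of K \<inter> simplex_of K') face_of simplex_of K"
      using face[of K K'] mixed[of K K'] mixed[of K' K] by (metis Int_commute)
  qed
  moreover have "packing J" by (rule nvb_packing(1)[OF r(1) p(1)])
  ultimately show ?thesis using conforming_iff_face_of by (auto simp: packing_def)
qed

section \<open>Meshes reachable by refinement, and their overlays\<close>

lemma meshes_nvb:
  assumes "T' \<in> meshes T"
  shows "nvb_refinement T T'" and "conforming T \<Longrightarrow> conforming T'"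
  using assms by (induction) (auto simp: is_refine_def intro: rtranclp_trans)

lemma meshes_trans: "T' \<in> meshes T \<Longrightarrow> T'' \<in> meshes T' \<Longrightarrow> T'' \<in> meshes T"
  by (rotate_tac, induction rule: meshes.induct) (auto intro: meshes.step)

text \<open>A refinement of minimal cardinality is the coarsest one: its meet with any other one has no fewer elements.\<close>

lemma is_refine_exists:
  assumes T: "packing T" and U: "nvb_refinement T U" "conforming U" and M: "M \<subseteq> T" "M \<inter> U = {}"
  shows "\<exists>T'. is_refine T M T'"
proof -
  let ?P = "\<lambda>T'. nvb_refinement T T' \<and> conforming T' \<and> M \<inter> T' = {}"
  obtain T' where T': "?P T'" and min: "\<And>T''. ?P T'' \<Longrightarrow> card T' \<le> card T''"
    using ex_has_least_nat[of ?P U card] U M by blast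
  have "nvb_refinement T' T''" if T'': "?P T''" for T''
  proof -
    obtain C where C: "nvb_refinement T C" "nvb_refinement C T'" "nvb_refinement C T''" "C \<subseteq> T' \<union> T''"
      using nvb_meet[of T T' T''] T' T'' T by blast
    have pC: "packing C" by (rule nvb_packing(1)[OF C(1) T])
    have "conforming C" by (rule conforming_meet[OF pC C(2-4)]) (use T' T'' in auto)
    moreover have "M \<inter> C = {}" using C(4) T' T'' by blast
    ultimately have "card T' \<le> card C" using min C(1) by blast
    then have "T' = C" using nvb_packing(3)[OF C(2) pC] by force
    then show ?thesis using C(3) by simp
  qed
  then show ?thesis using T' M by (auto simp: is_refine_def)
qed

text \<open>Bridges \<open>meshes\<close> and single bisections: marking exactly the elements of
  \<open>T\<close> that are missing in \<open>U\<close> yields a coarsest mesh that \<open>U\<close>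
  still refines, and the gap in cardinality shrinks.\<close>

lemma nvb_conforming_in_meshes:
  assumes "packing T" "nvb_refinement T U" "conforming U"
  shows "U \<in> meshes T"
  using assms
proof (induction "card U - card T" arbitrary: T rule: less_induct)
  case less
  show ?case
  proof (cases "T = U")
    case True then show ?thesis by (simp add: meshes.base)
  next
    case False
    let ?M = "T - U"
    obtain T' where T': "is_refine T ?M T'"
      using is_refine_exists[OF less.prems, of ?M] by blast
    have r: "nvb_refinement T T'" "nvb_refinement T' U"
      using T' less.prems by (auto simp: is_refine_def)
    have p': "packing T'" by (rule nvb_packing(1)[OF r(1) less.prems(1)])
    have "?M \<noteq> {}"
    proof
      assume "?M = {}"
      then have "T \<subseteq> U" by blast
      \<comment> \<open>A first bisection on the way to \<open>U\<close> would remove an element of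
        \<open>T\<close> for good, contradicting \<open>T \<subseteq> U\<close>.\<close>
      have "nvb_refinement T V \<Longrightarrow> nvb_refinement V U \<Longrightarrow> V = T" for V
      proof (induction rule: rtranclp_induct)
        case (step V W)
        then have "V = T" by (meson converse_rtranclp_into_rtranclp)
        then obtain K where K: "K \<in> T" "W = bisect T K" using step by (auto simp: bisection_step_iff)
        have "K \<notin> W" using child_notin_packing[OF less.prems(1) K(1) K(1), of K] K by (auto simp: bisect_def)
        moreover have "nvb_refinement T W" using K nvb_bisect by simp
        ultimately have "K \<notin> U" using nvb_no_return[OF _ step.prems less.prems(1) K(1)] by blast
        then show ?case using K \<open>T \<subseteq> U\<close> by blast
      qed simp
      then show False using less.prems(2) False by blast
    qed
    then have "T' \<noteq> T" using T' by (auto simp: is_refine_def)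
    then have lt: "card T < card T'" using nvb_packing(3)[OF r(1) less.prems(1)] by blast
    have "card T' \<le> card U" using nvb_packing(2)[OF r(2) p'] .
    then have "U \<in> meshes T'" using less.hyps[of T'] lt p' r less.prems by simp
    moreover have "T' \<in> meshes T" using T' by (meson meshes.base meshes.step)
    ultimately show ?thesis by (rule meshes_trans[rotated])
  qed
qed

text \<open>Distinct elements have distinct vertex sets of equal size, hence share at most
  \<open>d\<close> vertices, whose hull has empty interior.\<close>

lemma conforming_triangulation_packing:
  assumes "conforming_triangulation \<Omega> T"
  shows "packing (T :: 'n::finite mesh)"
  unfolding packing_def
proof (intro conjI ballI impI)
  show "finite T" "\<And>K. K \<in> T \<Longrightarrow> is_element K"
    using assms by (auto simp: conforming_triangulation_def)
  fix K K' assume K: "K \<in> T" "K' \<in> T" "K \<noteq> K'"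
  then have e: "is_element K" "is_element K'" and ne: "vertices K \<noteq> vertices K'"
    and eq: "simplex_of K \<inter> simplex_of K' = convex hull (vertices K \<inter> vertices K')"
    using assms by (auto simp: conforming_triangulation_def conforming_def inj_on_def)
  have fin: "finite (vertices K)" "finite (vertices K')" by (auto simp: vertices_def)
  have "vertices K \<inter> vertices K' \<noteq> vertices K"
    using ne fin is_element_card[OF e(1)] is_element_card[OF e(2)]
    by (metis Int_lower2 card_subset_eq)
  then have "vertices K \<inter> vertices K' \<subset> vertices K" by blast
  then have "card (vertices K \<inter> vertices K') < card (vertices K)" using fin by (rule_tac psubset_card_mono) auto
  then have "interior (convex hull (vertices K \<inter> vertices K')) = {}"
    using is_element_card[OF e(1)] fin by (intro empty_interior_convex_hull) auto
  then show "interior (simplex_of K) \<inter> interior (simplex_of K') = {}"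
    by (metis eq interior_Int)
qed

lemma overlay:
  assumes T0: "packing T0" "conforming T0" and T: "T1 \<in> meshes T0" "T2 \<in> meshes T0"
  obtains J where "J \<in> meshes T1" "J \<in> meshes T2" "card (T1 - J) + card T0 \<le> card T2"
proof -
  note r = meshes_nvb(1)[OF T(1)] meshes_nvb(1)[OF T(2)]
  note c = meshes_nvb(2)[OF T(1) T0(2)] meshes_nvb(2)[OF T(2) T0(2)]
  note p = nvb_packing(1)[OF r(1) T0(1)] nvb_packing(1)[OF r(2) T0(1)]
  obtain J where J: "nvb_refinement T1 J" "nvb_refinement T2 J" "J \<subseteq> T1 \<union> T2"
    "card (T1 - J) + card T0 \<le> card T2"
    using nvb_join[OF r(2,1) T0(1)] by blast
  have "conforming J" by (rule conforming_join[OF p J(1-3) c])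
  then show ?thesis using that nvb_conforming_in_meshes p J by blast
qed

section \<open>Smooth bump functions\<close>

text \<open>The polynomial parameter makes the family of functions \<open>p(1/x) exp(-1/x)\<close>
  closed under differentiation.\<close>

definition bump :: "real poly \<Rightarrow> real \<Rightarrow> real" where
  "bump p x = (if x > 0 then poly p (1 / x) * exp (- 1 / x) else 0)"

lemma poly_div_exp_tendsto_0: "((\<lambda>y. y ^ k * poly p y / exp y) \<longlongrightarrow> (0::real)) at_top"
proof (induction p arbitrary: k)
  case 0 then show ?case by simp
next
  case (pCons a p)
  have "((\<lambda>y. a * (y ^ k / exp y) + y ^ Suc k * poly p y / exp y) \<longlongrightarrow> a * 0 + 0) at_top"
    by (intro tendsto_intros tendsto_power_div_exp_0 pCons.IH)
  then show ?case by (simp add: algebra_simps add_divide_distrib)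
qed

text \<open>With \<open>y = 1/x\<close>, the chain rule turns \<open>p(y) exp(-y)\<close> into
  \<open>y^2 (p(y) - p'(y)) exp(-y)\<close>.\<close>

definition bump_deriv :: "real poly \<Rightarrow> real poly" where
  "bump_deriv p = [:0, 0, 1:] * (p - pderiv p)"

lemma has_real_derivative_bump: "(bump p has_real_derivative bump (bump_deriv p) x) (at x)"
proof -
  consider "x > 0" | "x < 0" | "x = 0" by linarith
  then show ?thesis
  proof cases
    case 1
    have "((\<lambda>x. poly p (1 / x) * exp (- 1 / x)) has_real_derivative bump (bump_deriv p) x) (at x)"
      using 1 by (auto intro!: derivative_eq_intros DERIV_chain2[OF poly_DERIV]
          simp: bump_def bump_deriv_def field_simps power2_eq_square)
    then show ?thesis
      by (rule has_field_derivative_transform_within_open[of _ _ _ "{0<..}"])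
        (use 1 in \<open>auto simp: bump_def\<close>)
  next
    case 2
    have "((\<lambda>x. 0) has_real_derivative bump (bump_deriv p) x) (at x)"
      using 2 by (simp add: bump_def)
    then show ?thesis
      by (rule has_field_derivative_transform_within_open[of _ _ _ "{..<0}"])
        (use 2 in \<open>auto simp: bump_def\<close>)
  next
    case 3
    \<comment> \<open>At the origin the right difference quotient is \<open>y p(y) / exp y\<close>
      with \<open>y = 1/h\<close>; the left one vanishes.\<close>
    have "((\<lambda>y. y ^ 1 * poly p y / exp y) \<longlongrightarrow> 0) at_top" by (rule poly_div_exp_tendsto_0)
    then have "((\<lambda>h. inverse h ^ 1 * poly p (inverse h) / exp (inverse h)) \<longlongrightarrow> 0) (at_right 0)"
      by (rule filterlim_compose[OF _ filterlim_inverse_at_top_right])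
    then have r: "((\<lambda>h. bump p h / h) \<longlongrightarrow> 0) (at_right 0)"
      by (rule Lim_transform_eventually)
        (auto simp: eventually_at_filter bump_def field_simps exp_minus)
    have l: "((\<lambda>h. bump p h / h) \<longlongrightarrow> 0) (at_left 0)"
      by (rule tendsto_eventually) (auto simp: eventually_at_filter bump_def)
    show ?thesis using filterlim_split_at[OF l r] by (simp add: 3 DERIV_def bump_def)
  qed
qed

section \<open>Calculus in the classes \<open>Ck\<close>\<close>

lemma partial_deriv_eq: "(\<phi> has_derivative D) (at x) \<Longrightarrow> partial_deriv i \<phi> x = D (axis i 1)"
  by (metis frechet_derivative_at partial_deriv_def)

lemma has_derivative_frechet: "\<phi> differentiable (at x) \<Longrightarrow> (\<phi> has_derivative frechet_derivative \<phi> (at x)) (at x)"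
  by (simp add: frechet_derivative_works)

lemma partial_deriv_add:
  assumes "\<And>x. \<phi> differentiable (at x)" "\<And>x. \<psi> differentiable (at x)"
  shows "partial_deriv i (\<lambda>x. \<phi> x + \<psi> x) = (\<lambda>x. partial_deriv i \<phi> x + partial_deriv i \<psi> x)"
proof
  fix x show "partial_deriv i (\<lambda>x. \<phi> x + \<psi> x) x = partial_deriv i \<phi> x + partial_deriv i \<psi> x"
    by (subst partial_deriv_eq[OF has_derivative_add[OF has_derivative_frechet[OF assms(1)] has_derivative_frechet[OF assms(2)]]])
      (simp add: partial_deriv_def)
qed

lemma partial_deriv_mult:
  assumes "\<And>x. \<phi> differentiable (at x)" "\<And>x. \<psi> differentiable (at x)"
  shows "partial_deriv i (\<lambda>x. \<phi> x * \<psi> x) = (\<lambda>x. \<phi> x * partial_deriv i \<psi> x + partial_deriv i \<phi> x * \<psi> x)"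
proof
  fix x show "partial_deriv i (\<lambda>x. \<phi> x * \<psi> x) x = \<phi> x * partial_deriv i \<psi> x + partial_deriv i \<phi> x * \<psi> x"
    by (subst partial_deriv_eq[OF has_derivative_mult[OF has_derivative_frechet[OF assms(1)] has_derivative_frechet[OF assms(2)]]])
      (simp add: partial_deriv_def)
qed

lemma Ck_Suc_imp: "Ck (Suc k) \<phi> \<Longrightarrow> Ck k \<phi>"
proof (induction k arbitrary: \<phi>)
  case 0 then show ?case
    by (auto simp: continuous_on_eq_continuous_at differentiable_imp_continuous_within)
qed auto

lemma Ck_add: "Ck k \<phi> \<Longrightarrow> Ck k \<psi> \<Longrightarrow> Ck k (\<lambda>x. \<phi> x + \<psi> x)"
proof (induction k arbitrary: \<phi> \<psi>)
  case 0 then show ?case by (auto intro: continuous_intros)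
next
  case (Suc k) then show ?case by (simp add: partial_deriv_add)
qed

lemma Ck_mult: "Ck k \<phi> \<Longrightarrow> Ck k \<psi> \<Longrightarrow> Ck k (\<lambda>x. \<phi> x * \<psi> x)"
proof (induction k arbitrary: \<phi> \<psi>)
  case 0 then show ?case by (auto intro: continuous_intros)
next
  case (Suc k)
  then have "Ck k \<phi>" "Ck k \<psi>" using Ck_Suc_imp by blast+
  then show ?case using Suc by (simp add: partial_deriv_mult Ck_add)
qed

lemma Ck_const: "Ck k (\<lambda>x::real^'n::finite. c)"
proof (induction k arbitrary: c)
  case (Suc k)
  have "partial_deriv i (\<lambda>x::real^'n::finite. c) = (\<lambda>x. 0)" for i
    by (rule ext, subst partial_deriv_eq[OF has_derivative_const]) simp
  then show ?case using Suc by simp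
qed simp

lemma Ck_prod: "finite I \<Longrightarrow> (\<And>i. i \<in> I \<Longrightarrow> Ck k (\<phi> i)) \<Longrightarrow> Ck k (\<lambda>x. \<Prod>i\<in>I. \<phi> i x)"
  by (induction rule: finite_induct) (auto intro: Ck_const Ck_mult)

text \<open>The scalar factor and the affine argument are there to close the induction: every
  partial derivative has the same form.\<close>

lemma Ck_bump:
  fixes i :: "'n::finite"
  shows "Ck k (\<lambda>x::real^'n. c * bump p (s * x $ i + a))"
proof (induction k arbitrary: c p)
  case 0
  have "continuous_on UNIV (bump p)"
    by (meson DERIV_isCont continuous_at_imp_continuous_on has_real_derivative_bump)
  then show ?case by (auto intro!: continuous_intros continuous_on_compose2[of UNIV "bump p"])
next
  case (Suc k)
  have d: "((\<lambda>x::real^'n. c * bump p (s * x $ i + a)) has_derivative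
      (\<lambda>h. c * (bump (bump_deriv p) (s * x $ i + a) * (s * h $ i)))) (at x)" for x
  proof -
    have "((\<lambda>x::real^'n. s * x $ i + a) has_derivative (\<lambda>h. s * h $ i)) (at x)"
      by (auto intro!: derivative_eq_intros bounded_linear.has_derivative[OF bounded_linear_vec_nth])
    from has_derivative_compose[OF this, of "bump p" "(*) (bump (bump_deriv p) (s * x $ i + a))"]
    show ?thesis using has_real_derivative_bump[of p "s * x $ i + a"]
      by (auto intro!: derivative_eq_intros simp: has_field_derivative_def)
  qed
  have "partial_deriv j (\<lambda>x::real^'n. c * bump p (s * x $ i + a)) =
      (\<lambda>x. (if j = i then c * s else 0) * bump (bump_deriv p) (s * x $ i + a))" for j
    by (rule ext, subst partial_deriv_eq[OF d]) (simp add: axis_def)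
  moreover have "(\<lambda>x::real^'n. c * bump p (s * x $ i + a)) differentiable (at x)" for x
    using d unfolding differentiable_def by blast
  ultimately show ?case using Suc by simp
qed

text \<open>Since \<open>exp (- 1 / (k * x))\<close> tends to \<open>1\<close> for \<open>x > 0\<close>, rescaling alone yields the indicator of the box.\<close>

definition box_bump :: "real^'n \<Rightarrow> real^'n \<Rightarrow> nat \<Rightarrow> real^'n::finite \<Rightarrow> real" where
  "box_bump a b k x = (\<Prod>i\<in>UNIV. bump 1 (real (Suc k) * (x $ i - a $ i)) * bump 1 (real (Suc k) * (b $ i - x $ i)))"

lemma smooth_box_bump: "smooth (box_bump a b k)"
  unfolding smooth_def
proof
  fix m
  have "Ck m (\<lambda>x. \<Prod>i\<in>UNIV. (1 * bump 1 (real (Suc k) * x $ i + (- real (Suc k) * a $ i))) *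
     (1 * bump 1 ((- real (Suc k)) * x $ i + real (Suc k) * b $ i)))"
    by (intro Ck_prod Ck_mult Ck_bump) auto
  also have "(\<lambda>x. \<Prod>i\<in>UNIV. (1 * bump 1 (real (Suc k) * x $ i + (- real (Suc k) * a $ i))) *
     (1 * bump 1 ((- real (Suc k)) * x $ i + real (Suc k) * b $ i))) = box_bump a b k"
    unfolding box_bump_def by (intro ext prod.cong) (simp_all add: algebra_simps)
  finally show "Ck m (box_bump a b k)" .
qed

lemma bump_1_bounds: "0 \<le> bump 1 x" "bump 1 x \<le> 1"
  by (auto simp: bump_def)

lemma box_bump_bounds: "0 \<le> box_bump a b k x" "box_bump a b k x \<le> 1"
  unfolding box_bump_def
  by (auto intro!: prod_nonneg prod_le_1 mult_nonneg_nonneg mult_le_one bump_1_bounds)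

lemma box_bump_outside: "x \<notin> box a b \<Longrightarrow> box_bump a b k x = 0"
proof -
  assume "x \<notin> box a b"
  then obtain i where "x $ i \<le> a $ i \<or> b $ i \<le> x $ i"
    by (auto simp: mem_box_cart not_less)
  then have "bump 1 (real (Suc k) * (x $ i - a $ i)) * bump 1 (real (Suc k) * (b $ i - x $ i)) = 0"
    by (auto simp: bump_def zero_less_mult_iff)
  then show ?thesis unfolding box_bump_def by (intro prod_zero) auto
qed

lemma box_bump_tendsto: "(\<lambda>k. box_bump a b k x) \<longlonglongrightarrow> indicator (box a b) x"
proof (cases "x \<in> box a b")
  case False then show ?thesis by (simp add: box_bump_outside)
next
  case True
  have t: "(\<lambda>k. bump 1 (real (Suc k) * c)) \<longlonglongrightarrow> 1" if "c > 0" for c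
  proof -
    have "(\<lambda>k. exp (- (1 / c * inverse (real (Suc k))))) \<longlonglongrightarrow> exp (- (1 / c * 0))"
      by (intro tendsto_intros LIMSEQ_inverse_real_of_nat)
    moreover have "bump 1 (real (Suc k) * c) = exp (- (1 / c * inverse (real (Suc k))))" for k
      using that by (simp add: bump_def field_simps add_pos_nonneg)
    ultimately show ?thesis by simp
  qed
  have "(\<lambda>k. box_bump a b k x) \<longlonglongrightarrow> (\<Prod>i\<in>(UNIV::'a set). 1 * 1)"
    unfolding box_bump_def using True by (intro tendsto_prod tendsto_mult t) (auto simp: mem_box_cart)
  then show ?thesis using True by simp
qed

lemma box_bump_test:
  assumes "cbox a b \<subseteq> S"
  shows "box_bump a b k \<in> test_functions S"
proof -
  have "{x. box_bump a b k x \<noteq> 0} \<subseteq> cbox a b"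
    using box_bump_outside box_subset_cbox by blast
  then have *: "closure {x. box_bump a b k x \<noteq> 0} \<subseteq> cbox a b"
    by (rule closure_minimal) (rule closed_cbox)
  moreover have "compact (closure {x. box_bump a b k x \<noteq> 0})"
    unfolding compact_eq_bounded_closed using bounded_subset[OF bounded_cbox *] by simp
  ultimately show ?thesis using assms smooth_box_bump by (auto simp: test_functions_def)
qed

section \<open>The fundamental lemma of the calculus of variations\<close>

lemma smooth_continuous: "smooth \<phi> \<Longrightarrow> continuous_on UNIV \<phi>"
  unfolding smooth_def using Ck.simps(1) by blast

lemma smooth_partial_continuous: "smooth \<phi> \<Longrightarrow> continuous_on UNIV (partial_deriv i \<phi>)"
  unfolding smooth_def using Ck.simps by blast

lemma borel_measurable_lebesgue_on:
  fixes f :: "'a::euclidean_space \<Rightarrow> 'b::topological_space"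
  shows "f \<in> borel_measurable borel \<Longrightarrow> f \<in> borel_measurable (lebesgue_on S)"
  by (intro measurable_restrict_space1 measurable_completion) simp

text \<open>Dominated convergence along the box bumps, which are test functions because the closed
  box lies in \<open>S\<close>.\<close>

lemma integral_box_eq_0:
  fixes h :: "real^'n::finite \<Rightarrow> real"
  assumes h: "integrable (lebesgue_on S) h"
    and z: "\<And>\<phi>. \<phi> \<in> test_functions S \<Longrightarrow> (LINT x|lebesgue_on S. h x * \<phi> x) = 0"
    and ab: "cbox a b \<subseteq> S"
  shows "(LINT x|lebesgue_on S. h x * indicator (box a b) x) = 0"
proof -
  note [measurable] = borel_measurable_integrable[OF h]
  have [measurable]: "box_bump a b k \<in> borel_measurable (lebesgue_on S)" for k
    by (intro borel_measurable_lebesgue_on borel_measurable_continuous_onI smooth_continuous smooth_box_bump)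
  have [measurable]: "(indicator (box a b) :: _ \<Rightarrow> real) \<in> borel_measurable (lebesgue_on S)"
    by (intro borel_measurable_lebesgue_on) simp
  have "(\<lambda>k. LINT x|lebesgue_on S. h x * box_bump a b k x) \<longlonglongrightarrow> (LINT x|lebesgue_on S. h x * indicator (box a b) x)"
  proof (rule integral_dominated_convergence[where w = "\<lambda>x. \<bar>h x\<bar>"])
    show "AE x in lebesgue_on S. (\<lambda>k. h x * box_bump a b k x) \<longlonglongrightarrow> h x * indicator (box a b) x"
      by (intro AE_I2 tendsto_intros box_bump_tendsto)
    show "AE x in lebesgue_on S. norm (h x * box_bump a b k x) \<le> \<bar>h x\<bar>" for k
      using box_bump_bounds[of a b k] by (auto simp: abs_mult mult_left_le)
    show "integrable (lebesgue_on S) (\<lambda>x. \<bar>h x\<bar>)" using h by simp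
  qed measurable
  moreover have "(LINT x|lebesgue_on S. h x * box_bump a b k x) = 0" for k
    by (intro z box_bump_test ab)
  ultimately have "(\<lambda>k::nat. 0::real) \<longlonglongrightarrow> (LINT x|lebesgue_on S. h x * indicator (box a b) x)" by simp
  then show ?thesis using LIMSEQ_unique[OF tendsto_const] by metis
qed

lemma sigma_finite_lebesgue: "sigma_finite_measure (lebesgue :: 'a::euclidean_space measure)"
proof
  obtain A :: "'a set set" where A: "countable A" "A \<subseteq> sets lborel" "\<Union>A = space lborel"
    "\<forall>a\<in>A. emeasure lborel a \<noteq> \<infinity>"
    using lborel.sigma_finite_countable by blast
  have "\<forall>a\<in>A. emeasure lebesgue a \<noteq> \<infinity>"
    using A(2,4) by (simp add: subset_eq)
  then show "\<exists>A::'a set set. countable A \<and> A \<subseteq> sets lebesgue \<and> \<Union>A = space lebesgue \<and> (\<forall>a\<in>A. emeasure lebesgue a \<noteq> \<infinity>)"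
    using A(1-3) by (intro exI[of _ A]) auto
qed

text \<open>Boxes form an intersection-stable generator of the Borel sets, and Lebesgue sets are
  Borel up to null sets; so vanishing integrals over boxes propagate to all measurable sets.\<close>

lemma AE_eq_0_on_box:
  fixes h :: "real^'n::finite \<Rightarrow> real"
  assumes S: "S \<in> sets lebesgue" and h: "integrable (lebesgue_on S) h"
    and z: "\<And>\<phi>. \<phi> \<in> test_functions S \<Longrightarrow> (LINT x|lebesgue_on S. h x * \<phi> x) = 0"
    and cd: "cbox c d \<subseteq> S"
  shows "AE x in lebesgue. x \<in> box c d \<longrightarrow> h x = 0"
proof -
  define g where "g x = indicator (box c d) x * h x" for x
  have bS: "box c d \<subseteq> S" using cd box_subset_cbox by blast
  have eq: "(LINT x|lebesgue_on S. h x * indicator (box a b) x) = (LINT x|lebesgue. indicator (box a b) x * h x)"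
    if "box a b \<subseteq> S" for a b
  proof -
    have "(LINT x|lebesgue_on S. h x * indicator (box a b) x) = (LINT x|lebesgue. indicator S x *\<^sub>R (h x * indicator (box a b) x))"
      using S by (subst integral_restrict_space) auto
    also have "\<dots> = (LINT x|lebesgue. indicator (box a b) x * h x)"
      using that by (intro Bochner_Integration.integral_cong) (auto simp: indicator_def)
    finally show ?thesis .
  qed
  have g: "integrable lebesgue g"
  proof -
    have "integrable lebesgue (\<lambda>x. indicator S x *\<^sub>R h x)"
      by (rule iffD1[OF integrable_restrict_space _]) (use S h in simp_all)
    then have "integrable lebesgue (\<lambda>x. indicator (box c d) x *\<^sub>R (indicator S x *\<^sub>R h x))"
      by (rule integrable_mult_indicator[rotated]) simp
    also have "(\<lambda>x. indicator (box c d) x *\<^sub>R (indicator S x *\<^sub>R h x)) = g"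
      using bS by (auto simp: g_def indicator_def fun_eq_iff)
    finally show ?thesis .
  qed
  have gs: "set_integrable lebesgue A g" if "A \<in> sets lebesgue" for A
    unfolding set_integrable_def using g that by (intro integrable_mult_indicator)
  have box0: "(LINT x:box a b|lebesgue. g x) = 0" for a b
  proof -
    \<comment> \<open>Cutting with \<open>box c d\<close> turns an arbitrary box into one whose
      closure lies in \<open>S\<close>.\<close>
    define a' :: "real^'n" where "a' = (\<chi> i. max (a $ i) (c $ i))"
    define b' :: "real^'n" where "b' = (\<chi> i. min (b $ i) (d $ i))"
    have i: "box a b \<inter> box c d = box a' b'" by (auto simp: mem_box_cart a'_def b'_def)
    have "cbox a' b' \<subseteq> cbox c d" by (auto simp: mem_box_cart a'_def b'_def)
    then have s: "cbox a' b' \<subseteq> S" using cd by blast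
    then have s': "box a' b' \<subseteq> S" using box_subset_cbox by blast
    have "(LINT x:box a b|lebesgue. g x) = (LINT x|lebesgue. indicator (box a' b') x * h x)"
      unfolding set_lebesgue_integral_def g_def i[symmetric]
      by (intro Bochner_Integration.integral_cong) (auto simp: indicator_def)
    then show ?thesis using integral_box_eq_0[OF h z s] eq[OF s'] by simp
  qed
  have UNIV0: "(LINT x|lebesgue. g x) = 0"
  proof -
    have "(LINT x|lebesgue. g x) = (LINT x:box c d|lebesgue. g x)"
      unfolding set_lebesgue_integral_def g_def
      by (intro Bochner_Integration.integral_cong) (auto simp: indicator_def)
    then show ?thesis using box0 by simp
  qed
  have borel0: "(LINT x:A|lebesgue. g x) = 0" if "A \<in> sets borel" for A
  proof -
    have "Int_stable (range (\<lambda>(a, b). box a b :: (real^'n) set))"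
      by (auto simp: Int_stable_def box_Int_box)
    moreover have "(range (\<lambda>(a, b). box a b :: (real^'n) set)) \<subseteq> Pow UNIV" by auto
    moreover have "A \<in> sigma_sets UNIV (range (\<lambda>(a, b). box a b))"
      using that unfolding borel_eq_box by simp
    ultimately show ?thesis
    proof (induction rule: sigma_sets_induct_disjoint)
      case (basic A) then show ?case using box0 by auto
    next
      case empty then show ?case by (simp add: set_lebesgue_integral_def)
    next
      case (compl A)
      then have "A \<in> sets borel" by (simp add: borel_eq_box)
      then have A: "A \<in> sets lebesgue" by simp
      have "(LINT x:UNIV - A|lebesgue. g x) = (LINT x|lebesgue. g x) - (LINT x:A|lebesgue. g x)"
      proof -
        have "(LINT x:UNIV - A|lebesgue. g x) = (LINT x|lebesgue. g x - indicator A x *\<^sub>R g x)"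
          unfolding set_lebesgue_integral_def
          by (intro Bochner_Integration.integral_cong) (auto simp: indicator_def)
        also have "\<dots> = (LINT x|lebesgue. g x) - (LINT x:A|lebesgue. g x)"
          unfolding set_lebesgue_integral_def
          using g gs[OF A] by (intro Bochner_Integration.integral_diff) (auto simp: set_integrable_def)
        finally show ?thesis .
      qed
      then show ?case using UNIV0 compl by simp
    next
      case (union F)
      then have "F i \<in> sets borel" for i by (auto simp: borel_eq_box)
      then have F: "F i \<in> sets lebesgue" for i by simp
      have "(LINT x:(\<Union>i. F i)|lebesgue. g x) = (\<Sum>i. (LINT x:F i|lebesgue. g x))"
        by (rule lebesgue_integral_countable_add)
          (use F union gs in \<open>auto simp: disjoint_family_on_def intro!: gs\<close>)
      then show ?case using union by simp
    qed
  qed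
  have "(LINT x:A|lebesgue. g x) = 0" if "A \<in> sets lebesgue" for A
  proof -
    obtain C T where CT: "fsigma C" "T \<in> null_sets lebesgue" "C \<union> T = A" "disjnt C T"
      by (rule lebesgue_set_almost_fsigma[OF \<open>A \<in> sets lebesgue\<close>])
    have "C \<in> sets borel" using CT(1) by (induction rule: fsigma.induct) auto
    then have "(LINT x:C|lebesgue. g x) = 0" by (rule borel0)
    moreover have "(LINT x:A|lebesgue. g x) = (LINT x:C|lebesgue. g x)"
      unfolding set_lebesgue_integral_def
    proof (rule integral_cong_AE)
      have "AE x in lebesgue. x \<notin> T"
        using CT(2) by (rule AE_not_in)
      then show "AE x in lebesgue. indicator A x *\<^sub>R g x = indicator C x *\<^sub>R g x"
        by eventually_elim (use CT in \<open>auto simp: indicator_def\<close>)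
      show "(\<lambda>x. indicator A x *\<^sub>R g x) \<in> borel_measurable lebesgue"
        using gs[OF that] by (auto simp: set_integrable_def)
      show "(\<lambda>x. indicator C x *\<^sub>R g x) \<in> borel_measurable lebesgue"
        using gs[of C] \<open>C \<in> sets borel\<close> by (auto simp: set_integrable_def)
    qed
    ultimately show ?thesis by simp
  qed
  then have "AE x in lebesgue. g x = 0"
    by (intro sigma_finite_measure.density_zero[OF _ g] sigma_finite_lebesgue) auto
  then show ?thesis by eventually_elim (auto simp: g_def indicator_def split: if_splits)
qed

text \<open>Countably many boxes with closure in \<open>S\<close> cover \<open>S\<close> by
  Lindelof, so the local null sets can be united.\<close>

lemma fundamental_lemma:
  fixes h :: "real^'n::finite \<Rightarrow> real"
  assumes S: "open S" and h: "integrable (lebesgue_on S) h"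
    and z: "\<And>\<phi>. \<phi> \<in> test_functions S \<Longrightarrow> (LINT x|lebesgue_on S. h x * \<phi> x) = 0"
  shows "AE x in lebesgue_on S. h x = 0"
proof -
  have mS: "S \<in> sets lebesgue" using S by simp
  let ?F = "{box c d | c d. cbox c d \<subseteq> S}"
  obtain F' where F': "F' \<subseteq> ?F" "countable F'" "\<Union>F' = \<Union>?F"
    by (rule Lindelof[of ?F]) auto
  have "S \<subseteq> \<Union>F'"
    unfolding F'(3)
  proof
    fix x assume "x \<in> S"
    then obtain e where e: "e > 0" "cball x e \<subseteq> S" using S open_contains_cball by blast
    then obtain a b where ab: "x \<in> box a b" "box a b \<subseteq> ball x e" using rational_boxes[OF e(1), of x] by blast
    then have "closure (box a b) \<subseteq> cball x e"
      by (meson ball_subset_cball closed_cball closure_minimal subset_trans)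
    moreover have "closure (box a b) = cbox a b" by (rule closure_box) (use ab in blast)
    ultimately have "cbox a b \<subseteq> S" using e(2) by blast
    then show "x \<in> \<Union>?F" using ab(1) by blast
  qed
  have "AE x in lebesgue. \<forall>B\<in>F'. x \<in> B \<longrightarrow> h x = 0"
  proof (subst AE_ball_countable[OF F'(2)], intro ballI)
    fix B assume "B \<in> F'"
    then obtain c d where "B = box c d" "cbox c d \<subseteq> S" using F'(1) by blast
    then show "AE x in lebesgue. x \<in> B \<longrightarrow> h x = 0" using AE_eq_0_on_box[OF mS h z] by blast
  qed
  then have "AE x in lebesgue. x \<in> S \<longrightarrow> h x = 0"
    by eventually_elim (use \<open>S \<subseteq> \<Union>F'\<close> in blast)
  then show ?thesis using mS by (subst AE_restrict_space_iff) auto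
qed

section \<open>The energy inner product\<close>

lemma L2_on_integrable_mult:
  fixes f g :: "'a::euclidean_space \<Rightarrow> real"
  assumes "L2_on S f" "L2_on S g"
  shows "integrable (lebesgue_on S) (\<lambda>x. f x * g x)"
proof (rule Bochner_Integration.integrable_bound[where f = "\<lambda>x. (norm (f x))\<^sup>2 + (norm (g x))\<^sup>2"])
  show "integrable (lebesgue_on S) (\<lambda>x. (norm (f x))\<^sup>2 + (norm (g x))\<^sup>2)"
    using assms by (auto simp: L2_on_def)
  show "(\<lambda>x. f x * g x) \<in> borel_measurable (lebesgue_on S)"
    using assms by (auto simp: L2_on_def)
  have "\<bar>a * b\<bar> \<le> a\<^sup>2 + b\<^sup>2" for a b :: real
  proof -
    have "0 \<le> \<bar>a\<bar> * \<bar>b\<bar>" "2 * (\<bar>a\<bar> * \<bar>b\<bar>) \<le> a\<^sup>2 + b\<^sup>2"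
      using sum_squares_bound[of "\<bar>a\<bar>" "\<bar>b\<bar>"] by simp_all
    then show ?thesis unfolding abs_mult by linarith
  qed
  then show "AE x in lebesgue_on S. norm (f x * g x) \<le> norm ((norm (f x))\<^sup>2 + (norm (g x))\<^sup>2)"
    by (intro AE_I2) simp
qed

lemma L2_on_norm: "L2_on S f \<Longrightarrow> L2_on S (\<lambda>x. norm (f x))"
  by (auto simp: L2_on_def)

lemma L2_on_diff:
  fixes f g :: "'a::euclidean_space \<Rightarrow> 'b::euclidean_space"
  assumes "L2_on S f" "L2_on S g"
  shows "L2_on S (\<lambda>x. f x - g x)"
  unfolding L2_on_def
proof
  note [measurable] = assms[unfolded L2_on_def, THEN conjunct1]
  show "(\<lambda>x. f x - g x) \<in> borel_measurable (lebesgue_on S)" by measurable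
  show "integrable (lebesgue_on S) (\<lambda>x. (norm (f x - g x))\<^sup>2)"
  proof (rule Bochner_Integration.integrable_bound[where f = "\<lambda>x. 2 * ((norm (f x))\<^sup>2 + (norm (g x))\<^sup>2)"])
    show "integrable (lebesgue_on S) (\<lambda>x. 2 * ((norm (f x))\<^sup>2 + (norm (g x))\<^sup>2))"
      using assms by (auto simp: L2_on_def)
    have "(norm (a - b))\<^sup>2 \<le> 2 * ((norm a)\<^sup>2 + (norm b)\<^sup>2)" for a b :: 'b
    proof -
      have "(norm (a - b))\<^sup>2 \<le> (norm a + norm b)\<^sup>2" by (intro power_mono norm_triangle_ineq4) auto
      also have "\<dots> \<le> 2 * ((norm a)\<^sup>2 + (norm b)\<^sup>2)"
        using sum_squares_bound[of "norm a" "norm b"] by (simp add: power2_sum)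
      finally show ?thesis .
    qed
    then show "AE x in lebesgue_on S. norm ((norm (f x - g x))\<^sup>2) \<le> norm (2 * ((norm (f x))\<^sup>2 + (norm (g x))\<^sup>2))"
      by (intro AE_I2) simp
  qed measurable
qed

lemma L2_on_component:
  fixes f :: "'a::euclidean_space \<Rightarrow> real^'n::finite"
  shows "L2_on S f \<Longrightarrow> L2_on S (\<lambda>x. f x $ i)"
  unfolding L2_on_def
proof (elim conjE, intro conjI)
  assume [measurable]: "f \<in> borel_measurable (lebesgue_on S)" and i: "integrable (lebesgue_on S) (\<lambda>x. (norm (f x))\<^sup>2)"
  have [measurable]: "(\<lambda>v::real^'n. v $ i) \<in> borel_measurable borel"
    by (intro borel_measurable_continuous_onI continuous_intros)
  show *: "(\<lambda>x. f x $ i) \<in> borel_measurable (lebesgue_on S)"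
    by (rule measurable_compose[where f = f and g = "\<lambda>v. v $ i"]) measurable
  show "integrable (lebesgue_on S) (\<lambda>x. (norm (f x $ i))\<^sup>2)"
  proof (rule Bochner_Integration.integrable_bound[OF i])
    show "(\<lambda>x. (norm (f x $ i))\<^sup>2) \<in> borel_measurable (lebesgue_on S)" using * by simp
    show "AE x in lebesgue_on S. norm ((norm (f x $ i))\<^sup>2) \<le> norm ((norm (f x))\<^sup>2)"
    proof (rule AE_I2)
      fix x show "norm ((norm (f x $ i))\<^sup>2) \<le> norm ((norm (f x))\<^sup>2)"
        using power_mono[OF component_le_norm_cart[of "f x" i], of 2] by simp
    qed
  qed
qed

lemma bounded_continuous_L2:
  fixes \<phi> :: "'a::euclidean_space \<Rightarrow> real"
  assumes S: "bounded S" "open S" and \<phi>: "continuous_on UNIV \<phi>"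
  shows "L2_on S \<phi>"
proof -
  have m: "S \<in> lmeasurable" using S by (simp add: bounded_set_imp_lmeasurable)
  interpret finite_measure "lebesgue_on S" by (rule finite_measure_lebesgue_on[OF m])
  have "compact (\<phi> ` closure S)"
    using S(1) by (intro compact_continuous_image continuous_on_subset[OF \<phi>]) auto
  then obtain B where B: "\<And>x. x \<in> closure S \<Longrightarrow> norm (\<phi> x) \<le> B"
    by (meson compact_imp_bounded bounded_iff image_eqI)
  have meas: "\<phi> \<in> borel_measurable (lebesgue_on S)"
    by (intro borel_measurable_lebesgue_on borel_measurable_continuous_onI \<phi>)
  have "integrable (lebesgue_on S) (\<lambda>x. (norm (\<phi> x))\<^sup>2)"
  proof (rule integrable_const_bound[where B = "B\<^sup>2"])
    show "AE x in lebesgue_on S. norm ((norm (\<phi> x))\<^sup>2) \<le> B\<^sup>2"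
    proof (rule AE_I2)
      fix x assume "x \<in> space (lebesgue_on S)"
      then have "x \<in> closure S" using closure_subset by (auto simp: space_restrict_space)
      then show "norm ((norm (\<phi> x))\<^sup>2) \<le> B\<^sup>2" using power_mono[OF B, of x 2] by simp
    qed
  qed (use meas in measurable)
  then show ?thesis using meas by (simp add: L2_on_def)
qed

text \<open>\<open>wgrad\<close> is selected by choice; any identity for it is obtained by
  exhibiting a competing weak gradient and holds almost everywhere.\<close>

lemma wgrad_unique:
  fixes S :: "(real^'n::finite) set"
  assumes S: "bounded S" "open S"
    and g: "L2_on S g" "is_weak_gradient S v g" and g': "L2_on S g'" "is_weak_gradient S v g'"
  shows "AE x in lebesgue_on S. g x = g' x"
proof -
  have "AE x in lebesgue_on S. g x $ i - g' x $ i = 0" for i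
  proof (rule fundamental_lemma[OF S(2)])
    have L: "L2_on S (\<lambda>x. g x $ i)" "L2_on S (\<lambda>x. g' x $ i)"
      using g g' by (auto intro: L2_on_component)
    \<comment> \<open>On a bounded set the constant one is square integrable, so square integrable
      functions are integrable, as the fundamental lemma demands.\<close>
    have one: "L2_on S (\<lambda>x. 1 :: real)" by (rule bounded_continuous_L2[OF S]) simp
    show "integrable (lebesgue_on S) (\<lambda>x. g x $ i - g' x $ i)"
      using L2_on_integrable_mult[OF L2_on_diff[OF L] one] by simp
    fix \<phi> assume \<phi>: "\<phi> \<in> test_functions S"
    then have "continuous_on UNIV \<phi>" by (auto simp: test_functions_def smooth_continuous)
    then have L\<phi>: "L2_on S \<phi>" by (rule bounded_continuous_L2[OF S])
    have "- (LINT x|lebesgue_on S. g x $ i * \<phi> x) = - (LINT x|lebesgue_on S. g' x $ i * \<phi> x)"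
      using g(2)[unfolded is_weak_gradient_def, rule_format, OF \<phi>, of i]
        g'(2)[unfolded is_weak_gradient_def, rule_format, OF \<phi>, of i] by (rule trans[OF sym])
    moreover have "(LINT x|lebesgue_on S. g x $ i * \<phi> x - g' x $ i * \<phi> x) =
        (LINT x|lebesgue_on S. g x $ i * \<phi> x) - (LINT x|lebesgue_on S. g' x $ i * \<phi> x)"
      using L L\<phi> by (intro Bochner_Integration.integral_diff L2_on_integrable_mult)
    ultimately show "(LINT x|lebesgue_on S. (g x $ i - g' x $ i) * \<phi> x) = 0"
      by (simp add: left_diff_distrib)
  qed
  then have "AE x in lebesgue_on S. \<forall>i\<in>(UNIV::'n set). g x $ i - g' x $ i = 0"
    by (intro AE_finite_allI) auto
  then show ?thesis by eventually_elim (auto simp: vec_eq_iff)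
qed

lemma wgrad_H1: "v \<in> H1 S \<Longrightarrow> L2_on S (wgrad S v)" "v \<in> H1 S \<Longrightarrow> is_weak_gradient S v (wgrad S v)"
  unfolding H1_def wgrad_def by (auto dest!: someI_ex)

lemma wgrad_diff:
  fixes S :: "(real^'n::finite) set"
  assumes S: "bounded S" "open S" and v: "v \<in> H1 S" "w \<in> H1 S"
  shows "(\<lambda>x. v x - w x) \<in> H1 S"
    and "AE x in lebesgue_on S. wgrad S (\<lambda>x. v x - w x) x = wgrad S v x - wgrad S w x"
proof -
  let ?g = "\<lambda>x. wgrad S v x - wgrad S w x"
  note gv = wgrad_H1[OF v(1)] and gw = wgrad_H1[OF v(2)]
  have Lv: "L2_on S v" "L2_on S w" using v by (auto simp: H1_def)
  have wg: "is_weak_gradient S (\<lambda>x. v x - w x) ?g"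
    unfolding is_weak_gradient_def
  proof (intro ballI allI)
    fix \<phi> i assume \<phi>: "\<phi> \<in> test_functions S"
    then have "smooth \<phi>" by (simp add: test_functions_def)
    then have L: "L2_on S \<phi>" "L2_on S (partial_deriv i \<phi>)"
      by (auto intro!: bounded_continuous_L2[OF S] smooth_continuous smooth_partial_continuous)
    have "(LINT x|lebesgue_on S. v x * partial_deriv i \<phi> x - w x * partial_deriv i \<phi> x) =
        (LINT x|lebesgue_on S. v x * partial_deriv i \<phi> x) - (LINT x|lebesgue_on S. w x * partial_deriv i \<phi> x)"
      using L Lv by (intro Bochner_Integration.integral_diff L2_on_integrable_mult)
    also have "\<dots> = - ((LINT x|lebesgue_on S. wgrad S v x $ i * \<phi> x) - (LINT x|lebesgue_on S. wgrad S w x $ i * \<phi> x))"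
      using gv(2) gw(2) \<phi> unfolding is_weak_gradient_def by simp
    also have "\<dots> = - (LINT x|lebesgue_on S. wgrad S v x $ i * \<phi> x - wgrad S w x $ i * \<phi> x)"
      using L gv gw by (subst Bochner_Integration.integral_diff) (auto intro!: L2_on_integrable_mult L2_on_component)
    finally show "(LINT x|lebesgue_on S. (v x - w x) * partial_deriv i \<phi> x) =
        - (LINT x|lebesgue_on S. ?g x $ i * \<phi> x)"
      by (simp add: algebra_simps)
  qed
  have Lg: "L2_on S ?g" using gv gw by (intro L2_on_diff)
  show H: "(\<lambda>x. v x - w x) \<in> H1 S"
    using L2_on_diff[OF Lv] Lg wg by (auto simp: H1_def)
  show "AE x in lebesgue_on S. wgrad S (\<lambda>x. v x - w x) x = ?g x"
    by (rule wgrad_unique[OF S wgrad_H1[OF H] Lg wg])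
qed

lemma norm_matrix_vector_mult_le: "norm ((A :: real^'n^'n::finite) *v x) \<le> real CARD('n) * norm A * norm x"
proof -
  have "norm (A *v x) \<le> (\<Sum>i\<in>UNIV. \<bar>(A *v x) $ i\<bar>)" by (rule norm_le_l1_cart)
  also have "\<dots> \<le> (\<Sum>i\<in>(UNIV::'n set). norm A * norm x)"
  proof (rule sum_mono)
    fix i
    have "\<bar>(A *v x) $ i\<bar> \<le> norm (A $ i) * norm x"
      unfolding matrix_vector_mul_component by (rule Cauchy_Schwarz_ineq2)
    also have "\<dots> \<le> norm A * norm x" by (intro mult_right_mono Finite_Cartesian_Product.norm_nth_le) auto
    finally show "\<bar>(A *v x) $ i\<bar> \<le> norm A * norm x" .
  qed
  finally show ?thesis by simp
qed

lemma bilin_integrable: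
  fixes A :: "real^'n::finite \<Rightarrow> real^'n^'n"
  assumes A: "Linf_on S A" and g: "L2_on S g" "L2_on S h"
  shows "integrable (lebesgue_on S) (\<lambda>x. (A x *v g x) \<bullet> h x)"
proof -
  obtain C where C: "AE x in lebesgue_on S. norm (A x) \<le> C"
    and [measurable]: "A \<in> borel_measurable (lebesgue_on S)" using A by (auto simp: Linf_on_def)
  have [measurable]: "g \<in> borel_measurable (lebesgue_on S)" "h \<in> borel_measurable (lebesgue_on S)"
    using g by (auto simp: L2_on_def)
  have m: "(\<lambda>x. A x *v g x) \<in> borel_measurable (lebesgue_on S)"
  proof (rule borel_measurable_continuous_Pair[where H = "(*v)"])
    show "continuous_on UNIV (\<lambda>x::(real^'n^'n) \<times> (real^'n). fst x *v snd x)"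
      unfolding matrix_vector_mult_def by (intro continuous_intros)
  qed measurable
  show ?thesis
  proof (rule Bochner_Integration.integrable_bound)
    show "integrable (lebesgue_on S) (\<lambda>x. (real CARD('n) * \<bar>C\<bar>) * (norm (g x) * norm (h x)))"
      by (intro integrable_mult_right L2_on_integrable_mult L2_on_norm g)
    show "(\<lambda>x. (A x *v g x) \<bullet> h x) \<in> borel_measurable (lebesgue_on S)" using m by measurable
    show "AE x in lebesgue_on S. norm ((A x *v g x) \<bullet> h x) \<le> norm ((real CARD('n) * \<bar>C\<bar>) * (norm (g x) * norm (h x)))"
      using C
    proof eventually_elim
      case (elim x)
      have "norm ((A x *v g x) \<bullet> h x) \<le> norm (A x *v g x) * norm (h x)"
        by (simp add: Cauchy_Schwarz_ineq2)
      also have "\<dots> \<le> (real CARD('n) * norm (A x) * norm (g x)) * norm (h x)"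
        by (intro mult_right_mono norm_matrix_vector_mult_le) auto
      also have "\<dots> \<le> (real CARD('n) * \<bar>C\<bar> * norm (g x)) * norm (h x)"
        using elim by (intro mult_right_mono mult_left_mono) auto
      finally show ?case by (simp add: abs_mult mult_ac)
    qed
  qed
qed

lemma energy_norm_nonneg:
  fixes S :: "(real^'n::finite) set"
  assumes "uniformly_spd S A"
  shows "0 \<le> bilin S A v v" "0 \<le> energy_norm S A v"
proof -
  show "0 \<le> bilin S A v v"
    unfolding bilin_def
  proof (rule integral_nonneg_AE)
    obtain c where c: "c > 0" "AE x in lebesgue_on S. \<forall>\<xi>. c * (norm \<xi>)\<^sup>2 \<le> (A x *v \<xi>) \<bullet> \<xi>"
      using assms by (auto simp: uniformly_spd_def)
    show "AE x in lebesgue_on S. 0 \<le> (A x *v wgrad S v x) \<bullet> wgrad S v x"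
      using c(2)
    proof eventually_elim
      case (elim x)
      have "0 \<le> c * (norm (wgrad S v x))\<^sup>2" using c(1) by simp
      also have "\<dots> \<le> (A x *v wgrad S v x) \<bullet> wgrad S v x" using elim by blast
      finally show ?case .
    qed
  qed
  then show "0 \<le> energy_norm S A v" by (simp add: energy_norm_def)
qed

text \<open>Expanded under the integral, since the gradient of a difference is known only almost
  everywhere; symmetry of \<open>A\<close> merges the mixed terms.\<close>

lemma energy_norm_diff:
  fixes S :: "(real^'n::finite) set"
  assumes S: "bounded S" "open S" and A: "Linf_on S A" "uniformly_spd S A"
    and v: "v \<in> H1 S" "w \<in> H1 S"
  shows "bilin S A v w = bilin S A w v"
    and "(energy_norm S A (\<lambda>x. v x - w x))\<^sup>2 = bilin S A v v - 2 * bilin S A v w + bilin S A w w"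
proof -
  let ?G = "wgrad S v" and ?H = "wgrad S w" and ?D = "wgrad S (\<lambda>x. v x - w x)"
  have L: "L2_on S ?G" "L2_on S ?H" using wgrad_H1(1) v by auto
  note d = wgrad_diff[OF S v]
  have LD: "L2_on S ?D" by (rule wgrad_H1(1)[OF d(1)])
  note I = bilin_integrable[OF A(1)]
  have sym: "AE x in lebesgue_on S. (A x *v ?G x) \<bullet> ?H x = (A x *v ?H x) \<bullet> ?G x"
  proof -
    have "AE x in lebesgue_on S. transpose (A x) = A x" using A(2) by (simp add: uniformly_spd_def)
    then show ?thesis
      by eventually_elim (metis dot_lmul_matrix inner_commute transpose_matrix_vector)
  qed
  show s: "bilin S A v w = bilin S A w v"
    unfolding bilin_def using sym I[OF L(1,2)] I[OF L(2,1)] by (intro integral_cong_AE) auto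
  have "bilin S A (\<lambda>x. v x - w x) (\<lambda>x. v x - w x) =
      (LINT x|lebesgue_on S. (A x *v ?G x) \<bullet> ?G x - (A x *v ?G x) \<bullet> ?H x - ((A x *v ?H x) \<bullet> ?G x - (A x *v ?H x) \<bullet> ?H x))"
    unfolding bilin_def
  proof (rule integral_cong_AE)
    show "AE x in lebesgue_on S. (A x *v ?D x) \<bullet> ?D x =
       (A x *v ?G x) \<bullet> ?G x - (A x *v ?G x) \<bullet> ?H x - ((A x *v ?H x) \<bullet> ?G x - (A x *v ?H x) \<bullet> ?H x)"
      using d(2) by eventually_elim (simp add: matrix_vector_mult_diff_distrib inner_diff_left inner_diff_right)
  qed (use I[OF LD LD] I L in \<open>auto intro!: borel_measurable_diff borel_measurable_integrable\<close>)
  also have "\<dots> = bilin S A v v - bilin S A v w - (bilin S A w v - bilin S A w w)"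
    unfolding bilin_def using I L by (simp add: Bochner_Integration.integral_diff Bochner_Integration.integrable_diff)
  finally have e: "bilin S A (\<lambda>x. v x - w x) (\<lambda>x. v x - w x) = bilin S A v v - 2 * bilin S A v w + bilin S A w w"
    using s by simp
  have "0 \<le> bilin S A (\<lambda>x. v x - w x) (\<lambda>x. v x - w x)" by (rule energy_norm_nonneg[OF A(2)])
  then show "(energy_norm S A (\<lambda>x. v x - w x))\<^sup>2 = bilin S A v v - 2 * bilin S A v w + bilin S A w w"
    using e by (simp add: energy_norm_def)
qed

section \<open>Linear convergence of estimator products\<close>

text \<open>Convexity of the square with weights \<open>q\<close> and \<open>1 - q\<close>, after
  writing \<open>E * b = (1 - q) * c\<close>.\<close>

lemma square_perturbed_le:
  fixes q E a b :: real
  assumes "0 \<le> q" "q < 1"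
  shows "(q * a + E * b)\<^sup>2 \<le> q * a\<^sup>2 + E\<^sup>2 / (1 - q) * b\<^sup>2"
proof -
  define c where "c = E / (1 - q) * b"
  have E: "E * b = (1 - q) * c" using assms by (simp add: c_def)
  have "q * a\<^sup>2 + (1 - q) * c\<^sup>2 - (q * a + (1 - q) * c)\<^sup>2 = q * (1 - q) * (a - c)\<^sup>2"
    by (simp add: power2_eq_square algebra_simps)
  moreover have "0 \<le> q * (1 - q) * (a - c)\<^sup>2" using assms by simp
  moreover have "(1 - q) * c\<^sup>2 = E\<^sup>2 / (1 - q) * b\<^sup>2"
    using assms by (simp add: c_def power_mult_distrib power_divide power2_eq_square)
  ultimately show ?thesis unfolding E by linarith
qed

text \<open>
  \<open>x l\<close> is the estimator on the \<open>l\<close>-th mesh, \<open>Q\<close> the squared energy of the discrete solution (by Galerkin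
  orthogonality \<open>Q k - Q n\<close> is a squared energy distance), and \<open>P\<close> the set of steps in which the marked
  elements satisfy the Doerfler criterion for \<open>x\<close>. The last condition holds for every later mesh \<open>k\<close>, not
  only the next one, because refined elements never reappear.
\<close>

definition marked_history ::
    "real \<Rightarrow> real \<Rightarrow> real \<Rightarrow> real \<Rightarrow> (nat \<Rightarrow> real) \<Rightarrow> (nat \<Rightarrow> real) \<Rightarrow> nat set \<Rightarrow> bool" where
  "marked_history C q E D x Q P \<longleftrightarrow> (\<forall>n. 0 \<le> x n) \<and>
     (\<forall>n k. n \<le> k \<longrightarrow> x k \<le> C * x n \<and> Q n \<le> Q k \<and> Q k - Q n \<le> D * (x n)\<^sup>2) \<and>
     (\<forall>n\<in>P. \<forall>k>n. x k \<le> q * x n + E * sqrt (Q k - Q n))"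

text \<open>
  \<open>L n = (x n)\<^sup>2 + E\<^sup>2 / (1 - q) * (Q m - Q n)\<close> contracts at every marked \<open>n\<close>, whatever the next
  index is at which it is evaluated; unmarked indices are skipped and cost only the constant \<open>C\<close> once.
\<close>

lemma marked_decay:
  fixes C q E D :: real
  assumes C: "1 \<le> C" and q: "0 < q" "q < 1" and D: "0 \<le> D"
  shows "\<exists>B lam. 0 < B \<and> 0 < lam \<and> lam < 1 \<and> (\<forall>x Q P m. marked_history C q E D x Q P \<longrightarrow>
     (x m)\<^sup>2 \<le> B * lam ^ card (P \<inter> {..<m}) * (x 0)\<^sup>2)"
proof -
  define E1 where "E1 = E\<^sup>2 / (1 - q)"
  define G where "G = E1 * D"
  \<comment> \<open>\<open>lam\<close> solves \<open>(1 - lam) * G = lam - q\<close>: the share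
    \<open>1 - lam\<close> of the tail energy, bounded by \<open>G\<close> times the squared
    estimator, exactly consumes the gain from \<open>q\<close>.\<close>
  define lam where "lam = (G + q) / (G + 1)"
  define B where "B = (1 + G) * C\<^sup>2"
  have E1: "0 \<le> E1" using q by (simp add: E1_def)
  have G: "0 \<le> G" using E1 D by (simp add: G_def)
  have lam: "0 < lam" "lam < 1" using G q by (auto simp: lam_def field_simps)
  have B: "0 < B" using G C by (auto simp: B_def)
  have main: "(x m)\<^sup>2 \<le> B * lam ^ card (P \<inter> {..<m}) * (x 0)\<^sup>2" if hist: "marked_history C q E D x Q P" for x Q P m
  proof -
    have pos: "\<And>n. 0 \<le> x n" and qm: "\<And>n k. n \<le> k \<Longrightarrow> x k \<le> C * x n"
      and Q: "\<And>n k. n \<le> k \<Longrightarrow> Q n \<le> Q k" and QD: "\<And>n k. n \<le> k \<Longrightarrow> Q k - Q n \<le> D * (x n)\<^sup>2"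
      and red: "\<And>n k. n \<in> P \<Longrightarrow> n < k \<Longrightarrow> x k \<le> q * x n + E * sqrt (Q k - Q n)"
      using hist unfolding marked_history_def by blast+
    define L where "L n = (x n)\<^sup>2 + E1 * (Q m - Q n)" for n
    have EQ: "E1 * (Q m - Q n) \<le> G * (x n)\<^sup>2" if "n \<le> m" for n
      using mult_left_mono[OF QD[OF that] E1] by (simp add: G_def mult_ac)
    have Lpos: "0 \<le> L n" if "n \<le> m" for n
      using Q[OF that] E1 by (auto simp: L_def)
    have step: "L k \<le> lam * L n" if "n \<in> P" "n < k" "k \<le> m" for n k
    proof -
      have "(x k)\<^sup>2 \<le> (q * x n + E * sqrt (Q k - Q n))\<^sup>2"
        using red[OF that(1,2)] pos by (intro power_mono) auto
      also have "\<dots> \<le> q * (x n)\<^sup>2 + E1 * (Q k - Q n)"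
        using square_perturbed_le[of q "x n" E "sqrt (Q k - Q n)"] q Q[of n k] that(2) by (simp add: E1_def)
      finally have "L k \<le> q * (x n)\<^sup>2 + E1 * (Q m - Q n)" by (simp add: L_def algebra_simps)
      also have "\<dots> \<le> lam * L n"
      proof -
        have lg: "lam * (G + 1) = G + q" using G by (simp add: lam_def)
        have "(1 - lam) * (E1 * (Q m - Q n)) \<le> (1 - lam) * (G * (x n)\<^sup>2)"
          using EQ[of n] that lam by (intro mult_left_mono) auto
        also have "(1 - lam) * (G * (x n)\<^sup>2) = (lam - q) * (x n)\<^sup>2"
        proof -
          have "(1 - lam) * G = lam - q" using lg by (simp add: algebra_simps)
          then show ?thesis by (metis mult.assoc)
        qed
        finally show ?thesis by (simp add: L_def algebra_simps)
      qed
      finally show ?thesis .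
    qed
    \<comment> \<open>Downward induction on \<open>l\<close>; the extra \<open>Suc\<close> counts
      the marked index \<open>n\<close> before \<open>l\<close>.\<close>
    have chain: "\<forall>n\<in>P. n < l \<longrightarrow> L m \<le> lam ^ Suc (card (P \<inter> {l..<m})) * L n" if "l \<le> m" for l
      using that
    proof (induction rule: inc_induct)
      case base then show ?case using step by simp
    next
      case (step l)
      show ?case
      proof (intro ballI impI)
        fix n assume n: "n \<in> P" "n < l"
        show "L m \<le> lam ^ Suc (card (P \<inter> {l..<m})) * L n"
        proof (cases "l \<in> P")
          case False
          then have "P \<inter> {l..<m} = P \<inter> {Suc l..<m}" by (auto simp: Suc_le_eq le_less)
          then show ?thesis using step.IH n by simp
        next
          case True
          have "P \<inter> {l..<m} = insert l (P \<inter> {Suc l..<m})" using True step.hyps by auto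
          then have c: "card (P \<inter> {l..<m}) = Suc (card (P \<inter> {Suc l..<m}))" by simp
          have "L m \<le> lam ^ Suc (card (P \<inter> {Suc l..<m})) * L l" using step.IH True by simp
          also have "\<dots> \<le> lam ^ Suc (card (P \<inter> {Suc l..<m})) * (lam * L n)"
            using \<open>\<And>n k. n \<in> P \<Longrightarrow> n < k \<Longrightarrow> k \<le> m \<Longrightarrow> L k \<le> lam * L n\<close>[OF n] step.hyps lam
            by (intro mult_left_mono) auto
          finally show ?thesis by (simp add: c mult_ac)
        qed
      qed
    qed
    show ?thesis
    proof (cases "P \<inter> {..<m} = {}")
      case True
      have "(x m)\<^sup>2 \<le> (C * x 0)\<^sup>2" using qm[of 0 m] pos by (intro power_mono) auto
      also have "\<dots> \<le> B * (x 0)\<^sup>2"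
        using G by (auto simp: B_def power_mult_distrib mult_right_mono mult_le_cancel_right1 algebra_simps)
      finally show ?thesis unfolding True by simp
    next
      case False
      define p where "p = (LEAST p. p \<in> P \<inter> {..<m})"
      have p: "p \<in> P" "p < m" using False LeastI_ex[of "\<lambda>p. p \<in> P \<inter> {..<m}"] by (auto simp: p_def)
      have "P \<inter> {..<m} = insert p (P \<inter> {Suc p..<m})"
      proof (intro equalityI subsetI)
        fix y assume y: "y \<in> P \<inter> {..<m}"
        then have "p \<le> y" unfolding p_def by (rule Least_le)
        then show "y \<in> insert p (P \<inter> {Suc p..<m})" using y by auto
      qed (use p in auto)
      then have c: "card (P \<inter> {..<m}) = Suc (card (P \<inter> {Suc p..<m}))" by simp
      have "L m \<le> lam ^ card (P \<inter> {..<m}) * L p"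
        using chain[of "Suc p"] p c by simp
      moreover have "L p \<le> B * (x 0)\<^sup>2"
      proof -
        have "L p \<le> (1 + G) * (x p)\<^sup>2" using EQ[of p] p by (simp add: L_def algebra_simps)
        also have "\<dots> \<le> (1 + G) * (C * x 0)\<^sup>2"
          using qm[of 0 p] pos G by (intro mult_left_mono power_mono) auto
        finally show ?thesis by (simp add: B_def power_mult_distrib)
      qed
      moreover have "L m = (x m)\<^sup>2" by (simp add: L_def)
      ultimately show ?thesis
        using mult_left_mono[of "L p" "B * (x 0)\<^sup>2" "lam ^ card (P \<inter> {..<m})"]
          zero_le_power[OF less_imp_le[OF lam(1)], of "card (P \<inter> {..<m})"]
        by (simp add: mult_ac)
    qed
  qed
  show ?thesis using lam B main by blast
qed

text \<open>The additional growth bound with factor one is used because blocks are evaluated at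
  their ends while the marking happens inside.\<close>

definition estimator_history ::
    "real \<Rightarrow> real \<Rightarrow> real \<Rightarrow> real \<Rightarrow> (nat \<Rightarrow> real) \<Rightarrow> (nat \<Rightarrow> real) \<Rightarrow> nat set \<Rightarrow> bool" where
  "estimator_history C q E D x Q P \<longleftrightarrow> marked_history C q E D x Q P \<and>
     (\<forall>n k. n \<le> k \<longrightarrow> x k \<le> x n + E * sqrt (Q k - Q n))"

section \<open>Round-robin activation of the goals\<close>

definition active :: "nat \<Rightarrow> (nat \<Rightarrow> nat \<Rightarrow> real) \<Rightarrow> nat \<Rightarrow> real" where
  "active N \<zeta> l = \<zeta> (l mod N + 1) l"

text \<open>Lags beyond \<open>l\<close> are omitted: the algorithm assigns them the value zero,
  which makes the comparison trivial.\<close>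

definition regular_step :: "nat \<Rightarrow> real \<Rightarrow> (nat \<Rightarrow> nat \<Rightarrow> real) \<Rightarrow> nat \<Rightarrow> bool" where
  "regular_step N \<rho> \<zeta> l \<longleftrightarrow> (\<forall>i\<in>{1..N - 1}. i \<le> l \<longrightarrow> \<rho> * active N \<zeta> (l - i) \<le> active N \<zeta> l)"

text \<open>Goals take turns with period \<open>N\<close>; the lag since goal \<open>i\<close> was
  last active is \<open>l - (i - 1)\<close> modulo \<open>N\<close>.\<close>

lemma active_index:
  assumes "i \<in> {1..N}" "N \<le> Suc l"
  obtains k where "k < N" "k \<le> l" "(l - k) mod N + 1 = i"
proof
  define p k where "p = i - 1" and "k = (l - p) mod N"
  have N: "N > 0" and p: "p \<le> l" "p < N" "i = Suc p" using assms by (auto simp: p_def)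
  show "k < N" using N by (simp add: k_def)
  have kl: "k \<le> l - p" unfolding k_def by (rule mod_less_eq_dividend)
  then show "k \<le> l" by simp
  have "l - k = (l - p - k) + p" using p kl by simp
  also have "l - p - k = N * ((l - p) div N)" unfolding k_def by (rule minus_mod_eq_mult_div)
  finally have "(l - k) mod N = p mod N" by simp
  then show "(l - k) mod N + 1 = i" using p by simp
qed

text \<open>Goal \<open>i\<close> was active fewer than \<open>N\<close> steps ago. Regularity
  compares that value with the present active one, and quasi-monotonicity carries it forward at the
  price of \<open>C\<close>. Lag zero is not among the compared ones and is settled by
  \<open>\<rho> \<le> 1\<close>.\<close>

lemma regular_step_dominates:
  assumes reg: "regular_step N \<rho> \<zeta> l" and N: "N \<le> Suc l" and \<rho>: "0 < \<rho>" "\<rho> \<le> 1" and C: "1 \<le> C"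
    and i: "i \<in> {1..N}" and pos: "\<And>l. 0 \<le> \<zeta> i l" and qm: "\<And>n k. n \<le> k \<Longrightarrow> \<zeta> i k \<le> C * \<zeta> i n"
  shows "\<rho> * \<zeta> i l \<le> C * active N \<zeta> l"
proof -
  obtain k where k: "k < N" "k \<le> l" "(l - k) mod N + 1 = i" using active_index[OF i N] .
  have a: "active N \<zeta> (l - k) = \<zeta> i (l - k)" using k by (simp add: active_def)
  have "\<rho> * active N \<zeta> (l - k) \<le> active N \<zeta> l"
  proof (cases "k = 0")
    case True then show ?thesis using a pos[of l] \<rho> by (simp add: mult_left_le_one_le)
  next
    case False then show ?thesis using reg k by (simp add: regular_step_def)
  qed
  moreover have "\<rho> * \<zeta> i l \<le> \<rho> * (C * \<zeta> i (l - k))" using qm[of "l - k" l] \<rho> by simp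
  moreover have "C * (\<rho> * active N \<zeta> (l - k)) \<le> C * active N \<zeta> l"
    using calculation(1) C by simp
  ultimately show ?thesis by (simp add: a mult_ac)
qed

text \<open>An irregular active value lies below \<rho> times one at most \<open>N - 1\<close> steps
  older; iterating this back to \<open>t\<close> collects at least one factor \<rho> per
  \<open>N\<close> steps.\<close>

lemma irregular_decay:
  assumes irr: "\<And>l. t \<le> l \<Longrightarrow> l < t + R \<Longrightarrow> \<not> regular_step N \<rho> \<zeta> l"
    and \<rho>: "0 < \<rho>" "\<rho> \<le> 1" and K: "0 \<le> K" "\<And>l. t \<le> l \<Longrightarrow> active N \<zeta> l \<le> K" and N: "0 < N"
  shows "t \<le> l \<Longrightarrow> l < t + R \<Longrightarrow> active N \<zeta> l \<le> K * \<rho> ^ ((l - t) div N)"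
proof (induction l rule: less_induct)
  case (less l)
  show ?case
  proof (cases "l - t < N")
    case True then show ?thesis using K(2) less.prems by simp
  next
    case False
    obtain i where i: "i \<in> {1..N - 1}" "i \<le> l" "active N \<zeta> l < \<rho> * active N \<zeta> (l - i)"
      using irr[OF less.prems] by (auto simp: regular_step_def not_le)
    have "active N \<zeta> (l - i) \<le> K * \<rho> ^ ((l - i - t) div N)"
      using i False less.prems by (intro less.IH) auto
    then have "active N \<zeta> l \<le> \<rho> * (K * \<rho> ^ ((l - i - t) div N))"
      using i(3) \<rho>(1) by (smt (verit) mult_left_mono)
    also have "\<dots> = K * \<rho> ^ Suc ((l - i - t) div N)" by simp
    also have "\<dots> \<le> K * \<rho> ^ ((l - t) div N)"
    proof (intro mult_left_mono power_decreasing)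
      have "(l - t) div N = Suc ((l - t - N) div N)" using False N by (simp add: le_div_geq)
      also have "(l - t - N) div N \<le> (l - i - t) div N" using i by (intro div_le_mono) auto
      finally show "(l - t) div N \<le> Suc ((l - i - t) div N)" by simp
    qed (use K \<rho> in auto)
    finally show ?thesis .
  qed
qed

lemma sum_square_le: "(\<And>i. i \<in> I \<Longrightarrow> 0 \<le> f i) \<Longrightarrow> (\<Sum>i\<in>I. (f i)\<^sup>2) \<le> (\<Sum>i\<in>I. f i :: real)\<^sup>2"
proof (cases "finite I")
  case True
  assume "\<And>i. i \<in> I \<Longrightarrow> 0 \<le> f i"
  with True show ?thesis
  proof (induction rule: finite_induct)
    case (insert a F)
    have "0 \<le> sum f F" using insert by (intro sum_nonneg) auto
    then have "(f a)\<^sup>2 + (sum f F)\<^sup>2 \<le> (f a + sum f F)\<^sup>2"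
      using insert.prems[of a] by (simp add: power2_sum)
    then show ?case using insert by force
  qed simp
qed simp

text \<open>\<open>B\<close> and \<open>mu\<close> are produced before any history is given, so they
  are uniform over all data and runs.\<close>

lemma linear_convergence:
  fixes C q E D \<rho> :: real
  assumes C: "1 \<le> C" and q: "0 < q" "q < 1" and D: "0 \<le> D" and E: "0 \<le> E"
    and \<rho>: "0 < \<rho>" "\<rho> < 1" and N: "0 < N"
  obtains B mu where "0 < B" "0 < mu" "mu < 1"
    "\<And>\<eta> \<zeta> Q Q' P P' k n. \<lbrakk>estimator_history C q E D \<eta> Q P;
       \<And>i. i \<in> {1..N} \<Longrightarrow> estimator_history C q E D (\<zeta> i) (Q' i) (P' i);
       \<And>l. regular_step N \<rho> \<zeta> l \<Longrightarrow> l \<in> P \<or> l \<in> P' (l mod N + 1)\<rbrakk>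
     \<Longrightarrow> \<eta> (k + n) * (\<Sum>i=1..N. \<zeta> i (k + n)) \<le> B * mu ^ n * (\<eta> k * (\<Sum>i=1..N. \<zeta> i k))"
proof -
  have N1: "1 \<le> real N" using N by simp
  \<comment> \<open>Summing the dominance bound over all goals shows that in a regular step the
    active goal carries at least the fraction \<open>c\<close> of the sum.\<close>
  define c where "c = \<rho> / (real N * C)"
  have c: "0 < c" "c \<le> 1"
    using \<rho> C N1 mult_mono[of 1 "real N" 1 C] by (auto simp: c_def field_simps)
  \<comment> \<open>The first entry is the contraction of the sum when one goal is marked;
    \<open>1 / 2\<close> is the one reached in a block of irregular steps.\<close>
  define q' where "q' = max (1 - (1 - q) * c) (1 / 2)"
  have q': "0 < q'" "q' < 1" using q c by (auto simp: q'_def)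
  obtain r where r: "real N * C ^ 3 * \<rho> ^ r \<le> 1 / 2"
  proof -
    have "(\<lambda>r. real N * C ^ 3 * \<rho> ^ r) \<longlonglongrightarrow> real N * C ^ 3 * 0"
      using \<rho> by (intro tendsto_mult tendsto_const LIMSEQ_power_zero) auto
    then have "eventually (\<lambda>r. real N * C ^ 3 * \<rho> ^ r < 1 / 2) sequentially"
      by (rule order_tendstoD) simp
    then show ?thesis using that less_imp_le unfolding eventually_sequentially by blast
  qed
  \<comment> \<open>\<open>r\<close> rounds for the decay, and one more round in which every goal is
    active once at the decayed level.\<close>
  define R where "R = (r + 1) * N"
  have R: "0 < R" "N \<le> R" using N by (auto simp: R_def)
  \<comment> \<open>Two perturbations occur: from the block start to the marked step and from there
    to a later block. For the sum, the factor \<open>N\<close> arises from bounding each goal's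
    energy increment by the total one.\<close>
  obtain B1 l1 where 1: "0 < B1" "0 < l1" "l1 < 1"
    "\<And>x Q P m. marked_history C q (2 * E) D x Q P \<Longrightarrow> (x m)\<^sup>2 \<le> B1 * l1 ^ card (P \<inter> {..<m}) * (x 0)\<^sup>2"
    using marked_decay[OF C q D, of "2 * E"] by metis
  obtain B2 l2 where 2: "0 < B2" "0 < l2" "l2 < 1"
    "\<And>x Q P m. marked_history C q' (2 * real N * E) D x Q P \<Longrightarrow> (x m)\<^sup>2 \<le> B2 * l2 ^ card (P \<inter> {..<m}) * (x 0)\<^sup>2"
    using marked_decay[OF C q' D, of "2 * real N * E"] by metis
  define lam where "lam = max l1 l2"
  have lam: "0 < lam" "lam < 1" using 1 2 by (auto simp: lam_def)
  \<comment> \<open>Squares of the factors decay by \<open>lam\<close> per credited block, the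
    product by its root; \<open>mu\<close> spreads this over the \<open>R\<close> steps of a
    block.\<close>
  define s where "s = sqrt lam"
  have s: "0 < s" "s < 1" using lam by (auto simp: s_def)
  define mu where "mu = s powr (1 / real R)"
  have mu: "0 < mu" "mu < 1"
  proof -
    show "0 < mu" using s by (simp add: mu_def)
    have "s powr (1 / real R) < s powr 0" using s R by (intro powr_less_mono') auto
    then show "mu < 1" using s by (simp add: mu_def)
  qed
  \<comment> \<open>\<open>C ^ 4\<close> pays twice for moving \<Delta> to a block start by
    quasi-monotonicity; division by \<open>s\<close> squared pays for the initial offset and the
    incomplete last block.\<close>
  define B where "B = (1 + sqrt (B1 * B2)) * C ^ 4 / s\<^sup>2"
  have B: "0 < B" using C s 1 2 by (auto simp: B_def intro!: divide_pos_pos mult_pos_pos add_pos_nonneg)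
  show thesis
  proof (rule that[OF B mu])
    fix \<eta> Q :: "nat \<Rightarrow> real" and \<zeta> Q' :: "nat \<Rightarrow> nat \<Rightarrow> real" and P :: "nat set" and P' :: "nat \<Rightarrow> nat set" and k n :: nat
    assume h\<eta>: "estimator_history C q E D \<eta> Q P"
      and h\<zeta>: "\<And>i. i \<in> {1..N} \<Longrightarrow> estimator_history C q E D (\<zeta> i) (Q' i) (P' i)"
      and reg: "\<And>l. regular_step N \<rho> \<zeta> l \<Longrightarrow> l \<in> P \<or> l \<in> P' (l mod N + 1)"
    note eta = h\<eta>[unfolded estimator_history_def marked_history_def]
    note zeta = h\<zeta>[unfolded estimator_history_def marked_history_def]
    define Z where "Z l = (\<Sum>i=1..N. \<zeta> i l)" for l
    define QZ where "QZ l = (\<Sum>i=1..N. Q' i l)" for l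
    have \<zeta>0: "0 \<le> \<zeta> i l" if "i \<in> {1..N}" for i l using zeta[OF that] by blast
    have Z0: "0 \<le> Z l" for l unfolding Z_def by (intro sum_nonneg \<zeta>0) auto
    have \<eta>0: "0 \<le> \<eta> l" for l using eta by blast
    have \<zeta>Z: "\<zeta> i l \<le> Z l" if "i \<in> {1..N}" for i l
      unfolding Z_def using that by (intro member_le_sum \<zeta>0) auto
    have act_idx: "l mod N + 1 \<in> {1..N}" for l using N by (simp add: Suc_leI)
    have ZC: "Z l \<le> C * Z m" if "m \<le> l" for l m
      unfolding Z_def sum_distrib_left using zeta that by (intro sum_mono) auto
    have \<eta>C: "\<eta> l \<le> C * \<eta> m" if "m \<le> l" for l m using eta that by blast
    have dQ: "0 \<le> Q' i l - Q' i m" if "m \<le> l" "i \<in> {1..N}" for i l m using zeta[OF that(2)] that by auto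
    have QZsum: "QZ l - QZ m = (\<Sum>i=1..N. Q' i l - Q' i m)" for l m by (simp add: QZ_def sum_subtractf)
    have dQZ: "Q' i l - Q' i m \<le> QZ l - QZ m" if "m \<le> l" "i \<in> {1..N}" for i l m
      unfolding QZsum using that dQ by (intro member_le_sum) auto
    have QZmono: "QZ m \<le> QZ l" if "m \<le> l" for l m
      unfolding QZ_def using zeta that by (intro sum_mono) auto
    have QZD: "QZ l - QZ m \<le> D * (Z m)\<^sup>2" if "m \<le> l" for l m
    proof -
      have "QZ l - QZ m \<le> (\<Sum>i=1..N. D * (\<zeta> i m)\<^sup>2)"
        unfolding QZsum using zeta that by (intro sum_mono) auto
      also have "\<dots> = D * (\<Sum>i=1..N. (\<zeta> i m)\<^sup>2)" by (simp add: sum_distrib_left)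
      also have "\<dots> \<le> D * (Z m)\<^sup>2"
        unfolding Z_def using D by (intro mult_left_mono sum_square_le \<zeta>0) auto
      finally show ?thesis .
    qed
    have sumE: "(\<Sum>i=1..N. E * sqrt (Q' i l - Q' i m)) \<le> real N * E * sqrt (QZ l - QZ m)" if "m \<le> l" for l m
    proof -
      have "(\<Sum>i=1..N. E * sqrt (Q' i l - Q' i m)) \<le> (\<Sum>i=1..N. E * sqrt (QZ l - QZ m))"
        using dQZ[OF that] E by (intro sum_mono mult_left_mono) auto
      then show ?thesis by simp
    qed
    have Zstep: "Z l \<le> Z m + real N * E * sqrt (QZ l - QZ m)" if "m \<le> l" for l m
    proof -
      have "Z l \<le> (\<Sum>i=1..N. \<zeta> i m + E * sqrt (Q' i l - Q' i m))"
        unfolding Z_def using zeta that by (intro sum_mono) auto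
      then show ?thesis using sumE[OF that] by (simp add: sum.distrib Z_def)
    qed
    \<comment> \<open>The offset \<open>N\<close> ensures that every goal has been active before the
      first block ends up in a comparison.\<close>
    define t where "t m = k + N + m * R" for m
    have tR: "t m + R \<le> t m'" if "m < m'" for m m'
    proof -
      have "m * R + R \<le> m' * R" using mult_le_mono1[of "Suc m" m' R] that by simp
      then show ?thesis by (simp add: t_def)
    qed
    have tmono: "t m \<le> t m'" if "m \<le> m'" for m m' using that by (simp add: t_def)
    \<comment> \<open>Blocks containing a step marked for \<eta> are credited to \<eta>. In any
      other block, a regular step is marked for its active goal; failing that, all steps are
      irregular. Either way the sum contracts.\<close>
    define PX where "PX = {m. \<exists>l\<in>P. t m \<le> l \<and> l < t m + R}"
    have X: "\<eta> (t m') \<le> q * \<eta> (t m) + 2 * E * sqrt (Q (t m') - Q (t m))" if m: "m \<in> PX" "m < m'" for m m'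
    proof -
      obtain l where l: "l \<in> P" "t m \<le> l" "l < t m + R" using m by (auto simp: PX_def)
      have lm: "l < t m'" using l tR[OF m(2)] by simp
      have a: "\<eta> (t m') \<le> q * \<eta> l + E * sqrt (Q (t m') - Q l)" using eta l lm by blast
      have b: "\<eta> l \<le> \<eta> (t m) + E * sqrt (Q l - Q (t m))" using eta l by blast
      have Qs: "Q (t m) \<le> Q l" "Q l \<le> Q (t m')" using eta l lm by auto
      have "q * \<eta> l \<le> q * (\<eta> (t m) + E * sqrt (Q l - Q (t m)))" using b q by simp
      also have "\<dots> \<le> q * \<eta> (t m) + E * sqrt (Q l - Q (t m))"
      proof -
        have "0 \<le> E * sqrt (Q l - Q (t m))" using E Qs by simp
        then have "q * (E * sqrt (Q l - Q (t m))) \<le> 1 * (E * sqrt (Q l - Q (t m)))"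
          using q by (intro mult_right_mono) auto
        then show ?thesis by (simp add: distrib_left)
      qed
      also have "E * sqrt (Q l - Q (t m)) \<le> E * sqrt (Q (t m') - Q (t m))"
        using E Qs by (intro mult_left_mono real_sqrt_le_mono) auto
      finally have "q * \<eta> l \<le> q * \<eta> (t m) + E * sqrt (Q (t m') - Q (t m))" by simp
      moreover have "E * sqrt (Q (t m') - Q l) \<le> E * sqrt (Q (t m') - Q (t m))"
        using E Qs by (intro mult_left_mono real_sqrt_le_mono) auto
      ultimately show ?thesis using a by linarith
    qed
    have Y: "Z (t m') \<le> q' * Z (t m) + 2 * real N * E * sqrt (QZ (t m') - QZ (t m))" if m: "m \<in> - PX" "m < m'" for m m'
    proof -
      have sq0: "0 \<le> 2 * real N * E * sqrt (QZ (t m') - QZ (t m))"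
        using E QZmono[OF tmono, of m m'] m by auto
      show ?thesis
      proof (cases "\<exists>l. t m \<le> l \<and> l < t m + R \<and> regular_step N \<rho> \<zeta> l")
        case True
        then obtain l where l: "t m \<le> l" "l < t m + R" "regular_step N \<rho> \<zeta> l" by blast
        let ?j = "l mod N + 1"
        have lm: "l < t m'" using l tR[OF m(2)] by simp
        have "l \<notin> P" using m l by (auto simp: PX_def)
        then have lj: "l \<in> P' ?j" using reg[OF l(3)] by blast
        have Nl: "N \<le> Suc l" using l by (simp add: t_def)
        have "\<rho> * Z l \<le> (\<Sum>i=1..N. C * active N \<zeta> l)"
          unfolding Z_def sum_distrib_left
        proof (rule sum_mono)
          fix i assume i: "i \<in> {1..N}"
          show "\<rho> * \<zeta> i l \<le> C * active N \<zeta> l"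
            by (rule regular_step_dominates[OF l(3) Nl \<rho>(1) _ C i]) (use \<rho> zeta[OF i] in auto)
        qed
        then have dom: "c * Z l \<le> \<zeta> ?j l"
          using C N1 by (simp add: c_def active_def field_simps)
        have "Z (t m') \<le> (\<Sum>i=1..N. (if i = ?j then q * \<zeta> i l else \<zeta> i l) + E * sqrt (Q' i (t m') - Q' i l))"
          unfolding Z_def
        proof (rule sum_mono)
          fix i assume i: "i \<in> {1..N}"
          show "\<zeta> i (t m') \<le> (if i = ?j then q * \<zeta> i l else \<zeta> i l) + E * sqrt (Q' i (t m') - Q' i l)"
            using zeta[OF i] lj lm by (auto simp: less_imp_le)
        qed
        also have "\<dots> \<le> (\<Sum>i=1..N. (if i = ?j then q * \<zeta> i l else \<zeta> i l)) + real N * E * sqrt (QZ (t m') - QZ l)"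
          using sumE[of l "t m'"] lm by (simp add: sum.distrib)
        also have "(\<Sum>i=1..N. (if i = ?j then q * \<zeta> i l else \<zeta> i l)) = Z l - (1 - q) * \<zeta> ?j l"
        proof -
          have "(\<Sum>i=1..N. (if i = ?j then q * \<zeta> i l else \<zeta> i l)) = (\<Sum>i=1..N. \<zeta> i l - (if i = ?j then (1 - q) * \<zeta> ?j l else 0))"
            by (intro sum.cong) (auto simp: algebra_simps)
          also have "\<dots> = Z l - (1 - q) * \<zeta> ?j l"
            using act_idx[of l] by (simp add: sum_subtractf Z_def sum.delta)
          finally show ?thesis .
        qed
        also have "Z l - (1 - q) * \<zeta> ?j l \<le> (1 - (1 - q) * c) * Z l"
          using mult_left_mono[OF dom, of "1 - q"] q by (simp add: algebra_simps)
        also have "(1 - (1 - q) * c) * Z l \<le> q' * Z l" using Z0 by (intro mult_right_mono) (auto simp: q'_def)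
        also have "q' * Z l \<le> q' * Z (t m) + real N * E * sqrt (QZ (t m') - QZ (t m))"
        proof -
          have a: "0 \<le> real N * E * sqrt (QZ l - QZ (t m))" using E QZmono[OF l(1)] by simp
          have "q' * Z l \<le> q' * (Z (t m) + real N * E * sqrt (QZ l - QZ (t m)))"
            using Zstep[OF l(1)] q' by simp
          also have "\<dots> \<le> q' * Z (t m) + real N * E * sqrt (QZ l - QZ (t m))"
            using mult_right_mono[OF less_imp_le[OF q'(2)] a] by (simp add: distrib_left)
          also have "real N * E * sqrt (QZ l - QZ (t m)) \<le> real N * E * sqrt (QZ (t m') - QZ (t m))"
            using E QZmono[of l "t m'"] lm by (intro mult_left_mono real_sqrt_le_mono) auto
          finally show ?thesis by simp
        qed
        also have "real N * E * sqrt (QZ (t m') - QZ l) \<le> real N * E * sqrt (QZ (t m') - QZ (t m))"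
          using E QZmono[OF l(1)] by (intro mult_left_mono real_sqrt_le_mono) auto
        finally show ?thesis by (simp add: mult_ac)
      next
        case False
        have act: "active N \<zeta> l \<le> C * Z (t m) * \<rho> ^ r" if l: "t m + r * N \<le> l" "l < t m + R" for l
        proof -
          have "active N \<zeta> l \<le> (C * Z (t m)) * \<rho> ^ ((l - t m) div N)"
          proof (rule irregular_decay[where t = "t m" and R = R])
            show "0 \<le> C * Z (t m)" using C Z0 by simp
            show "active N \<zeta> l' \<le> C * Z (t m)" if "t m \<le> l'" for l'
              using \<zeta>Z[OF act_idx, of l' l'] ZC[OF that] by (simp add: active_def)
          qed (use False \<rho> N l in auto)
          also have "\<dots> \<le> (C * Z (t m)) * \<rho> ^ r"
          proof (intro mult_left_mono power_decreasing)
            have "r * N div N \<le> (l - t m) div N" using l by (intro div_le_mono) auto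
            then show "r \<le> (l - t m) div N" using N by simp
          qed (use C Z0 \<rho> in auto)
          finally show ?thesis .
        qed
        have "\<zeta> i (t m') \<le> C * (C * Z (t m) * \<rho> ^ r)" if i: "i \<in> {1..N}" for i
        proof -
          \<comment> \<open>Counting back from the last step of the block, goal \<open>i\<close> is
            met within the final \<open>N\<close> steps, where \<open>r\<close> rounds of decay are
            over.\<close>
          let ?l = "t m + R - 1"
          have "N \<le> Suc ?l" using R by (simp add: t_def)
          then obtain j where j: "j < N" "j \<le> ?l" "(?l - j) mod N + 1 = i" using active_index[OF i] by blast
          have b: "t m + r * N \<le> ?l - j" "?l - j < t m + R" using j R by (auto simp: R_def)
          have "\<zeta> i (t m') \<le> C * \<zeta> i (?l - j)" using zeta[OF i] tR[OF m(2)] b by auto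
          also have "\<zeta> i (?l - j) = active N \<zeta> (?l - j)" unfolding active_def j(3) ..
          also have "C * active N \<zeta> (?l - j) \<le> C * (C * Z (t m) * \<rho> ^ r)" using act[OF b] C by simp
          finally show ?thesis .
        qed
        then have "Z (t m') \<le> (\<Sum>i=1..N. C * (C * Z (t m) * \<rho> ^ r))" unfolding Z_def by (rule sum_mono)
        also have "\<dots> = (real N * C\<^sup>2 * \<rho> ^ r) * Z (t m)" by (simp add: power2_eq_square)
        also have "\<dots> \<le> 1 / 2 * Z (t m)"
        proof (intro mult_right_mono Z0)
          have "real N * C\<^sup>2 * \<rho> ^ r \<le> real N * C ^ 3 * \<rho> ^ r"
            using C \<rho> by (intro mult_right_mono mult_left_mono power_increasing) auto
          then show "real N * C\<^sup>2 * \<rho> ^ r \<le> 1 / 2" using r by linarith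
        qed
        also have "\<dots> \<le> q' * Z (t m)" using Z0 by (intro mult_right_mono) (auto simp: q'_def)
        finally show ?thesis using sq0 by linarith
      qed
    qed
    \<comment> \<open>Each of the first \<open>m\<close> blocks is credited to exactly one factor,
      so the two exponents add up to \<open>m\<close>.\<close>
    have XY: "\<eta> (t m) * Z (t m) \<le> sqrt (B1 * B2) * s ^ m * (\<eta> (t 0) * Z (t 0))" for m
    proof -
      have x: "(\<eta> (t m))\<^sup>2 \<le> B1 * l1 ^ card (PX \<inter> {..<m}) * (\<eta> (t 0))\<^sup>2"
        by (rule 1(4)[of "\<lambda>m. \<eta> (t m)" "\<lambda>m. Q (t m)" PX]) (use eta tmono X in \<open>auto simp: marked_history_def\<close>)
      have y: "(Z (t m))\<^sup>2 \<le> B2 * l2 ^ card (- PX \<inter> {..<m}) * (Z (t 0))\<^sup>2"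
        by (rule 2(4)[of "\<lambda>m. Z (t m)" "\<lambda>m. QZ (t m)" "- PX"])
          (use tmono Y Z0 ZC QZmono QZD in \<open>auto simp: marked_history_def\<close>)
      have "PX \<inter> {..<m} \<union> - PX \<inter> {..<m} = {..<m}" by blast
      then have "card (PX \<inter> {..<m}) + card (- PX \<inter> {..<m}) = card {..<m}"
        using card_Un_disjoint[of "PX \<inter> {..<m}" "- PX \<inter> {..<m}"] by auto
      then have cm: "card (PX \<inter> {..<m}) + card (- PX \<inter> {..<m}) = m" by simp
      have "(\<eta> (t m) * Z (t m))\<^sup>2 \<le> (B1 * l1 ^ card (PX \<inter> {..<m}) * (\<eta> (t 0))\<^sup>2) * (B2 * l2 ^ card (- PX \<inter> {..<m}) * (Z (t 0))\<^sup>2)"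
        unfolding power_mult_distrib using x y 1 by (intro mult_mono) auto
      also have "\<dots> \<le> (B1 * lam ^ card (PX \<inter> {..<m}) * (\<eta> (t 0))\<^sup>2) * (B2 * lam ^ card (- PX \<inter> {..<m}) * (Z (t 0))\<^sup>2)"
        using 1 2 by (intro mult_mono mult_right_mono mult_left_mono power_mono) (auto simp: lam_def)
      also have "\<dots> = (B1 * B2) * lam ^ m * (\<eta> (t 0) * Z (t 0))\<^sup>2"
        using cm by (simp add: power_mult_distrib mult_ac flip: power_add)
      also have "\<dots> = (sqrt (B1 * B2) * s ^ m * (\<eta> (t 0) * Z (t 0)))\<^sup>2"
      proof -
        have "(s ^ m)\<^sup>2 = (s\<^sup>2) ^ m" by (simp add: mult.commute flip: power_mult)
        also have "s\<^sup>2 = lam" using lam by (simp add: s_def)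
        finally have "(s ^ m)\<^sup>2 = lam ^ m" .
        then show ?thesis using 1 2 by (simp add: power_mult_distrib)
      qed
      finally show ?thesis
        by (rule power2_le_imp_le) (use 1 2 s \<eta>0 Z0 in auto)
    qed
    have \<Delta>C: "\<eta> l * Z l \<le> C\<^sup>2 * (\<eta> m * Z m)" if "m \<le> l" for l m
    proof -
      have "\<eta> l * Z l \<le> (C * \<eta> m) * (C * Z m)"
        using that \<eta>C ZC \<eta>0 Z0 C by (intro mult_mono) auto
      then show ?thesis by (simp add: power2_eq_square mult_ac)
    qed
    have \<Delta>0: "0 \<le> \<eta> l * Z l" for l using \<eta>0 Z0 by simp
    have mun: "mu ^ n / s\<^sup>2 = s powr (real n / real R - 2)"
    proof -
      have "mu ^ n = s powr (real n / real R)"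
        using s by (simp add: mu_def powr_powr flip: powr_realpow)
      moreover have "s powr 2 = s\<^sup>2" using s by simp
      ultimately show ?thesis by (simp only: powr_diff)
    qed
    \<comment> \<open>For \<open>n < N\<close> no block has started, but the shifted exponent is
      negative, so quasi-monotonicity suffices.\<close>
    have main: "\<eta> (k + n) * Z (k + n) \<le> (1 + sqrt (B1 * B2)) * C ^ 4 * s powr (real n / real R - 2) * (\<eta> k * Z k)"
    proof (cases "n < N")
      case True
      have "real n / real R \<le> 1" using True R by simp
      then have "s powr 0 \<le> s powr (real n / real R - 2)" using s by (intro powr_mono') auto
      then have p: "1 \<le> s powr (real n / real R - 2)" using s by simp
      have "C\<^sup>2 * 1 \<le> ((1 + sqrt (B1 * B2)) * C ^ 4) * s powr (real n / real R - 2)"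
      proof (intro mult_mono p)
        have "1 * C\<^sup>2 \<le> (1 + sqrt (B1 * B2)) * C ^ 4" using C 1 2 by (intro mult_mono power_increasing) auto
        then show "C\<^sup>2 \<le> (1 + sqrt (B1 * B2)) * C ^ 4" by simp
      qed (use C 1 2 in auto)
      then have "C\<^sup>2 * (\<eta> k * Z k) \<le> ((1 + sqrt (B1 * B2)) * C ^ 4) * s powr (real n / real R - 2) * (\<eta> k * Z k)"
        using \<Delta>0 by (intro mult_right_mono) auto
      then show ?thesis using \<Delta>C[of k "k + n"] by simp
    next
      case False
      define m where "m = (n - N) div R"
      have "m * R \<le> n - N" unfolding m_def by simp
      then have tm: "t m \<le> k + n" using False by (simp add: t_def)
      have "n - N < (m + 1) * R"
        unfolding m_def using R(1) dividend_less_div_times[of R "n - N"] by (simp add: algebra_simps)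
      then have "n \<le> (m + 2) * R" using R(2) by simp
      then have "real n \<le> real ((m + 2) * R)" by (rule of_nat_mono)
      then have "real n / real R - 2 \<le> real m" using R by (simp add: field_simps)
      then have sm: "s ^ m \<le> s powr (real n / real R - 2)"
        using powr_mono'[of "real n / real R - 2" "real m" s] s by (simp add: powr_realpow)
      have "\<eta> (k + n) * Z (k + n) \<le> C\<^sup>2 * (\<eta> (t m) * Z (t m))" by (rule \<Delta>C[OF tm])
      also have "\<dots> \<le> C\<^sup>2 * (sqrt (B1 * B2) * s ^ m * (\<eta> (t 0) * Z (t 0)))" using XY[of m] by (intro mult_left_mono) auto
      also have "\<dots> \<le> C\<^sup>2 * (sqrt (B1 * B2) * s ^ m * (C\<^sup>2 * (\<eta> k * Z k)))"
        using \<Delta>C[of k "t 0"] 1 2 s by (intro mult_left_mono) (auto simp: t_def)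
      also have "\<dots> = sqrt (B1 * B2) * C ^ 4 * s ^ m * (\<eta> k * Z k)" by (simp add: power4_eq_xxxx power2_eq_square mult_ac)
      also have "\<dots> \<le> (1 + sqrt (B1 * B2)) * C ^ 4 * s powr (real n / real R - 2) * (\<eta> k * Z k)"
        using sm \<eta>0 Z0 C 1(1) 2(1) s by (intro mult_mono) auto
      finally show ?thesis .
    qed
    have "B * mu ^ n = (1 + sqrt (B1 * B2)) * C ^ 4 * (mu ^ n / s\<^sup>2)" by (simp add: B_def)
    then show "\<eta> (k + n) * (\<Sum>i=1..N. \<zeta> i (k + n)) \<le> B * mu ^ n * (\<eta> k * (\<Sum>i=1..N. \<zeta> i k))"
      using main by (simp add: mun Z_def)
  qed
qed

section \<open>From linear convergence to algebraic rates\<close>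

lemma sum_power_reverse_le:
  assumes "0 \<le> x" "x < (1::real)"
  shows "(\<Sum>k<l. x ^ (l - k)) \<le> 1 / (1 - x)"
proof -
  have "(\<Sum>k<l. x ^ (l - k)) = (\<Sum>k<l. x ^ Suc k)"
    by (subst sum.nat_diff_reindex[symmetric]) (intro sum.cong, auto simp: Suc_diff_Suc)
  also have "\<dots> = x * (\<Sum>k<l. x ^ k)" by (simp add: sum_distrib_left)
  also have "\<dots> \<le> 1 * (\<Sum>k<l. x ^ k)" using assms by (intro mult_right_mono sum_nonneg) auto
  also have "\<dots> \<le> 1 / (1 - x)" using assms by (simp add: sum_gp_strict divide_right_mono)
  finally show ?thesis .
qed

lemma powr_power_commute: "0 < x \<Longrightarrow> (x ^ n) powr a = (x powr a) ^ n" for x :: real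
  by (induction n) (simp_all add: powr_mult)

text \<open>Solving the bound for \<open>m k\<close> and inserting linear convergence from
  \<open>k\<close> to \<open>l\<close> leaves a geometric series in \<open>l - k\<close>, dominated
  by its most recent terms.\<close>

lemma algebraic_rate:
  fixes m \<Delta> c :: "nat \<Rightarrow> real"
  assumes B: "0 < B" and mu: "0 < mu" "mu < 1" and \<sigma>: "0 < \<sigma>" and Cm: "0 \<le> Cm"
    and \<Delta>: "\<And>l. 0 \<le> \<Delta> l" "\<And>k n. \<Delta> (k + n) \<le> B * mu ^ n * \<Delta> k" "\<Delta> l \<le> G"
    and m: "\<And>k. 0 \<le> m k" "\<And>k. m k powr \<sigma> * \<Delta> k \<le> G"
    and c: "0 \<le> c l" "c l \<le> Cm * (\<Sum>k<l. m k)"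
  shows "(c l + 1) powr \<sigma> * \<Delta> l \<le> (Cm * B powr (1 / \<sigma>) / (1 - mu powr (1 / \<sigma>)) + 1) powr \<sigma> * G"
proof (cases "\<Delta> l = 0")
  case True then show ?thesis using \<Delta>(3) by simp
next
  case False
  then have pos: "0 < \<Delta> l" using \<Delta>(1)[of l] by simp
  have G: "0 < G" using pos \<Delta>(3) by simp
  define nu where "nu = mu powr (1 / \<sigma>)"
  have nu: "0 < nu" "nu < 1"
  proof -
    show "0 < nu" using mu by (simp add: nu_def)
    have "mu powr (1 / \<sigma>) < mu powr 0" using mu \<sigma> by (intro powr_less_mono') auto
    then show "nu < 1" using mu by (simp add: nu_def)
  qed
  define g where "g = (G / \<Delta> l) powr (1 / \<sigma>)"
  have root: "y \<le> z powr (1 / \<sigma>)" if "y powr \<sigma> \<le> z" "0 \<le> y" for y z :: real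
  proof -
    have "(y powr \<sigma>) powr (1 / \<sigma>) \<le> z powr (1 / \<sigma>)" using that \<sigma> by (intro powr_mono2) auto
    then show ?thesis using that \<sigma> by (simp add: powr_powr)
  qed
  have g1: "1 \<le> g" unfolding g_def using \<Delta>(3) pos by (intro root) auto
  have mk: "m k \<le> g * B powr (1 / \<sigma>) * nu ^ (l - k)" if "k < l" for k
  proof -
    have d: "\<Delta> l \<le> B * mu ^ (l - k) * \<Delta> k" using \<Delta>(2)[of k "l - k"] that by simp
    then have k0: "0 < \<Delta> k" using pos \<Delta>(1)[of k] by (cases "\<Delta> k = 0") auto
    have "m k powr \<sigma> \<le> G / \<Delta> k" using m(2)[of k] k0 by (simp add: field_simps)
    also have "\<dots> \<le> G * (B * mu ^ (l - k)) / \<Delta> l"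
      using d k0 pos G by (simp add: field_simps)
    finally have "m k \<le> (G * (B * mu ^ (l - k)) / \<Delta> l) powr (1 / \<sigma>)" using m(1) by (intro root)
    also have "\<dots> = ((G / \<Delta> l) * B * mu ^ (l - k)) powr (1 / \<sigma>)" by (simp add: mult_ac)
    also have "\<dots> = g * B powr (1 / \<sigma>) * (mu ^ (l - k)) powr (1 / \<sigma>)"
      using G pos B mu powr_mult[of "G / \<Delta> l * B" "mu ^ (l - k)" "1 / \<sigma>"] powr_mult[of "G / \<Delta> l" B "1 / \<sigma>"]
      unfolding g_def by simp
    also have "(mu ^ (l - k)) powr (1 / \<sigma>) = nu ^ (l - k)"
      unfolding nu_def
      by (rule powr_power_commute) (use mu in simp)
    finally show ?thesis .
  qed
  have "(\<Sum>k<l. m k) \<le> (\<Sum>k<l. g * B powr (1 / \<sigma>) * nu ^ (l - k))" using mk by (intro sum_mono) auto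
  also have "\<dots> = g * B powr (1 / \<sigma>) * (\<Sum>k<l. nu ^ (l - k))" by (simp add: sum_distrib_left)
  also have "\<dots> \<le> g * B powr (1 / \<sigma>) * (1 / (1 - nu))"
    using nu g1 by (intro mult_left_mono sum_power_reverse_le) auto
  finally have "Cm * (\<Sum>k<l. m k) \<le> Cm * (g * B powr (1 / \<sigma>) * (1 / (1 - nu)))"
    using Cm by (rule mult_left_mono)
  \<comment> \<open>The added one is absorbed by \<open>g\<close>, which is at least one because
    \<open>\<Delta> l \<le> G\<close>.\<close>
  then have "c l + 1 \<le> Cm * (g * B powr (1 / \<sigma>) * (1 / (1 - nu))) + g"
    using c(2) g1 by linarith
  then have "c l + 1 \<le> g * (Cm * B powr (1 / \<sigma>) / (1 - nu) + 1)" by (simp add: algebra_simps)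
  then have "(c l + 1) powr \<sigma> \<le> (g * (Cm * B powr (1 / \<sigma>) / (1 - nu) + 1)) powr \<sigma>"
    using c(1) \<sigma> by (intro powr_mono2) auto
  also have "\<dots> = (G / \<Delta> l) * (Cm * B powr (1 / \<sigma>) / (1 - nu) + 1) powr \<sigma>"
  proof -
    have "0 \<le> Cm * B powr (1 / \<sigma>) / (1 - nu) + 1" using Cm nu by simp
    moreover have "g powr \<sigma> = G / \<Delta> l" using G pos \<sigma> by (simp add: g_def powr_powr)
    moreover have "0 \<le> g" using g1 by simp
    ultimately show ?thesis by (simp add: powr_mult)
  qed
  finally have "(c l + 1) powr \<sigma> * \<Delta> l \<le> (G / \<Delta> l) * (Cm * B powr (1 / \<sigma>) / (1 - nu) + 1) powr \<sigma> * \<Delta> l"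
    using pos by (intro mult_right_mono) auto
  also have "\<dots> = (Cm * B powr (1 / \<sigma>) / (1 - nu) + 1) powr \<sigma> * G" using pos by simp
  finally show ?thesis by (simp add: nu_def)
qed

section \<open>Consequences of the estimator properties\<close>

lemma est_nonneg: "0 \<le> est \<mu> U"
  by (simp add: est_def sum_nonneg)

lemma est_square: "(est \<mu> U)\<^sup>2 = (\<Sum>K\<in>U. (\<mu> K)\<^sup>2)"
  by (simp add: est_def sum_nonneg)

lemma est_mono: "finite V \<Longrightarrow> U \<subseteq> V \<Longrightarrow> est \<mu> U \<le> est \<mu> V"
  by (auto simp: est_def intro!: sum_mono2)

lemma est_split: "finite U \<Longrightarrow> (est \<mu> U)\<^sup>2 = (est \<mu> (U - V))\<^sup>2 + (est \<mu> (U \<inter> V))\<^sup>2"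
  unfolding est_square by (subst sum.Int_Diff[of U _ V]) auto

text \<open>The drop of the estimator that forces the refined elements to satisfy the Doerfler
  criterion; it is what the triangle inequality in \<open>doerfler_optimality\<close> leaves
  over.\<close>

definition kappa :: "real \<Rightarrow> real \<Rightarrow> real \<Rightarrow> real" where
  "kappa Cstab Cdrel \<theta> = sqrt (1 - \<theta>) - Cstab * Cdrel * sqrt \<theta>"

lemma kappa_pos:
  assumes "0 < Cstab" "0 < Cdrel" "\<theta> < theta_star Cstab Cdrel"
  shows "0 < kappa Cstab Cdrel \<theta>"
proof -
  have "\<theta> * (1 + Cstab\<^sup>2 * Cdrel\<^sup>2) < 1"
    using assms by (simp add: theta_star_def field_simps add_pos_nonneg)
  then have "(Cstab * Cdrel)\<^sup>2 * \<theta> < 1 - \<theta>" by (simp add: power_mult_distrib algebra_simps)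
  then have "sqrt ((Cstab * Cdrel)\<^sup>2 * \<theta>) < sqrt (1 - \<theta>)" by simp
  then show ?thesis using assms by (simp add: kappa_def real_sqrt_mult)
qed

text \<open>One setting for the primal and all dual problems. The Hilbert space structure enters
  only through the potential \<open>Q\<close>, whose differences along nested meshes are squared
  distances of discrete solutions.\<close>

locale estimator_setting =
  fixes T0 :: "'n::finite mesh" and X :: "'n mesh \<Rightarrow> (real^'n \<Rightarrow> real) set" and nrm :: "(real^'n \<Rightarrow> real) \<Rightarrow> real"
    and Cstab qred Cdrel Cmon :: real and \<mu> :: "'n mesh \<Rightarrow> (real^'n \<Rightarrow> real) \<Rightarrow> 'n element \<Rightarrow> real"
    and w :: "'n mesh \<Rightarrow> real^'n \<Rightarrow> real" and Q :: "'n mesh \<Rightarrow> real"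
  assumes T0: "packing T0" "conforming T0"
    and bounds: "0 < Cstab" "0 < Cdrel" "0 < Cmon" "0 < qred" "qred < 1"
    and props: "estimator_properties T0 X nrm Cstab qred Cdrel Cmon \<mu> w"
    and nested: "\<And>TH Th. TH \<in> meshes T0 \<Longrightarrow> Th \<in> meshes TH \<Longrightarrow> X TH \<subseteq> X Th"
    and solution: "\<And>TH. TH \<in> meshes T0 \<Longrightarrow> w TH \<in> X TH"
    and nrm_nonneg: "\<And>v. 0 \<le> nrm v"
    and energy: "\<And>TH Th. TH \<in> meshes T0 \<Longrightarrow> Th \<in> meshes TH \<Longrightarrow>
      (nrm (\<lambda>x. w Th x - w TH x))\<^sup>2 = Q Th - Q TH"
begin

definition loc :: "'n mesh \<Rightarrow> 'n element \<Rightarrow> real" where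
  "loc TH = \<mu> TH (w TH)"

definition tot :: "'n mesh \<Rightarrow> real" where
  "tot TH = est (loc TH) TH"

lemma tot_nonneg: "0 \<le> tot TH" by (simp add: tot_def est_nonneg)

lemma mesh_finite: "TH \<in> meshes T0 \<Longrightarrow> finite TH"
  using nvb_packing(1)[OF meshes_nvb(1) T0(1)] by (auto simp: packing_def)

lemma nrm_eq: "TH \<in> meshes T0 \<Longrightarrow> Th \<in> meshes TH \<Longrightarrow> nrm (\<lambda>x. w Th x - w TH x) = sqrt (Q Th - Q TH)"
  by (rule real_sqrt_unique[symmetric]) (rule energy, assumption+, rule nrm_nonneg)

lemma stable:
  "TH \<in> meshes T0 \<Longrightarrow> Th \<in> meshes TH \<Longrightarrow> U \<subseteq> Th \<inter> TH \<Longrightarrow> vH \<in> X TH \<Longrightarrow> vh \<in> X Th \<Longrightarrow>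
    \<bar>est (\<mu> Th vh) U - est (\<mu> TH vH) U\<bar> \<le> Cstab * nrm (\<lambda>x. vh x - vH x)"
  using props unfolding estimator_properties_def stability_def by blast

lemma reliable: "TH \<in> meshes T0 \<Longrightarrow> Th \<in> meshes TH \<Longrightarrow> sqrt (Q Th - Q TH) \<le> Cdrel * est (loc TH) (TH - Th)"
  using props unfolding estimator_properties_def discrete_reliability_def loc_def by (simp flip: nrm_eq)

lemma quasi_monotone: "TH \<in> meshes T0 \<Longrightarrow> Th \<in> meshes TH \<Longrightarrow> tot Th \<le> Cmon * tot TH"
  using props unfolding estimator_properties_def quasi_monotonicity_def tot_def loc_def by blast

lemma estimator_reduction:
  assumes TH: "TH \<in> meshes T0" and Th: "Th \<in> meshes TH"
  shows "tot Th \<le> sqrt ((tot TH)\<^sup>2 - (1 - qred\<^sup>2) * (est (loc TH) (TH - Th))\<^sup>2) + Cstab * sqrt (Q Th - Q TH)"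
proof -
  have Th0: "Th \<in> meshes T0" by (rule meshes_trans[OF TH Th])
  have wX: "w TH \<in> X Th" "w TH \<in> X TH" "w Th \<in> X Th"
    using nested[OF TH Th] solution TH Th0 by auto
  have "\<bar>est (\<mu> Th (w Th)) Th - est (\<mu> Th (w TH)) Th\<bar> \<le> Cstab * nrm (\<lambda>x. w Th x - w TH x)"
    by (rule stable[OF Th0 meshes.base]) (use wX in auto)
  then have 1: "tot Th \<le> est (\<mu> Th (w TH)) Th + Cstab * sqrt (Q Th - Q TH)"
    by (simp add: tot_def loc_def nrm_eq[OF TH Th])
  \<comment> \<open>Stability with equal arguments shows that the estimator on the unrefined
    elements does not change with the mesh.\<close>
  have "nrm (\<lambda>x. w TH x - w TH x) = 0" using nrm_eq[OF TH meshes.base] by simp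
  then have "est (\<mu> Th (w TH)) (Th \<inter> TH) = est (loc TH) (Th \<inter> TH)"
    using stable[OF TH Th, of "Th \<inter> TH" "w TH" "w TH"] wX by (simp add: loc_def)
  moreover have "est (\<mu> Th (w TH)) (Th - TH) \<le> qred * est (loc TH) (TH - Th)"
    using props TH Th wX unfolding estimator_properties_def reduction_def loc_def by blast
  then have "(est (\<mu> Th (w TH)) (Th - TH))\<^sup>2 \<le> qred\<^sup>2 * (est (loc TH) (TH - Th))\<^sup>2"
    using est_nonneg by (metis power_mono power_mult_distrib)
  ultimately have "(est (\<mu> Th (w TH)) Th)\<^sup>2 \<le> (est (loc TH) (Th \<inter> TH))\<^sup>2 + qred\<^sup>2 * (est (loc TH) (TH - Th))\<^sup>2"
    using est_split[OF mesh_finite[OF Th0], of "\<mu> Th (w TH)" TH] by simp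
  also have "\<dots> = (tot TH)\<^sup>2 - (1 - qred\<^sup>2) * (est (loc TH) (TH - Th))\<^sup>2"
    using est_split[OF mesh_finite[OF TH], of "loc TH" Th] by (simp add: tot_def Int_commute algebra_simps)
  finally have "est (\<mu> Th (w TH)) Th \<le> sqrt ((tot TH)\<^sup>2 - (1 - qred\<^sup>2) * (est (loc TH) (TH - Th))\<^sup>2)"
    by (rule real_le_rsqrt)
  then show ?thesis using 1 by simp
qed

lemma perturbed_monotone:
  assumes TH: "TH \<in> meshes T0" and Th: "Th \<in> meshes TH"
  shows "tot Th \<le> tot TH + Cstab * sqrt (Q Th - Q TH)"
proof -
  have "qred\<^sup>2 \<le> 1" using bounds by (simp add: power_le_one)
  then have "(tot TH)\<^sup>2 - (1 - qred\<^sup>2) * (est (loc TH) (TH - Th))\<^sup>2 \<le> (tot TH)\<^sup>2" by simp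
  then have "sqrt ((tot TH)\<^sup>2 - (1 - qred\<^sup>2) * (est (loc TH) (TH - Th))\<^sup>2) \<le> tot TH"
    using tot_nonneg by (simp add: real_le_lsqrt)
  then show ?thesis using estimator_reduction[OF TH Th] by linarith
qed

lemma doerfler_reduction:
  assumes TH: "TH \<in> meshes T0" and Th: "Th \<in> meshes TH"
    and M: "M \<subseteq> TH - Th" "\<theta> * (tot TH)\<^sup>2 \<le> (est (loc TH) M)\<^sup>2"
  shows "tot Th \<le> q_est qred \<theta> * tot TH + Cstab * sqrt (Q Th - Q TH)"
proof -
  have q: "qred\<^sup>2 \<le> 1" using bounds by (simp add: power_le_one)
  have "est (loc TH) M \<le> est (loc TH) (TH - Th)" using mesh_finite[OF TH] M by (intro est_mono) auto
  then have "\<theta> * (tot TH)\<^sup>2 \<le> (est (loc TH) (TH - Th))\<^sup>2"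
    using M(2) est_nonneg by (meson order_trans power_mono)
  then have "(1 - qred\<^sup>2) * (\<theta> * (tot TH)\<^sup>2) \<le> (1 - qred\<^sup>2) * (est (loc TH) (TH - Th))\<^sup>2"
    using q by (intro mult_left_mono) auto
  then have "sqrt ((tot TH)\<^sup>2 - (1 - qred\<^sup>2) * (est (loc TH) (TH - Th))\<^sup>2) \<le> sqrt ((1 - (1 - qred\<^sup>2) * \<theta>) * (tot TH)\<^sup>2)"
    by (intro real_sqrt_le_mono) (simp add: algebra_simps)
  also have "\<dots> = q_est qred \<theta> * tot TH"
    using tot_nonneg by (simp add: q_est_def real_sqrt_mult)
  finally show ?thesis using estimator_reduction[OF TH Th] by linarith
qed

text \<open>If the refined elements failed the criterion, discrete reliability would make the
  solutions so close that stability bounds the estimator on the kept elements below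
  \<open>sqrt (1 - \<theta>) * tot TH\<close>; refined and kept parts together would miss the
  total.\<close>

lemma doerfler_optimality:
  assumes TH: "TH \<in> meshes T0" and Th: "Th \<in> meshes TH"
    and \<theta>: "0 < \<theta>" "\<theta> < 1" and le: "tot Th \<le> kappa Cstab Cdrel \<theta> * tot TH"
  shows "\<theta> * (tot TH)\<^sup>2 \<le> (est (loc TH) (TH - Th))\<^sup>2"
proof (rule ccontr)
  let ?r = "est (loc TH) (TH - Th)"
  assume "\<not> ?thesis"
  then have lt: "?r\<^sup>2 < \<theta> * (tot TH)\<^sup>2" by simp
  then have "sqrt (?r\<^sup>2) < sqrt (\<theta> * (tot TH)\<^sup>2)" by (rule real_sqrt_less_mono)
  then have r: "?r < sqrt \<theta> * tot TH" using est_nonneg tot_nonneg by (simp add: real_sqrt_mult)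
  have Th0: "Th \<in> meshes T0" by (rule meshes_trans[OF TH Th])
  have "\<bar>est (\<mu> Th (w Th)) (TH \<inter> Th) - est (\<mu> TH (w TH)) (TH \<inter> Th)\<bar> \<le> Cstab * nrm (\<lambda>x. w Th x - w TH x)"
    using solution TH Th0 by (intro stable[OF TH Th]) auto
  then have "est (loc TH) (TH \<inter> Th) \<le> est (loc Th) (TH \<inter> Th) + Cstab * sqrt (Q Th - Q TH)"
    by (simp add: loc_def nrm_eq[OF TH Th])
  also have "est (loc Th) (TH \<inter> Th) \<le> tot Th"
    unfolding tot_def using mesh_finite[OF Th0] by (intro est_mono) auto
  also have "tot Th \<le> kappa Cstab Cdrel \<theta> * tot TH" by (rule le)
  also have "Cstab * sqrt (Q Th - Q TH) \<le> Cstab * (Cdrel * ?r)"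
    using reliable[OF TH Th] bounds by simp
  also have "Cstab * (Cdrel * ?r) < Cstab * (Cdrel * (sqrt \<theta> * tot TH))"
    using r bounds by simp
  finally have "est (loc TH) (TH \<inter> Th) < sqrt (1 - \<theta>) * tot TH"
    by (simp add: kappa_def algebra_simps)
  then have "(est (loc TH) (TH \<inter> Th))\<^sup>2 \<le> (sqrt (1 - \<theta>) * tot TH)\<^sup>2"
    using est_nonneg by (intro power_mono) auto
  then have "(est (loc TH) (TH \<inter> Th))\<^sup>2 \<le> (1 - \<theta>) * (tot TH)\<^sup>2"
    using \<theta> by (simp add: power_mult_distrib)
  then show False
    using lt est_split[OF mesh_finite[OF TH], of "loc TH" Th] by (simp add: tot_def algebra_simps)
qed

lemma doerfler_set_of_optimal_size:
  assumes TH: "TH \<in> meshes T0" and \<theta>: "0 < \<theta>" "\<theta> < 1" "0 < kappa Cstab Cdrel \<theta>" and s: "0 < s"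
    and S: "0 \<le> S" "approx_norm T0 s tot = ennreal S"
  shows "\<exists>R\<in>doerfler \<theta> TH (loc TH). real (card R) powr s * (kappa Cstab Cdrel \<theta> / Cmon * tot TH) \<le> S"
proof (cases "tot TH = 0")
  case True
  then have "{} \<in> doerfler \<theta> TH (loc TH)" by (simp add: doerfler_def tot_def)
  then show ?thesis using S by (intro bexI[of _ "{}"]) auto
next
  case False
  \<comment> \<open>Chosen so that \<open>Cmon * a\<close> is the threshold of Doerfler optimality:
    the overlay loses a factor \<open>Cmon\<close> against the near-best mesh.\<close>
  define a where "a = kappa Cstab Cdrel \<theta> / Cmon * tot TH"
  have a: "0 < a" using False tot_nonneg[of TH] \<theta> bounds by (simp add: a_def)
  have "\<exists>n. S < a * (real n + 1) powr s"
  proof -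
    obtain n where n: "(S / a + 1) powr (1 / s) < real n" using reals_Archimedean2 by blast
    have "S / a < S / a + 1" by simp
    also have "S / a + 1 = ((S / a + 1) powr (1 / s)) powr s"
      using S a s by (simp add: powr_powr add_nonneg_nonneg)
    also have "\<dots> \<le> (real n + 1) powr s" using n s by (intro powr_mono2) auto
    finally show ?thesis using a by (auto simp: field_simps)
  qed
  \<comment> \<open>The strict inequality at \<open>n\<close> provides a mesh in the class with
    estimator below \<open>a\<close>; its failure at \<open>n - 1\<close> bounds the overlay
    cardinality without rounding loss.\<close>
  then obtain n where n: "S < a * (real n + 1) powr s" and least: "\<And>k. k < n \<Longrightarrow> \<not> S < a * (real k + 1) powr s"
    using exists_least_iff[of "\<lambda>n. S < a * (real n + 1) powr s"] by blast
  let ?p = "(real n + 1) powr s"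
  have p: "0 < ?p" by simp
  have "ennreal ?p * (INF T\<in>meshes_upto T0 n. ennreal (tot T)) \<le> approx_norm T0 s tot"
    unfolding approx_norm_def by (rule SUP_upper) simp
  also have "\<dots> < ennreal (?p * a)" using n S by (simp add: ennreal_lessI mult.commute)
  also have "\<dots> = ennreal ?p * ennreal a" using a by (simp add: ennreal_mult)
  finally have "(INF T\<in>meshes_upto T0 n. ennreal (tot T)) < ennreal a"
    by (metis mult_left_mono not_le zero_le)
  then obtain T' where T': "T' \<in> meshes T0" "card T' - card T0 \<le> n" "tot T' < a"
    using tot_nonneg by (auto simp: INF_less_iff meshes_upto_def ennreal_less_iff)
  obtain J where J: "J \<in> meshes TH" "J \<in> meshes T'" "card (TH - J) + card T0 \<le> card T'"
    using overlay[OF T0 TH T'(1)] by blast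
  have "tot J \<le> Cmon * tot T'" by (rule quasi_monotone[OF T'(1) J(2)])
  also have "\<dots> \<le> Cmon * a" using T' bounds by simp
  also have "\<dots> = kappa Cstab Cdrel \<theta> * tot TH" using bounds by (simp add: a_def)
  finally have "TH - J \<in> doerfler \<theta> TH (loc TH)"
    using doerfler_optimality[OF TH J(1) \<theta>(1,2)] by (simp add: doerfler_def tot_def)
  moreover have "real (card (TH - J)) powr s * a \<le> S"
  proof (cases n)
    case 0
    then have "card (TH - J) = 0" using J(3) T'(2) by linarith
    then show ?thesis using S by simp
  next
    case (Suc k)
    have "real (card (TH - J)) powr s \<le> (real k + 1) powr s"
      using J T' Suc s by (intro powr_mono2) auto
    then have "real (card (TH - J)) powr s * a \<le> a * (real k + 1) powr s" using a by (simp add: mult.commute)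
    also have "\<dots> \<le> S" using least[of k] Suc by simp
    finally show ?thesis .
  qed
  ultimately show ?thesis unfolding a_def by blast
qed

lemma quasi_minimal_marking:
  assumes TH: "TH \<in> meshes T0" and \<theta>: "0 < \<theta>" "\<theta> < 1" "0 < kappa Cstab Cdrel \<theta>" and s: "0 < s" and Cmark: "1 \<le> Cmark"
    and S: "0 \<le> S" "approx_norm T0 s tot = ennreal S"
    and M: "M \<in> doerfler_quasi_min \<theta> Cmark TH (loc TH)"
  shows "(real (card M) / Cmark) powr s * (kappa Cstab Cdrel \<theta> / Cmon * tot TH) \<le> S"
proof -
  obtain R where R: "R \<in> doerfler \<theta> TH (loc TH)" "real (card R) powr s * (kappa Cstab Cdrel \<theta> / Cmon * tot TH) \<le> S"
    using doerfler_set_of_optimal_size[OF TH \<theta> s S] by (elim bexE)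
  have "finite (doerfler \<theta> TH (loc TH))"
    using mesh_finite[OF TH] unfolding doerfler_def by simp
  then have "Min (card ` doerfler \<theta> TH (loc TH)) \<le> card R" using R(1) by simp
  then have "Cmark * real (Min (card ` doerfler \<theta> TH (loc TH))) \<le> Cmark * real (card R)"
    using Cmark by (intro mult_left_mono of_nat_mono) auto
  then have "real (card M) \<le> Cmark * real (card R)" using M by (auto simp: doerfler_quasi_min_def)
  then have "real (card M) / Cmark \<le> real (card R)" using Cmark by (simp add: field_simps)
  then have "(real (card M) / Cmark) powr s * (kappa Cstab Cdrel \<theta> / Cmon * tot TH) \<le> real (card R) powr s * (kappa Cstab Cdrel \<theta> / Cmon * tot TH)"
    using Cmark s \<theta> bounds tot_nonneg by (intro mult_right_mono powr_mono2) auto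
  then show ?thesis using R(2) by simp
qed

text \<open>The index set collects every step whose marked set meets the criterion for this
  estimator, whichever estimator it was selected for. Reliability supplies
  \<open>D = Cdrel\<^sup>2\<close>.\<close>

lemma history:
  assumes T: "T 0 = T0" "\<And>l. is_refine (T l) (M l) (T (Suc l))" and \<theta>: "0 < \<theta>" "\<theta> < 1"
  shows "estimator_history (max 1 Cmon) (q_est qred \<theta>) Cstab (Cdrel\<^sup>2) (\<lambda>l. tot (T l)) (\<lambda>l. Q (T l))
    {l. \<theta> * (tot (T l))\<^sup>2 \<le> (est (loc (T l)) (M l))\<^sup>2}"
proof -
  have step: "T (Suc l) \<in> meshes (T l)" for l using T(2) by (meson meshes.base meshes.step)
  have mono: "T k \<in> meshes (T l)" if "l \<le> k" for l k
    using that by (induction rule: dec_induct) (auto intro: meshes.base meshes_trans step)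
  have Tm: "T l \<in> meshes T0" for l using mono[of 0 l] T(1) by simp
  have disj: "M l \<subseteq> T l - T k" if "l < k" for l k
  proof -
    have M: "M l \<subseteq> T l" "M l \<inter> T (Suc l) = {}" using T(2) by (auto simp: is_refine_def)
    have "packing (T l)" using nvb_packing(1)[OF meshes_nvb(1)[OF Tm] T0(1)] .
    then have "K \<notin> T k" if "K \<in> M l" for K
      using nvb_no_return[OF meshes_nvb(1)[OF step[of l]] meshes_nvb(1)[OF mono[of "Suc l" k]], of K] M that \<open>l < k\<close>
      by (meson Suc_leI disjoint_iff subsetD)
    then show ?thesis using M by blast
  qed
  have Qm: "Q (T l) \<le> Q (T k)" if "l \<le> k" for l k
    using energy[OF Tm mono[OF that]] by (metis diff_ge_0_iff_ge zero_le_power2)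
  have QD: "Q (T k) - Q (T l) \<le> Cdrel\<^sup>2 * (tot (T l))\<^sup>2" if "l \<le> k" for l k
  proof -
    have "sqrt (Q (T k) - Q (T l)) \<le> Cdrel * est (loc (T l)) (T l - T k)"
      by (rule reliable[OF Tm mono[OF that]])
    also have "\<dots> \<le> Cdrel * tot (T l)"
      unfolding tot_def using bounds mesh_finite[OF Tm] by (intro mult_left_mono est_mono) auto
    finally have "(sqrt (Q (T k) - Q (T l)))\<^sup>2 \<le> (Cdrel * tot (T l))\<^sup>2"
      using Qm[OF that] by (intro power_mono) auto
    then show ?thesis using Qm[OF that] by (simp add: power_mult_distrib)
  qed
  have qm: "tot (T k) \<le> max 1 Cmon * tot (T l)" if "l \<le> k" for l k
    using quasi_monotone[OF Tm mono[OF that]] mult_right_mono[OF max.cobounded2 tot_nonneg] by (rule order_trans)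
  show ?thesis
    unfolding estimator_history_def marked_history_def
    using tot_nonneg qm Qm QD perturbed_monotone[OF Tm mono] doerfler_reduction[OF Tm mono disj]
    by (simp add: less_imp_le)
qed

end

section \<open>Convergence rates of the adaptive algorithm\<close>

lemma fe_space_mono:
  assumes "nvb_refinement T T'" "packing T"
  shows "fe_space \<Omega> p T \<subseteq> fe_space \<Omega> p T'"
proof
  fix v assume v: "v \<in> fe_space \<Omega> p T"
  show "v \<in> fe_space \<Omega> p T'"
    unfolding fe_space_def
  proof (intro CollectI conjI ballI)
    show "v \<in> H10 \<Omega>" using v by (simp add: fe_space_def)
    fix K assume "K \<in> T'"
    then obtain L where L: "L \<in> T" "simplex_of K \<subseteq> simplex_of L" using nvb_ancestor[OF assms] by blast
    then obtain q where q: "poly_fun p q" "AE x in lebesgue_on (simplex_of L). v x = q x"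
      using v by (auto simp: fe_space_def)
    have meas: "simplex_of K' \<in> sets lebesgue" for K' :: "'a element"
      by (rule fmeasurableD, rule lmeasurable_compact)
        (simp add: simplex_of_def vertices_def finite_imp_compact_convex_hull)
    have "AE x in lebesgue. x \<in> simplex_of L \<longrightarrow> v x = q x"
      using q(2) meas by (subst (asm) AE_restrict_space_iff) auto
    then have "AE x in lebesgue. x \<in> simplex_of K \<longrightarrow> v x = q x"
      by eventually_elim (use L in blast)
    then have "AE x in lebesgue_on (simplex_of K). v x = q x"
      using meas by (subst AE_restrict_space_iff) auto
    then show "\<exists>q. poly_fun p q \<and> (AE x in lebesgue_on (simplex_of K). v x = q x)" using q(1) by blast
  qed
qed

text \<open>\<open>2 \<le> N\<close> keeps the maximum over a nonempty set; its entries with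
  negative index are zero and harmless, as estimators are nonnegative.\<close>

lemma regular_step_iff:
  assumes N: "2 \<le> N" and \<rho>: "0 < \<rho>"
  shows "\<rho> * Max ((\<lambda>i. zeta_active N \<zeta> T (int l - int i)) ` {1..N - 1}) \<le> zeta_active N \<zeta> T (int l)
    \<longleftrightarrow> regular_step N \<rho> (\<lambda>j l. est (\<zeta> j (T l)) (T l)) l"
proof -
  let ?z = "\<lambda>j l. est (\<zeta> j (T l)) (T l)"
  let ?S = "(\<lambda>i. zeta_active N \<zeta> T (int l - int i)) ` {1..N - 1}"
  have S: "finite ?S" "?S \<noteq> {}" using N by auto
  have a: "zeta_active N \<zeta> T (int l) = active N ?z l"
    by (simp add: zeta_active_def active_def)
  have b: "zeta_active N \<zeta> T (int l - int i) = (if i \<le> l then active N ?z (l - i) else 0)" for i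
    by (auto simp: zeta_active_def active_def nat_diff_distrib')
  have "\<rho> * Max ?S \<le> active N ?z l \<longleftrightarrow> (\<forall>x\<in>?S. \<rho> * x \<le> active N ?z l)"
  proof
    assume le: "\<rho> * Max ?S \<le> active N ?z l"
    show "\<forall>x\<in>?S. \<rho> * x \<le> active N ?z l"
    proof
      fix x assume "x \<in> ?S"
      then have "\<rho> * x \<le> \<rho> * Max ?S" using S(1) \<rho> by (intro mult_left_mono Max_ge) auto
      then show "\<rho> * x \<le> active N ?z l" using le by linarith
    qed
  next
    assume "\<forall>x\<in>?S. \<rho> * x \<le> active N ?z l"
    then show "\<rho> * Max ?S \<le> active N ?z l" using Max_in[OF S] by (rule bspec)
  qed
  also have "\<dots> \<longleftrightarrow> regular_step N \<rho> ?z l"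
  proof -
    have "0 \<le> active N ?z l" by (simp add: active_def est_nonneg)
    then show ?thesis unfolding regular_step_def by (auto simp: b)
  qed
  finally show ?thesis by (simp add: a)
qed

text \<open>Take \<open>n = 0\<close>: proper refinements have more elements, so only
  \<open>T0\<close> competes.\<close>

lemma approx_norm_ge: "ennreal (\<mu> T0) \<le> approx_norm T0 r \<mu>" if "packing T0" for \<mu> :: "'n::finite mesh \<Rightarrow> real"
proof -
  have "T = T0" if T: "T \<in> meshes_upto T0 0" for T
  proof (rule ccontr)
    assume "T \<noteq> T0"
    then have "card T0 < card T"
      using nvb_packing(3)[OF meshes_nvb(1) \<open>packing T0\<close>, of T] T by (auto simp: meshes_upto_def)
    then show False using T by (simp add: meshes_upto_def)
  qed
  then have "ennreal (\<mu> T0) \<le> ennreal ((real 0 + 1) powr r) * (INF T\<in>meshes_upto T0 0. ennreal (\<mu> T))"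
    by (auto intro!: INF_greatest)
  also have "\<dots> \<le> approx_norm T0 r \<mu>" unfolding approx_norm_def by (rule SUP_upper) simp
  finally show ?thesis .
qed

lemma ennreal_finite: "x \<noteq> top \<Longrightarrow> \<exists>r. 0 \<le> r \<and> x = ennreal r"
  by (cases x) auto

text \<open>As \<open>m\<close> is controlled by both marked sets, \<open>m powr (s + t)\<close>
  splits into a power \<open>s\<close> charged to the primal and a power \<open>t\<close> charged to
  the dual class. One \<open>Cmark\<close> stems from uniting the sets, the other from their
  quasi-minimality.\<close>

lemma regular_marking_bound:
  fixes m U V e z Z cu cz s t c Cmark C :: real
  assumes st: "0 < s" "0 < t" and Cmark: "1 \<le> Cmark" and m: "0 \<le> m" "m \<le> Cmark * cu" "m \<le> Cmark * cz"
    and u: "(cu / Cmark) powr s * (c * e) \<le> U" and z: "(cz / Cmark) powr t * (c * z) \<le> V"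
    and c: "0 < c" and e: "0 \<le> e" and z0: "0 \<le> z" "Z \<le> C * z" and C: "0 \<le> C"
  shows "m powr (s + t) * (e * Z) \<le> (Cmark\<^sup>2) powr (s + t) * C / c\<^sup>2 * (U * V)"
proof -
  define a where "a = m / Cmark\<^sup>2"
  have a: "0 \<le> a" "a \<le> cu / Cmark" "a \<le> cz / Cmark"
    using m Cmark by (auto simp: a_def power2_eq_square field_simps)
  have "a powr s * (c * e) \<le> (cu / Cmark) powr s * (c * e)" using a st c e by (intro mult_right_mono powr_mono2) auto
  then have 1: "a powr s * (c * e) \<le> U" using u by simp
  have "a powr t * (c * z) \<le> (cz / Cmark) powr t * (c * z)" using a st c z0 by (intro mult_right_mono powr_mono2) auto
  then have 2: "a powr t * (c * z) \<le> V" using z by simp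
  have "0 \<le> a powr s * (c * e)" using c e by simp
  then have 3: "(a powr s * (c * e)) * (a powr t * (c * z)) \<le> U * V"
    using 1 2 c z0 by (intro mult_mono) auto
  have ma: "m powr (s + t) = (Cmark\<^sup>2) powr (s + t) * a powr (s + t)"
    using m(1) Cmark a(1) powr_mult[of "Cmark\<^sup>2" a "s + t"] by (simp add: a_def)
  have "m powr (s + t) * (e * Z) \<le> m powr (s + t) * (e * (C * z))"
    using e z0 by (intro mult_left_mono) auto
  also have "\<dots> = (Cmark\<^sup>2) powr (s + t) * C / c\<^sup>2 * ((a powr s * (c * e)) * (a powr t * (c * z)))"
    using c unfolding ma powr_add[of a] by (simp add: power2_eq_square field_simps)
  also have "\<dots> \<le> (Cmark\<^sup>2) powr (s + t) * C / c\<^sup>2 * (U * V)"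
    using 3 C by (intro mult_left_mono) auto
  finally show ?thesis .
qed

text \<open>Linear convergence enters as the rule \<open>lin\<close> with given \<open>B\<close> and
  \<open>mu\<close>, so that the final constant can be named before the data are fixed.\<close>

lemma ngo_afem_rate:
  fixes T0 :: "'n::finite mesh" and \<eta> :: "'n mesh \<Rightarrow> 'n element \<Rightarrow> real"
    and \<zeta> :: "nat \<Rightarrow> 'n mesh \<Rightarrow> 'n element \<Rightarrow> real"
  assumes su: "estimator_setting T0 X nrm Cstab qred Cdrel Cmon \<mu>u wu Qu"
    and sz: "\<And>j. j \<in> {1..N} \<Longrightarrow> estimator_setting T0 X nrm Cstab qred Cdrel Cmon (\<mu>z j) (wz j) (Qz j)"
    and \<eta>: "\<And>TH. \<eta> TH = \<mu>u TH (wu TH)" and \<zeta>: "\<And>j TH. \<zeta> j TH = \<mu>z j TH (wz j TH)"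
    and Cmesh: "0 < Cmesh" "mesh_closure T0 Cmesh" and N: "2 \<le> N" and Cmark: "1 \<le> Cmark"
    and \<theta>: "0 < \<theta>" "\<theta> < 1" "0 < kappa Cstab Cdrel \<theta>" and \<rho>: "0 < \<rho>" "\<rho> \<le> 1" and st: "0 < s" "0 < t"
    and B: "0 < B" "0 < mu" "mu < 1"
    and lin: "\<And>x y R R' P P' k n. \<lbrakk>estimator_history (max 1 Cmon) (q_est qred \<theta>) Cstab (Cdrel\<^sup>2) x R P;
       \<And>i. i \<in> {1..N} \<Longrightarrow> estimator_history (max 1 Cmon) (q_est qred \<theta>) Cstab (Cdrel\<^sup>2) (y i) (R' i) (P' i);
       \<And>l. regular_step N \<rho> y l \<Longrightarrow> l \<in> P \<or> l \<in> P' (l mod N + 1)\<rbrakk>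
     \<Longrightarrow> x (k + n) * (\<Sum>i=1..N. y i (k + n)) \<le> B * mu ^ n * (x k * (\<Sum>i=1..N. y i k))"
    and ngo: "NGO_AFEM N \<theta> \<rho> Cmark T0 \<eta> \<zeta> T Mu Mz Mmin Muz M"
  defines "C1 \<equiv> (Cmark\<^sup>2) powr (s + t) * (real N * max 1 Cmon / \<rho>) / (kappa Cstab Cdrel \<theta> / Cmon)\<^sup>2"
  defines "C2 \<equiv> (Cmesh * B powr (1 / (s + t)) / (1 - mu powr (1 / (s + t))) + 1) powr (s + t)"
  defines "\<Delta> \<equiv> (\<lambda>l. error_product N \<eta> \<zeta> (T l))"
  defines "C0 \<equiv> Max ((\<lambda>k. real (card (M k)) * \<Delta> k powr (1 / (s + t))) ` {0..N - 2})"
  shows "(SUP l. ennreal ((real (card (T l)) - real (card T0) + 1) powr (s + t) * \<Delta> l))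
    \<le> ennreal (C2 * ((B + 1) * (C1 + real N + 1))) * max (ennreal (C0 powr (s + t)))
         (Max ((\<lambda>j. approx_norm T0 s (\<lambda>TH. est (\<eta> TH) TH) *
                    approx_norm T0 t (\<lambda>TH. est (\<zeta> j TH) TH)) ` {1..N}))"
proof -
  let ?u = "approx_norm T0 s (\<lambda>TH. est (\<eta> TH) TH)" and ?v = "\<lambda>j. approx_norm T0 t (\<lambda>TH. est (\<zeta> j TH) TH)"
  let ?W = "max (ennreal (C0 powr (s + t))) (Max ((\<lambda>j. ?u * ?v j) ` {1..N}))"
  let ?Cg = "(B + 1) * (C1 + real N + 1)" and ?\<sigma> = "s + t" and ?C = "max 1 Cmon" and ?\<kappa> = "kappa Cstab Cdrel \<theta> / Cmon"
  define e where "e l = est (\<eta> (T l)) (T l)" for l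
  define z where "z j l = est (\<zeta> j (T l)) (T l)" for j l
  define m where "m l = real (card (M l))" for l
  interpret u: estimator_setting T0 X nrm Cstab qred Cdrel Cmon \<mu>u wu Qu by (rule su)
  have uloc: "u.loc = \<eta>" "u.tot = (\<lambda>TH. est (\<eta> TH) TH)"
    by (auto simp: u.loc_def u.tot_def \<eta>)
  have zloc: "estimator_setting.loc (\<mu>z j) (wz j) = \<zeta> j"
    "estimator_setting.tot (\<mu>z j) (wz j) = (\<lambda>TH. est (\<zeta> j TH) TH)" if "j \<in> {1..N}" for j
    using estimator_setting.loc_def[OF sz[OF that]] estimator_setting.tot_def[OF sz[OF that]]
    by (auto simp: \<zeta>)
  have T: "T 0 = T0" "\<And>l. is_refine (T l) (M l) (T (Suc l))" using ngo by (auto simp: NGO_AFEM_def)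
  have Tm: "T l \<in> meshes T0" for l
    by (induction l) (auto simp: T(1) intro: meshes.base meshes.step[OF _ T(2)])
  have e0: "0 \<le> e l" and z0: "0 \<le> z j l" for j l by (simp_all add: e_def z_def est_nonneg)
  have \<Delta>: "\<Delta> l = e l * (\<Sum>i=1..N. z i l)" for l by (simp add: \<Delta>_def error_product_def e_def z_def)
  have act_idx: "l mod N + 1 \<in> {1..N}" for l using N by (simp add: Suc_leI)
  have act: "active N z l = z (l mod N + 1) l" for l by (simp add: active_def)
  define Pu where "Pu = {l. \<theta> * (e l)\<^sup>2 \<le> (est (\<eta> (T l)) (M l))\<^sup>2}"
  define Pz where "Pz j = {l. \<theta> * (z j l)\<^sup>2 \<le> (est (\<zeta> j (T l)) (M l))\<^sup>2}" for j
  have hu: "estimator_history ?C (q_est qred \<theta>) Cstab (Cdrel\<^sup>2) e (\<lambda>l. Qu (T l)) Pu"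
    using u.history[OF T \<theta>(1,2)] by (simp add: uloc Pu_def e_def[abs_def])
  have hz: "estimator_history ?C (q_est qred \<theta>) Cstab (Cdrel\<^sup>2) (z j) (\<lambda>l. Qz j (T l)) (Pz j)" if "j \<in> {1..N}" for j
    using estimator_setting.history[OF sz[OF that] T \<theta>(1,2)] by (simp add: zloc[OF that] Pz_def z_def[abs_def])
  have zmono: "z j k \<le> ?C * z j l" if "j \<in> {1..N}" "l \<le> k" for j k l
    using hz[OF that(1)] that(2) unfolding estimator_history_def marked_history_def by blast
  have step: "Mu l \<in> doerfler_quasi_min \<theta> Cmark (T l) (\<eta> (T l))"
    "Mz l \<in> doerfler_quasi_min \<theta> Cmark (T l) (\<zeta> (l mod N + 1) (T l))"
    "Mmin l \<in> {Mu l, Mz l}" "card (Mmin l) = min (card (Mu l)) (card (Mz l))"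
    "Mmin l \<subseteq> Muz l" "Muz l \<subseteq> Mu l \<union> Mz l" "real (card (Muz l)) \<le> Cmark * real (card (Mmin l))"
    "if regular_step N \<rho> z l then M l = Muz l else M l \<subseteq> Muz l \<and> card (M l) \<le> card (M (l - 1))" for l
    using ngo unfolding NGO_AFEM_def regular_step_iff[OF N \<rho>(1)] z_def[symmetric] by blast+
  \<comment> \<open>A regular step retains \<open>Mmin\<close>, a Doerfler set for one of the two
    estimators; which one remains open.\<close>
  have marked: "l \<in> Pu \<or> l \<in> Pz (l mod N + 1)" if reg: "regular_step N \<rho> z l" for l
  proof -
    have sub: "Mmin l \<subseteq> M l" "M l \<subseteq> T l" using step(5,8)[of l] reg T(2)[of l] by (auto simp: is_refine_def)
    have le: "(est f (Mmin l))\<^sup>2 \<le> (est f (M l))\<^sup>2" for f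
      using sub u.mesh_finite[OF Tm[of l]] finite_subset by (intro power_mono est_mono est_nonneg) blast+
    show ?thesis
      using step(1,2,3)[of l] le[of "\<eta> (T l)"] le[of "\<zeta> (l mod N + 1) (T l)"]
      by (auto simp: doerfler_quasi_min_def doerfler_def Pu_def Pz_def e_def z_def)
  qed
  have conv: "\<Delta> (k + n) \<le> B * mu ^ n * \<Delta> k" for k n
    unfolding \<Delta> by (rule lin[OF hu hz marked])
  have conv1: "\<Delta> k \<le> B * \<Delta> l" if "l \<le> k" for k l
  proof -
    have "\<Delta> (l + (k - l)) \<le> B * mu ^ (k - l) * \<Delta> l" by (rule conv)
    also have "\<dots> \<le> B * 1 * \<Delta> l"
      using B e0 z0 unfolding \<Delta> by (intro mult_right_mono mult_left_mono power_le_one mult_nonneg_nonneg sum_nonneg) auto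
    finally show ?thesis using that by simp
  qed
  have \<Delta>0: "0 \<le> \<Delta> l" for l unfolding \<Delta> using e0 z0 by (intro mult_nonneg_nonneg sum_nonneg)
  have C1: "0 \<le> C1" using \<rho> by (simp add: C1_def)
  have "mu powr (1 / ?\<sigma>) < mu powr 0" using B st by (intro powr_less_mono') auto
  then have nu: "mu powr (1 / ?\<sigma>) < 1" using B by simp
  have "0 < Cmesh * B powr (1 / ?\<sigma>) / (1 - mu powr (1 / ?\<sigma>)) + 1"
    using Cmesh B nu by (intro add_nonneg_pos divide_nonneg_nonneg mult_nonneg_nonneg) auto
  then have C2: "0 < C2" by (simp add: C2_def)
  have Cg: "0 < ?Cg" using B C1 by (intro mult_pos_pos) auto
  show ?thesis
  proof (cases "?W = top")
    case True
    have "ennreal (C2 * ?Cg) * ?W = top"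
      unfolding True using mult_pos_pos[OF C2 Cg] by (simp only: ennreal_mult_eq_top_iff ennreal_eq_0_iff not_le) blast
    then show ?thesis by simp
  next
    case False
    then obtain w where w: "0 \<le> w" "?W = ennreal w" using ennreal_finite by blast
    have uv: "?u * ?v j \<le> ennreal w" if "j \<in> {1..N}" for j
    proof -
      have "?u * ?v j \<le> Max ((\<lambda>j. ?u * ?v j) ` {1..N})" using that by (intro Max_ge) auto
      then show ?thesis unfolding w(2)[symmetric] by (rule max.coboundedI2)
    qed
    have C0w: "C0 powr ?\<sigma> \<le> w"
    proof -
      have "ennreal (C0 powr ?\<sigma>) \<le> ennreal w" unfolding w(2)[symmetric] by (rule max.cobounded1)
      then show ?thesis using w(1) by (simp add: ennreal_le_iff)
    qed
    have "(real (card (T l)) - real (card T0) + 1) powr ?\<sigma> * \<Delta> l \<le> C2 * ?Cg * w" for l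
    proof (cases "\<Delta> 0 = 0")
      case True
      then have "\<Delta> l = 0" using conv1[of 0 l] \<Delta>0[of l] by simp
      then show ?thesis using C2 Cg w by simp
    next
      case False
      then have "e 0 \<noteq> 0" "(\<Sum>i=1..N. z i 0) \<noteq> 0" by (auto simp: \<Delta>)
      then obtain j0 where j0: "j0 \<in> {1..N}" "z j0 0 \<noteq> 0" by (meson sum.neutral)
      have pos: "0 < e 0" "0 < z j0 0" using \<open>e 0 \<noteq> 0\<close> j0 e0[of 0] z0[of j0 0] by auto
      have ue: "ennreal (e 0) \<le> ?u" using approx_norm_ge[OF u.T0(1)] by (simp add: e_def T(1))
      have vz: "ennreal (z j 0) \<le> ?v j" for j
        using approx_norm_ge[OF u.T0(1), of "\<lambda>TH. est (\<zeta> j TH) TH"] by (simp add: z_def T(1))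
      \<comment> \<open>Since \<open>0 * top = 0\<close> in \<open>ennreal\<close>, finite products
        alone do not make the factors finite; the positive initial estimators exclude this
        case.\<close>
      have ne: "?u \<noteq> 0" "?v j0 \<noteq> 0" using ue vz[of j0] pos by (auto simp: ennreal_eq_0_iff)
      have "?u \<noteq> top" using uv[OF j0(1)] ne by (auto simp: ennreal_top_mult top_unique)
      then obtain U where U: "0 \<le> U" "?u = ennreal U" using ennreal_finite by blast
      have "\<exists>V. 0 \<le> V \<and> ?v j = ennreal V" if "j \<in> {1..N}" for j
      proof -
        have "?v j \<noteq> top" using uv[OF that] ne by (auto simp: ennreal_mult_top top_unique)
        then show ?thesis by (rule ennreal_finite)
      qed
      then obtain V where V: "\<And>j. j \<in> {1..N} \<Longrightarrow> 0 \<le> V j \<and> ?v j = ennreal (V j)" by metis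
      have UV: "U * V j \<le> w" if "j \<in> {1..N}" for j
        using uv[OF that] V[OF that] U w by (simp add: ennreal_mult[symmetric] ennreal_le_iff)
      have eU: "e 0 \<le> U" using ue U by (simp add: ennreal_le_iff)
      have zV: "z j 0 \<le> V j" if "j \<in> {1..N}" for j using vz[of j] V[OF that] by (simp add: ennreal_le_iff)
      have "\<Delta> 0 = (\<Sum>i=1..N. e 0 * z i 0)" by (simp add: \<Delta> sum_distrib_left)
      also have "\<dots> \<le> (\<Sum>i=1..N. w)"
      proof (rule sum_mono)
        fix i assume i: "i \<in> {1..N}"
        have "e 0 * z i 0 \<le> U * V i" using eU zV[OF i] U z0 by (intro mult_mono) auto
        then show "e 0 * z i 0 \<le> w" using UV[OF i] by simp
      qed
      finally have \<Delta>w: "\<Delta> 0 \<le> real N * w" by simp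
      \<comment> \<open>One constant serves three bounds: \<open>real N\<close> for
        \<open>\<Delta> 0\<close>, \<open>C1\<close> for regular steps, \<open>1\<close> for the
        first steps; \<open>B\<close> pays for passing to a later step.\<close>
      have Bw: "B * x \<le> ?Cg * w" if "x \<le> (C1 + real N + 1) * w" for x
      proof -
        have "B * x \<le> B * ((C1 + real N + 1) * w)" using that B by simp
        also have "\<dots> \<le> (B + 1) * ((C1 + real N + 1) * w)" using C1 w by (intro mult_right_mono) auto
        finally show ?thesis by (simp add: mult_ac)
      qed
      have \<Delta>G: "\<Delta> l \<le> ?Cg * w"
      proof -
        have "real N * w \<le> (C1 + real N + 1) * w" using C1 w by (intro mult_right_mono) auto
        then have "B * \<Delta> 0 \<le> ?Cg * w" using \<Delta>w by (intro Bw) simp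
        then show ?thesis using conv1[of 0 l] by simp
      qed
      \<comment> \<open>\<open>Suc k < N\<close> is the range of the maximum in \<open>C0\<close>;
        from \<open>k = N - 1\<close> on every goal has been active, as dominance in a regular step
        requires.\<close>
      have good: "m k powr ?\<sigma> * \<Delta> k \<le> (C1 + 1) * w" if k: "Suc k < N \<or> regular_step N \<rho> z k" for k
      proof (cases "Suc k < N")
        case True
        have "m k * \<Delta> k powr (1 / ?\<sigma>) \<le> C0"
          unfolding C0_def m_def using True by (intro Max_ge) auto
        then have "(m k * \<Delta> k powr (1 / ?\<sigma>)) powr ?\<sigma> \<le> C0 powr ?\<sigma>"
          using st by (intro powr_mono2) (auto simp: m_def)
        also have "(m k * \<Delta> k powr (1 / ?\<sigma>)) powr ?\<sigma> = m k powr ?\<sigma> * \<Delta> k"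
          using st \<Delta>0[of k] powr_mult[of "m k" "\<Delta> k powr (1 / ?\<sigma>)" ?\<sigma>] by (simp add: m_def powr_powr)
        finally have "m k powr ?\<sigma> * \<Delta> k \<le> 1 * w" using C0w by simp
        also have "\<dots> \<le> (C1 + 1) * w" using C1 w by (intro mult_right_mono) auto
        finally show ?thesis .
      next
        case False
        then have reg: "regular_step N \<rho> z k" and Nk: "N \<le> Suc k" using k by auto
        let ?j = "k mod N + 1"
        have dom: "\<rho> * z i k \<le> ?C * z ?j k" if "i \<in> {1..N}" for i
          using regular_step_dominates[OF reg Nk \<rho> _ that] zmono[OF that] z0 by (simp add: act)
        have "\<rho> * (\<Sum>i=1..N. z i k) \<le> (\<Sum>i=1..N. ?C * z ?j k)"
          unfolding sum_distrib_left by (intro sum_mono dom)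
        then have Z: "(\<Sum>i=1..N. z i k) \<le> (real N * ?C / \<rho>) * z ?j k"
          using \<rho> by (simp add: field_simps)
        have Mk: "m k \<le> Cmark * real (min (card (Mu k)) (card (Mz k)))"
          using step(4,7,8)[of k] reg by (simp add: m_def)
        have "Cmark * real (min (card (Mu k)) (card (Mz k))) \<le> Cmark * real (card (Mu k))"
          "Cmark * real (min (card (Mu k)) (card (Mz k))) \<le> Cmark * real (card (Mz k))"
          using Cmark by (auto intro!: mult_left_mono)
        then have mk: "m k \<le> Cmark * real (card (Mu k))" "m k \<le> Cmark * real (card (Mz k))" using Mk by linarith+
        have qu: "(real (card (Mu k)) / Cmark) powr s * (?\<kappa> * e k) \<le> U"
          using u.quasi_minimal_marking[OF Tm \<theta> st(1) Cmark U(1), of "Mu k" k] step(1)[of k] U(2)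
          by (simp add: uloc e_def)
        have qz: "(real (card (Mz k)) / Cmark) powr t * (?\<kappa> * z ?j k) \<le> V ?j"
          using estimator_setting.quasi_minimal_marking[OF sz[OF act_idx] Tm \<theta> st(2) Cmark, of "V ?j" k "Mz k" k]
            V[OF act_idx[of k]] step(2)[of k] by (simp add: zloc[OF act_idx[of k], simplified] z_def)
        have "m k powr ?\<sigma> * \<Delta> k \<le> C1 * (U * V ?j)"
          unfolding \<Delta> C1_def
          by (rule regular_marking_bound[OF st Cmark _ mk qu qz])
            (use \<theta> u.bounds e0 z0 Z \<rho> in \<open>auto simp: m_def\<close>)
        also have "\<dots> \<le> C1 * w" using UV[OF act_idx] C1 by (rule mult_left_mono)
        also have "\<dots> \<le> (C1 + 1) * w" using w by (intro mult_right_mono) auto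
        finally show ?thesis .
      qed
      \<comment> \<open>The cardinality constraint of irregular steps is followed backwards until a
        step of known cost; step \<open>0\<close> is one because \<open>2 \<le> N\<close>.\<close>
      have earlier: "\<exists>k'\<le>k. (Suc k' < N \<or> regular_step N \<rho> z k') \<and> m k \<le> m k'" for k
      proof (induction k)
        case 0 then show ?case using N by auto
      next
        case (Suc k)
        show ?case
        proof (cases "regular_step N \<rho> z (Suc k)")
          case True then show ?thesis by blast
        next
          case False
          then have "m (Suc k) \<le> m k" using step(8)[of "Suc k"] by (simp add: m_def)
          then show ?thesis using Suc.IH by (meson le_SucI order_trans)
        qed
      qed
      have mG: "m k powr ?\<sigma> * \<Delta> k \<le> ?Cg * w" for k
      proof -
        obtain k' where k': "k' \<le> k" "Suc k' < N \<or> regular_step N \<rho> z k'" "m k \<le> m k'" using earlier by blast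
        have "m k powr ?\<sigma> * \<Delta> k \<le> m k' powr ?\<sigma> * (B * \<Delta> k')"
          using k' conv1[OF k'(1)] \<Delta>0 st by (intro mult_mono powr_mono2) (auto simp: m_def)
        also have "\<dots> = B * (m k' powr ?\<sigma> * \<Delta> k')" by simp
        also have "\<dots> \<le> ?Cg * w"
        proof (rule Bw)
          have "(C1 + 1) * w \<le> (C1 + real N + 1) * w" using w by (intro mult_right_mono) auto
          then show "m k' powr ?\<sigma> * \<Delta> k' \<le> (C1 + real N + 1) * w" using good[OF k'(2)] by simp
        qed
        finally show ?thesis .
      qed
      have "card T0 \<le> card (T l)" by (rule nvb_packing(2)[OF meshes_nvb(1)[OF Tm] u.T0(1)])
      then have c0: "0 \<le> real (card (T l)) - real (card T0)" by simp
      have cl: "real (card (T l)) - real (card T0) \<le> Cmesh * (\<Sum>k<l. m k)"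
        using Cmesh(2)[unfolded mesh_closure_def, rule_format, of T l M] T by (simp add: m_def)
      show ?thesis
        unfolding C2_def mult.assoc[of _ ?Cg w]
        by (rule algebraic_rate[where c = "\<lambda>l. real (card (T l)) - real (card T0)" and m = m])
          (use B st Cmesh conv \<Delta>0 \<Delta>G mG c0 cl in \<open>auto simp: m_def\<close>)
    qed
    then have "ennreal ((real (card (T l)) - real (card T0) + 1) powr ?\<sigma> * \<Delta> l) \<le> ennreal (C2 * ?Cg) * ?W" for l
      using C2 Cg w by (simp add: ennreal_mult[symmetric] ennreal_leI)
    then show ?thesis by (rule SUP_least)
  qed
qed

text \<open>Testing the fine problem with the coarse solution gives
  \<open>a(w_h, w_H) = F(w_H) = a(w_H, w_H)\<close>, so the mixed term turns the squared distance
  into a difference of energies. The disjunction covers primal and dual problems.\<close>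

lemma galerkin_setting:
  fixes \<Omega> :: "(real^'n::finite) set" and T0 :: "'n mesh"
  assumes \<Omega>: "bounded \<Omega>" "open \<Omega>" and A: "Linf_on \<Omega> A" "uniformly_spd \<Omega> A"
    and T0: "packing T0" "conforming T0"
    and bounds: "0 < Cstab" "0 < Cdrel" "0 < Cmon" "0 < qred" "qred < 1"
    and props: "estimator_properties T0 (fe_space \<Omega> p) (energy_norm \<Omega> A) Cstab qred Cdrel Cmon \<mu> w"
    and w: "\<And>TH. TH \<in> meshes T0 \<Longrightarrow> w TH \<in> fe_space \<Omega> p TH"
    and galerkin: "\<And>TH v. TH \<in> meshes T0 \<Longrightarrow> v \<in> fe_space \<Omega> p TH \<Longrightarrow> bilin \<Omega> A (w TH) v = F v \<or> bilin \<Omega> A v (w TH) = F v"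
  shows "estimator_setting T0 (fe_space \<Omega> p) (energy_norm \<Omega> A) Cstab qred Cdrel Cmon \<mu> w
    (\<lambda>TH. bilin \<Omega> A (w TH) (w TH))"
proof
  have H1: "v \<in> H1 \<Omega>" if "v \<in> fe_space \<Omega> p TH" for v TH using that by (simp add: fe_space_def H10_def)
  show nested: "fe_space \<Omega> p TH \<subseteq> fe_space \<Omega> p Th" if "TH \<in> meshes T0" "Th \<in> meshes TH" for TH Th
    using fe_space_mono[OF meshes_nvb(1)[OF that(2)] nvb_packing(1)[OF meshes_nvb(1)[OF that(1)] T0(1)]] .
  fix TH Th assume m: "TH \<in> meshes T0" "Th \<in> meshes TH"
  have m': "Th \<in> meshes T0" by (rule meshes_trans[OF m])
  have wX: "w TH \<in> fe_space \<Omega> p TH" "w TH \<in> fe_space \<Omega> p Th" "w Th \<in> fe_space \<Omega> p Th"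
    using w m m' nested[OF m] by auto
  note d = energy_norm_diff[OF \<Omega> A]
  have "bilin \<Omega> A (w TH) (w TH) = F (w TH)" using galerkin[OF m(1) wX(1)] by auto
  moreover have "bilin \<Omega> A (w Th) (w TH) = F (w TH)"
    using galerkin[OF m' wX(2)] d(1)[OF H1[OF wX(3)] H1[OF wX(1)]] by auto
  ultimately show "(energy_norm \<Omega> A (\<lambda>x. w Th x - w TH x))\<^sup>2 = bilin \<Omega> A (w Th) (w Th) - bilin \<Omega> A (w TH) (w TH)"
    using d(2)[OF H1[OF wX(3)] H1[OF wX(1)]] by simp
qed (use assms energy_norm_nonneg(2) in auto)

text \<open>The order of quantifiers expresses what the constant may depend on: it precedes the
  coefficient, the data, the polynomial degree and all choices of the algorithm. Values in
  \<open>ennreal\<close> include solutions with infinite approximation norm.\<close>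

theorem theorem9:
  fixes \<Omega> :: "(real^'n::finite) set" and T0 :: "'n mesh" and N :: nat
    and Cstab Cdrel Cmon qred Cmesh Cmark \<theta> \<rho> s t :: real
  assumes "bounded \<Omega>" and "lipschitz_domain \<Omega>" and "conforming_triangulation \<Omega> T0"
    and "0 < Cmesh" and "mesh_closure T0 Cmesh"
    and "2 \<le> N"
    and "0 < Cstab" and "0 < Cdrel" and "0 < Cmon" and "0 < qred" and "qred < 1"
    and "1 \<le> Cmark"
    and "0 < \<theta>" and "\<theta> < theta_star Cstab Cdrel"
    and "0 < \<rho>" and "\<rho> < (1 - q_est qred \<theta>) / (real N - 1)"
    and "0 < s" and "0 < t"
  shows "\<exists>Copt>0. \<forall>A f ff g gg p u z uH zH T Mu Mz Mmin Muz M.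
    admissible_coefficient \<Omega> T0 A \<longrightarrow>
    admissible_rhs \<Omega> T0 f ff \<longrightarrow>
    (\<forall>j\<in>{1..N}. admissible_rhs \<Omega> T0 (g j) (gg j)) \<longrightarrow>
    1 \<le> p \<longrightarrow>
    solves_primal \<Omega> A f ff (H10 \<Omega>) u \<longrightarrow>
    (\<forall>j\<in>{1..N}. solves_dual \<Omega> A (g j) (gg j) (H10 \<Omega>) (z j)) \<longrightarrow>
    (\<forall>TH\<in>meshes T0. solves_primal \<Omega> A f ff (fe_space \<Omega> p TH) (uH TH)) \<longrightarrow>
    (\<forall>j\<in>{1..N}. \<forall>TH\<in>meshes T0. solves_dual \<Omega> A (g j) (gg j) (fe_space \<Omega> p TH) (zH j TH)) \<longrightarrow>
    estimator_properties T0 (fe_space \<Omega> p) (energy_norm \<Omega> A) Cstab qred Cdrel Cmon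
      (residual_indicator \<Omega> A f ff) uH \<longrightarrow>
    (\<forall>j\<in>{1..N}. estimator_properties T0 (fe_space \<Omega> p) (energy_norm \<Omega> A) Cstab qred Cdrel Cmon
      (residual_indicator \<Omega> A (g j) (gg j)) (zH j)) \<longrightarrow>
    (let \<eta> = (\<lambda>TH. residual_indicator \<Omega> A f ff TH (uH TH));
         \<zeta> = (\<lambda>j TH. residual_indicator \<Omega> A (g j) (gg j) TH (zH j TH));
         \<Delta> = (\<lambda>l. error_product N \<eta> \<zeta> (T l));
         C0 = Max ((\<lambda>k. real (card (M k)) * \<Delta> k powr (1 / (s + t))) ` {0..N - 2})
     in NGO_AFEM N \<theta> \<rho> Cmark T0 \<eta> \<zeta> T Mu Mz Mmin Muz M \<longrightarrow>
        (SUP l. ennreal ((real (card (T l)) - real (card T0) + 1) powr (s + t) * \<Delta> l))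
        \<le> ennreal Copt * max (ennreal (C0 powr (s + t)))
             (Max ((\<lambda>j. approx_norm T0 s (\<lambda>TH. est (\<eta> TH) TH) *
                        approx_norm T0 t (\<lambda>TH. est (\<zeta> j TH) TH)) ` {1..N})))"
proof -
  let ?C = "max 1 Cmon" and ?q = "q_est qred \<theta>" and ?\<sigma> = "s + t"
  have ts: "theta_star Cstab Cdrel \<le> 1" by (simp add: theta_star_def divide_le_eq add_pos_nonneg)
  then have \<theta>1: "\<theta> < 1" using \<open>\<theta> < theta_star Cstab Cdrel\<close> by simp
  have \<kappa>: "0 < kappa Cstab Cdrel \<theta>"
    using \<open>0 < Cstab\<close> \<open>0 < Cdrel\<close> \<open>\<theta> < theta_star Cstab Cdrel\<close> by (rule kappa_pos)
  have qr: "0 < 1 - qred\<^sup>2" "1 - qred\<^sup>2 < 1"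
    using \<open>0 < qred\<close> \<open>qred < 1\<close> by (auto simp: power_less_one_iff)
  have "(1 - qred\<^sup>2) * \<theta> < 1 * 1"
    using qr \<open>0 < \<theta>\<close> \<theta>1 by (intro mult_strict_mono) simp_all
  moreover have "0 < (1 - qred\<^sup>2) * \<theta>" using qr \<open>0 < \<theta>\<close> by (intro mult_pos_pos)
  ultimately have q: "0 < ?q" "?q < 1" by (simp_all add: q_est_def)
  have \<rho>1: "\<rho> < 1"
  proof -
    have "(1 - ?q) / (real N - 1) \<le> (1 - ?q) / 1" using q \<open>2 \<le> N\<close> by (intro divide_left_mono) auto
    then show ?thesis using \<open>\<rho> < (1 - q_est qred \<theta>) / (real N - 1)\<close> q by simp
  qed
  obtain B mu where B: "0 < B" "0 < mu" "mu < 1"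
    and lin: "\<And>x y R R' P P' k n. \<lbrakk>estimator_history ?C ?q Cstab (Cdrel\<^sup>2) x R P;
       \<And>i. i \<in> {1..N} \<Longrightarrow> estimator_history ?C ?q Cstab (Cdrel\<^sup>2) (y i) (R' i) (P' i);
       \<And>l. regular_step N \<rho> y l \<Longrightarrow> l \<in> P \<or> l \<in> P' (l mod N + 1)\<rbrakk>
     \<Longrightarrow> x (k + n) * (\<Sum>i=1..N. y i (k + n)) \<le> B * mu ^ n * (x k * (\<Sum>i=1..N. y i k))"
    by (rule linear_convergence[of ?C ?q "Cdrel\<^sup>2" Cstab \<rho> N])
      (use q \<open>0 < Cstab\<close> \<open>0 < \<rho>\<close> \<rho>1 \<open>2 \<le> N\<close> in auto)
  define C1 where "C1 = (Cmark\<^sup>2) powr ?\<sigma> * (real N * ?C / \<rho>) / (kappa Cstab Cdrel \<theta> / Cmon)\<^sup>2"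
  define C2 where "C2 = (Cmesh * B powr (1 / ?\<sigma>) / (1 - mu powr (1 / ?\<sigma>)) + 1) powr ?\<sigma>"
  have "mu powr (1 / ?\<sigma>) < mu powr 0" using B \<open>0 < s\<close> \<open>0 < t\<close> by (intro powr_less_mono') auto
  then have nu: "mu powr (1 / ?\<sigma>) < 1" using B by simp
  have "0 < Cmesh * B powr (1 / ?\<sigma>) / (1 - mu powr (1 / ?\<sigma>)) + 1"
    using \<open>0 < Cmesh\<close> B nu by (intro add_nonneg_pos divide_nonneg_nonneg mult_nonneg_nonneg) auto
  then have "0 < C2" by (simp add: C2_def)
  moreover have "0 \<le> C1" using \<open>0 < \<rho>\<close> by (simp add: C1_def)
  ultimately have Copt: "0 < C2 * ((B + 1) * (C1 + real N + 1))"
    using B by (intro mult_pos_pos) auto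
  have pc: "packing T0" "conforming T0"
    using conforming_triangulation_packing \<open>conforming_triangulation \<Omega> T0\<close>
    by (auto simp: conforming_triangulation_def)
  have op: "open \<Omega>" using \<open>lipschitz_domain \<Omega>\<close> by (simp add: lipschitz_domain_def)
  note setting = galerkin_setting[OF \<open>bounded \<Omega>\<close> op _ _ pc \<open>0 < Cstab\<close> \<open>0 < Cdrel\<close> \<open>0 < Cmon\<close> \<open>0 < qred\<close> \<open>qred < 1\<close>]
  show ?thesis
    unfolding Let_def
  proof (intro exI[of _ "C2 * ((B + 1) * (C1 + real N + 1))"] conjI allI impI Copt)
    fix A f ff g gg p u z uH zH T Mu Mz Mmin Muz M
    assume A: "admissible_coefficient \<Omega> T0 A"
      and uH: "\<forall>TH\<in>meshes T0. solves_primal \<Omega> A f ff (fe_space \<Omega> p TH) (uH TH)"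
      and zH: "\<forall>j\<in>{1..N}. \<forall>TH\<in>meshes T0. solves_dual \<Omega> A (g j) (gg j) (fe_space \<Omega> p TH) (zH j TH)"
      and pu: "estimator_properties T0 (fe_space \<Omega> p) (energy_norm \<Omega> A) Cstab qred Cdrel Cmon
        (residual_indicator \<Omega> A f ff) uH"
      and pz: "\<forall>j\<in>{1..N}. estimator_properties T0 (fe_space \<Omega> p) (energy_norm \<Omega> A) Cstab qred Cdrel Cmon
        (residual_indicator \<Omega> A (g j) (gg j)) (zH j)"
      and ngo: "NGO_AFEM N \<theta> \<rho> Cmark T0 (\<lambda>TH. residual_indicator \<Omega> A f ff TH (uH TH))
        (\<lambda>j TH. residual_indicator \<Omega> A (g j) (gg j) TH (zH j TH)) T Mu Mz Mmin Muz M"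
    have A': "Linf_on \<Omega> A" "uniformly_spd \<Omega> A" using A by (auto simp: admissible_coefficient_def)
    have su: "estimator_setting T0 (fe_space \<Omega> p) (energy_norm \<Omega> A) Cstab qred Cdrel Cmon
        (residual_indicator \<Omega> A f ff) uH (\<lambda>TH. bilin \<Omega> A (uH TH) (uH TH))"
      by (rule setting[OF A' pu, where F = "functional \<Omega> f ff"]) (use uH in \<open>auto simp: solves_primal_def\<close>)
    have sz: "estimator_setting T0 (fe_space \<Omega> p) (energy_norm \<Omega> A) Cstab qred Cdrel Cmon
        (residual_indicator \<Omega> A (g j) (gg j)) (zH j) (\<lambda>TH. bilin \<Omega> A (zH j TH) (zH j TH))" if "j \<in> {1..N}" for j
      by (rule setting[OF A' bspec[OF pz that], where F = "functional \<Omega> (g j) (gg j)"])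
        (use zH that in \<open>auto simp: solves_dual_def\<close>)
    note rate = ngo_afem_rate[where \<mu>z = "\<lambda>j. residual_indicator \<Omega> A (g j) (gg j)", OF su sz refl refl
        \<open>0 < Cmesh\<close> \<open>mesh_closure T0 Cmesh\<close> \<open>2 \<le> N\<close> \<open>1 \<le> Cmark\<close> \<open>0 < \<theta>\<close> \<theta>1 \<kappa> \<open>0 < \<rho>\<close> less_imp_le[OF \<rho>1]
        \<open>0 < s\<close> \<open>0 < t\<close> B lin ngo]
    show "(SUP l. ennreal ((real (card (T l)) - real (card T0) + 1) powr (s + t) *
          error_product N (\<lambda>TH. residual_indicator \<Omega> A f ff TH (uH TH))
            (\<lambda>j TH. residual_indicator \<Omega> A (g j) (gg j) TH (zH j TH)) (T l)))
      \<le> ennreal (C2 * ((B + 1) * (C1 + real N + 1))) * max (ennreal (Max ((\<lambda>k. real (card (M k)) *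
            error_product N (\<lambda>TH. residual_indicator \<Omega> A f ff TH (uH TH))
              (\<lambda>j TH. residual_indicator \<Omega> A (g j) (gg j) TH (zH j TH)) (T k) powr (1 / (s + t))) ` {0..N - 2}) powr (s + t)))
           (Max ((\<lambda>j. approx_norm T0 s (\<lambda>TH. est (residual_indicator \<Omega> A f ff TH (uH TH)) TH) *
                      approx_norm T0 t (\<lambda>TH. est (residual_indicator \<Omega> A (g j) (gg j) TH (zH j TH)) TH)) ` {1..N}))"
      unfolding C1_def C2_def by (rule rate)
  qed
qed

end
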